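(* Let $E$ be a finite directed graph, $K$ a field, and $c$ a basic closed path in $E$. Let $U_{E,c-1}$ be the Prüfer left $L_K(E)$-module associated to $c$. Then $U_{E,c-1}$ is an injective left $L_K(E)$-module if and only if $c$ is a maximal cycle. In case $U_{E,c-1}$ is injective, then: (1) $U_{E,c-1}$ is the injective envelope of the Chen simple module $V_{[c^\infty]}$; and (2) the ring $\mathrm{End}_{L_K(E)}(U_{E,c-1})$ is isomorphic to the ring $K[[x]]$ of formal power series in $x$.
   Context: All modules are left modules. A directed graph $E=(E^0,E^1,s,r)$ has vertex set $E^0$, edge set $E^1$, and source and range maps $s,r:E^1\to E^0$; it is finite if $E^0$ and $E^1$ are finite. A path is a sequence $e_1\cdots e_n$ of edges with $r(e_i)=s(e_{i+1})$, with $s(e_1\cdots e_n)=s(e_1)$, $r(e_1\cdots e_n)=r(e_n)$; vertices are paths of length $0$. A closed path is a path $\gamma=e_1\cdots e_n$, $n\ge 1$, with $r(e_n)=s(e_1)$; it is basic if it is not of the form $\delta^k$ with $\delta$ a closed path and $k\ge 2$; it is a cycle if $s(e_i)\ne s(e_j)$ for $i\neq j$. A cyclic shift of $e_1\cdots e_n$ is any closed path $e_ie_{i+1}\cdots e_ne_1\cdots e_{i-1}$, $1\le i\le n$. A vertex $w$ connects to a vertex $v$ if $w=v$ or there is a path from $w$ to $v$; a cycle $d$ connects to $v$ if $s(d)$ does. A cycle $c$ is maximal if no cycle in $E$ other than the cyclic shifts of $c$ connects to $s(c)$. The Leavitt path algebra $L_K(E)$ is the $K$-algebra generated by $E^0\cup\{e,e^*: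 e\in E^1\}$ with relations: $vu=\delta_{v,u}v$ for $v,u\in E^0$; $s(e)e=er(e)=e$ and $r(e)e^*=e^*s(e)=e^*$ for $e\in E^1$; $e^*e'=\delta_{e,e'}r(e)$ for $e,e'\in E^1$; $v=\sum_{s(e)=v}ee^*$ for each $v\in E^0$ with $0<|s^{-1}(v)|<\infty$. For finite $E$ it is unital with $1=\sum_{v\in E^0}v$. Chen simple module: an infinite path is a sequence $e_1e_2e_3\cdots$ of edges with $r(e_i)=s(e_{i+1})$; two infinite paths are tail equivalent if they coincide after deleting suitable finite initial segments; $[p]$ is the tail-equivalence class of $p$; $c^\infty=ccc\cdots$. $V_{[p]}$ is the $K$-vector space with basis $[p]$, with left $L_K(E)$-action given, for $q=f_1f_2\cdots\in[p]$, by $v\cdot q=q$ if $v=s(f_1)$ and $0$ otherwise; $e\cdot q=eq$ if $r(e)=s(f_1)$ and $0$ otherwise; $e^*\cdot q=f_2f_3\cdots$ if $e=f_1$ and $0$ otherwise. Prüfer module: for $n\ge1$ let $M_{E,n,c-1}=L_K(E)/L_K(E)(c-1)^n$, and for $1\le i\le j$ let $\psi_{E,i,j}:M_{E,i,c-1}\to M_{E,j,c-1}$ be the $L_K(E)$-homomorphism with $1+L_K(E)(c-1)^i\mapsto (c-1)^{j-i}+L_K(E)(c-1)^j$ (these are monomorphisms). Then $U_{E,c-1}=\varinjlim\{M_{E,i,c-1},\psi_{E,i,j}\}_{i\le j}$. *)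

theory Defs
  imports
    "HOL-Algebra.Module"
    "HOL-Algebra.QuotRing"
    "HOL-Algebra.Algebraic_Closure_Type"
    "HOL-Computational_Algebra.Formal_Power_Series"
    "HOL-Library.Poly_Mapping"
    "HOL-Library.Stream"
    "Graph_Theory.Arc_Walk"
begin

section \<open>Paths and cycles\<close>

text \<open>
  Directed graphs with loops and parallel edges are those of \<^theory>\<open>Graph_Theory.Digraph\<close>, with
  \<^const>\<open>tail\<close> for the source map and \<^const>\<open>head\<close> for the range map. A path of positive length
  is the list of its edges; closed paths and cycles are \<^const>\<open>wf_digraph.closed_w\<close> and
  \<^const>\<open>pre_digraph.cycle\<close>.
\<close>

definition basic_closed_path :: "('v, 'e) pre_digraph \<Rightarrow> 'e list \<Rightarrow> bool" where
  "basic_closed_path E c \<longleftrightarrow> wf_digraph.closed_w E c \<and>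
     \<not> (\<exists>d k. wf_digraph.closed_w E d \<and> 2 \<le> k \<and> c = concat (replicate k d))"

definition path_source :: "('v, 'e) pre_digraph \<Rightarrow> 'e list \<Rightarrow> 'v" where
  "path_source E p = tail E (hd p)"

definition maximal_cycle :: "('v, 'e) pre_digraph \<Rightarrow> 'e list \<Rightarrow> bool" where
  "maximal_cycle E c \<longleftrightarrow> pre_digraph.cycle E c \<and>
     (\<forall>d. pre_digraph.cycle E d \<and> path_source E d \<rightarrow>\<^sup>*\<^bsub>E\<^esub> path_source E c
        \<longrightarrow> (\<exists>i. d = rotate i c))"

section \<open>Left modules over a not necessarily commutative ring\<close>

text \<open>
  As in \<^theory>\<open>HOL-Algebra.Module\<close>, a module is a record extending that of rings; its fields
  \<^const>\<open>monoid.mult\<close> and \<^const>\<open>one\<close> carry no meaning and are left undefined below, except for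
  the ring regarded as a module over itself. The library locale demands a commutative ring of
  scalars, hence the following variant.
\<close>

locale left_module = R?: ring R + M?: abelian_group M
  for R :: "('r, 's) ring_scheme" (structure) and M :: "('r, 'a, 'x) module_scheme" (structure) +
  assumes smult_closed:
      "\<lbrakk>a \<in> carrier R; x \<in> carrier M\<rbrakk> \<Longrightarrow> a \<odot>\<^bsub>M\<^esub> x \<in> carrier M"
    and smult_l_distr:
      "\<lbrakk>a \<in> carrier R; b \<in> carrier R; x \<in> carrier M\<rbrakk> \<Longrightarrow>
       (a \<oplus> b) \<odot>\<^bsub>M\<^esub> x = a \<odot>\<^bsub>M\<^esub> x \<oplus>\<^bsub>M\<^esub> b \<odot>\<^bsub>M\<^esub> x"
    and smult_r_distr:
      "\<lbrakk>a \<in> carrier R; x \<in> carrier M; y \<in> carrier M\<rbrakk> \<Longrightarrow>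
       a \<odot>\<^bsub>M\<^esub> (x \<oplus>\<^bsub>M\<^esub> y) = a \<odot>\<^bsub>M\<^esub> x \<oplus>\<^bsub>M\<^esub> a \<odot>\<^bsub>M\<^esub> y"
    and smult_assoc:
      "\<lbrakk>a \<in> carrier R; b \<in> carrier R; x \<in> carrier M\<rbrakk> \<Longrightarrow>
       (a \<otimes> b) \<odot>\<^bsub>M\<^esub> x = a \<odot>\<^bsub>M\<^esub> (b \<odot>\<^bsub>M\<^esub> x)"
    and smult_one:
      "x \<in> carrier M \<Longrightarrow> \<one> \<odot>\<^bsub>M\<^esub> x = x"

definition module_homs ::
  "('r, 's) ring_scheme \<Rightarrow> ('r, 'a, 'x) module_scheme \<Rightarrow> ('r, 'b, 'y) module_scheme \<Rightarrow> ('a \<Rightarrow> 'b) set"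
  where
  "module_homs R M N = {f \<in> carrier M \<rightarrow> carrier N.
     (\<forall>x\<in>carrier M. \<forall>y\<in>carrier M. f (x \<oplus>\<^bsub>M\<^esub> y) = f x \<oplus>\<^bsub>N\<^esub> f y) \<and>
     (\<forall>a\<in>carrier R. \<forall>x\<in>carrier M. f (a \<odot>\<^bsub>M\<^esub> x) = a \<odot>\<^bsub>N\<^esub> f x)}"

text \<open>Endomorphisms are made extensional so that equality in the record is equality of maps on
  the carrier.\<close>

definition End_ring :: "('r, 's) ring_scheme \<Rightarrow> ('r, 'a, 'x) module_scheme \<Rightarrow> ('a \<Rightarrow> 'a) ring" where
  "End_ring R M = \<lparr>
     carrier = module_homs R M M \<inter> extensional (carrier M),
     monoid.mult = compose (carrier M),
     one = (\<lambda>x\<in>carrier M. x),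
     ring.zero = (\<lambda>x\<in>carrier M. \<zero>\<^bsub>M\<^esub>),
     add = (\<lambda>f g. \<lambda>x\<in>carrier M. f x \<oplus>\<^bsub>M\<^esub> g x)\<rparr>"

definition regular_module :: "('r, 's) ring_scheme \<Rightarrow> ('r, 'r) module" where
  "regular_module R = \<lparr>carrier = carrier R, monoid.mult = monoid.mult R, one = one R,
     ring.zero = ring.zero R, add = add R, module.smult = monoid.mult R\<rparr>"

definition quotient_module :: "('r, 'a, 'x) module_scheme \<Rightarrow> 'a set \<Rightarrow> ('r, 'a set) module" where
  "quotient_module M N = \<lparr>carrier = a_rcosets\<^bsub>M\<^esub> N, monoid.mult = undefined, one = undefined,
     ring.zero = N, add = set_add M, module.smult = (\<lambda>a S. \<Union>x\<in>S. N +>\<^bsub>M\<^esub> (a \<odot>\<^bsub>M\<^esub> x))\<rparr>"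

subsection \<open>Injective modules and injective envelopes\<close>

text \<open>
  HOL cannot quantify over all modules inside a formula, so the test modules \<open>A\<close> and \<open>B\<close> have their
  carriers in a type \<open>'m\<close> that is a parameter of the notion. If the elements of \<open>R\<close> embed into \<open>'m\<close>,
  then all inclusions of left ideals into \<open>R\<close> occur among the test maps up to isomorphism, so that by
  Baer's criterion the notion is the usual one and no longer depends on \<open>'m\<close>. It should be used
  with such an \<open>'m\<close> only; a type of the form \<open>'r + 'm\<close> with \<open>'m\<close> arbitrary ensures this.
\<close>

definition injective_module ::
  "'m itself \<Rightarrow> ('r, 's) ring_scheme \<Rightarrow> ('r, 'u, 'x) module_scheme \<Rightarrow> bool" where
  "injective_module (_ :: 'm itself) R U \<longleftrightarrow> left_module R U \<and>
     (\<forall>(A :: ('r, 'm) module) (B :: ('r, 'm) module) f g.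
        left_module R A \<and> left_module R B \<and>
        f \<in> module_homs R A B \<and> inj_on f (carrier A) \<and> g \<in> module_homs R A U
        \<longrightarrow> (\<exists>h\<in>module_homs R B U. \<forall>x\<in>carrier A. h (f x) = g x))"

definition injective_envelope ::
  "'m itself \<Rightarrow> ('r, 's) ring_scheme \<Rightarrow> ('r, 'v, 'y) module_scheme \<Rightarrow> ('r, 'u, 'x) module_scheme \<Rightarrow> bool"
  where
  "injective_envelope T R V U \<longleftrightarrow> left_module R V \<and> injective_module T R U \<and>
     (\<exists>f\<in>module_homs R V U. inj_on f (carrier V) \<and>
        (\<forall>N. submodule N R U \<and> N \<noteq> {\<zero>\<^bsub>U\<^esub>} \<longrightarrow> N \<inter> f ` carrier V \<noteq> {\<zero>\<^bsub>U\<^esub>}))"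

subsection \<open>Direct limits over a set of natural numbers\<close>

text \<open>
  The direct limit is the disjoint union of the modules \<open>M i\<close>, \<open>i \<in> I\<close>, modulo
  the identification of elements with a common image further up.
\<close>

definition dirlim_rel ::
  "nat set \<Rightarrow> (nat \<Rightarrow> ('r, 'a, 'x) module_scheme) \<Rightarrow> (nat \<Rightarrow> nat \<Rightarrow> 'a \<Rightarrow> 'a) \<Rightarrow>
   ((nat \<times> 'a) \<times> (nat \<times> 'a)) set" where
  "dirlim_rel I M \<psi> = {((i, x), (j, y)). i \<in> I \<and> j \<in> I \<and> x \<in> carrier (M i) \<and> y \<in> carrier (M j) \<and>
     (\<exists>k\<in>I. i \<le> k \<and> j \<le> k \<and> \<psi> i k x = \<psi> j k y)}"

definition direct_limit ::
  "nat set \<Rightarrow> (nat \<Rightarrow> ('r, 'a, 'x) module_scheme) \<Rightarrow> (nat \<Rightarrow> nat \<Rightarrow> 'a \<Rightarrow> 'a) \<Rightarrow>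
   ('r, (nat \<times> 'a) set) module" where
  "direct_limit I M \<psi> = \<lparr>
     carrier = (SIGMA i:I. carrier (M i)) // dirlim_rel I M \<psi>,
     monoid.mult = undefined, one = undefined,
     ring.zero = (\<Union>i\<in>I. dirlim_rel I M \<psi> `` {(i, \<zero>\<^bsub>M i\<^esub>)}),
     add = (\<lambda>S T. \<Union>(i, x)\<in>S. \<Union>(j, y)\<in>T. dirlim_rel I M \<psi> ``
              {(max i j, \<psi> i (max i j) x \<oplus>\<^bsub>M (max i j)\<^esub> \<psi> j (max i j) y)}),
     module.smult = (\<lambda>a S. \<Union>(i, x)\<in>S. dirlim_rel I M \<psi> `` {(i, a \<odot>\<^bsub>M i\<^esub> x)})\<rparr>"

section \<open>Leavitt path algebras\<close>

text \<open>
  The free monoid on \<open>'x\<close>, written additively because multiplication on \<open>'a \<Rightarrow>\<^sub>0 'k\<close> is the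
  convolution with respect to addition on \<open>'a\<close>; thus \<open>'x fword \<Rightarrow>\<^sub>0 'k\<close> is the free
  associative unital algebra on \<open>'x\<close>.
\<close>

datatype 'x fword = FWord (letters: "'x list")

instantiation fword :: (type) monoid_add
begin

definition zero_fword :: "'a fword" where
  "zero_fword = FWord []"

definition plus_fword :: "'a fword \<Rightarrow> 'a fword \<Rightarrow> 'a fword" where
  "plus_fword u w = FWord (letters u @ letters w)"

instance
  by standard (simp_all add: zero_fword_def plus_fword_def)

end

definition free_algebra :: "'x set \<Rightarrow> ('x fword \<Rightarrow>\<^sub>0 'k::field) ring" where
  "free_algebra S = ring_of_type_algebra
     \<lparr>carrier := {a. \<forall>w\<in>Poly_Mapping.keys a. set (letters w) \<subseteq> S}\<rparr>"

datatype ('v, 'e) lpa_gen = Vertex 'v | Edge 'e | Ghost 'e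

definition lpa_gens :: "('v, 'e) pre_digraph \<Rightarrow> ('v, 'e) lpa_gen set" where
  "lpa_gens E = Vertex ` verts E \<union> Edge ` arcs E \<union> Ghost ` arcs E"

type_synonym ('v, 'e, 'k) lpa_free = "('v, 'e) lpa_gen fword \<Rightarrow>\<^sub>0 'k"

type_synonym ('v, 'e, 'k) lpa = "('v, 'e, 'k) lpa_free set"

definition monomial :: "'x list \<Rightarrow> 'x fword \<Rightarrow>\<^sub>0 'k::field" where
  "monomial xs = Poly_Mapping.single (FWord xs) 1"

text \<open>
  The last relation is not among the defining relations of the algebra without prescribed unit:
  since the free algebra used here is unital, it identifies the added unit with
  the sum of the vertices, which is the unit of the Leavitt path algebra of a finite graph. (An
  infinite graph is not covered by this definition.)
\<close>

inductive_set lpa_relations :: "('v, 'e) pre_digraph \<Rightarrow> ('v, 'e, 'k::field) lpa_free set"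
  for E :: "('v, 'e) pre_digraph" where
  vertices: "\<lbrakk>v \<in> verts E; u \<in> verts E\<rbrakk> \<Longrightarrow>
    monomial [Vertex v, Vertex u] - (if v = u then monomial [Vertex v] else 0) \<in> lpa_relations E"
| source_edge: "e \<in> arcs E \<Longrightarrow>
    monomial [Vertex (tail E e), Edge e] - monomial [Edge e] \<in> lpa_relations E"
| edge_range: "e \<in> arcs E \<Longrightarrow>
    monomial [Edge e, Vertex (head E e)] - monomial [Edge e] \<in> lpa_relations E"
| range_ghost: "e \<in> arcs E \<Longrightarrow>
    monomial [Vertex (head E e), Ghost e] - monomial [Ghost e] \<in> lpa_relations E"
| ghost_source: "e \<in> arcs E \<Longrightarrow>
    monomial [Ghost e, Vertex (tail E e)] - monomial [Ghost e] \<in> lpa_relations E"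
| CK1: "\<lbrakk>e \<in> arcs E; e' \<in> arcs E\<rbrakk> \<Longrightarrow>
    monomial [Ghost e, Edge e'] - (if e = e' then monomial [Vertex (head E e)] else 0)
      \<in> lpa_relations E"
| CK2: "\<lbrakk>v \<in> verts E; finite (out_arcs E v); out_arcs E v \<noteq> {}\<rbrakk> \<Longrightarrow>
    monomial [Vertex v] - (\<Sum>e\<in>out_arcs E v. monomial [Edge e, Ghost e]) \<in> lpa_relations E"
| unit: "1 - (\<Sum>v\<in>verts E. monomial [Vertex v]) \<in> lpa_relations E"

definition lpa_ideal :: "('v, 'e) pre_digraph \<Rightarrow> ('v, 'e, 'k::field) lpa_free set" where
  "lpa_ideal E = genideal (free_algebra (lpa_gens E)) (lpa_relations E)"

definition leavitt_path_algebra :: "'k itself \<Rightarrow> ('v, 'e) pre_digraph \<Rightarrow> ('v, 'e, 'k::field) lpa ring"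
  where
  "leavitt_path_algebra _ E = free_algebra (lpa_gens E) Quot lpa_ideal E"

definition lpa_path :: "('v, 'e) pre_digraph \<Rightarrow> 'e list \<Rightarrow> ('v, 'e, 'k::field) lpa" where
  "lpa_path E p = lpa_ideal E +>\<^bsub>free_algebra (lpa_gens E)\<^esub> monomial (map Edge p)"

section \<open>Chen modules\<close>

text \<open>Infinite paths are streams of edges.\<close>

definition infinite_path :: "('v, 'e) pre_digraph \<Rightarrow> 'e stream \<Rightarrow> bool" where
  "infinite_path E p \<longleftrightarrow> (\<forall>n. p !! n \<in> arcs E \<and> head E (p !! n) = tail E (p !! Suc n))"

definition tail_class :: "('v, 'e) pre_digraph \<Rightarrow> 'e stream \<Rightarrow> 'e stream set" where
  "tail_class E p = {q. infinite_path E q \<and> (\<exists>m n. sdrop m p = sdrop n q)}"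

definition linear_extension :: "('a \<Rightarrow> ('b \<Rightarrow>\<^sub>0 'k)) \<Rightarrow> ('a \<Rightarrow>\<^sub>0 'k::field) \<Rightarrow> ('b \<Rightarrow>\<^sub>0 'k)" where
  "linear_extension f x =
     (\<Sum>a\<in>Poly_Mapping.keys x. Poly_Mapping.map ((*) (Poly_Mapping.lookup x a)) (f a))"

fun gen_action ::
  "('v, 'e) pre_digraph \<Rightarrow> ('v, 'e) lpa_gen \<Rightarrow> 'e stream \<Rightarrow> ('e stream \<Rightarrow>\<^sub>0 'k::field)" where
  "gen_action E (Vertex v) q = (if v = tail E (shd q) then Poly_Mapping.single q 1 else 0)"
| "gen_action E (Edge e) q = (if head E e = tail E (shd q) then Poly_Mapping.single (e ## q) 1 else 0)"
| "gen_action E (Ghost e) q = (if e = shd q then Poly_Mapping.single (stl q) 1 else 0)"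

definition word_action ::
  "('v, 'e) pre_digraph \<Rightarrow> ('e stream \<Rightarrow>\<^sub>0 'k::field) \<Rightarrow> ('v, 'e) lpa_gen fword \<Rightarrow> ('e stream \<Rightarrow>\<^sub>0 'k)" where
  "word_action E x w = foldr (\<lambda>g. linear_extension (gen_action E g)) (letters w) x"

text \<open>
  A coset acts through any of its representatives; the action of the free algebra on the span of a
  tail class respects the relations, so that all representatives give the same result.
\<close>

definition chen_module ::
  "'k itself \<Rightarrow> ('v, 'e) pre_digraph \<Rightarrow> 'e stream \<Rightarrow> (('v, 'e, 'k::field) lpa, 'e stream \<Rightarrow>\<^sub>0 'k) module"
  where
  "chen_module _ E p = \<lparr>
     carrier = {x. Poly_Mapping.keys x \<subseteq> tail_class E p},
     monoid.mult = undefined, one = undefined, ring.zero = 0, add = (+),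
     module.smult = (\<lambda>A x. THE y. \<forall>a\<in>A. linear_extension (word_action E x) a = y)\<rparr>"

section \<open>Pruefer modules\<close>

definition left_ideal_power ::
  "'k itself \<Rightarrow> ('v, 'e) pre_digraph \<Rightarrow> 'e list \<Rightarrow> nat \<Rightarrow> ('v, 'e, 'k::field) lpa set" where
  "left_ideal_power K E c n = (let L = leavitt_path_algebra K E in
     {a \<otimes>\<^bsub>L\<^esub> (lpa_path E c \<ominus>\<^bsub>L\<^esub> \<one>\<^bsub>L\<^esub>) [^]\<^bsub>L\<^esub> n | a. a \<in> carrier L})"

definition prufer_level ::
  "'k itself \<Rightarrow> ('v, 'e) pre_digraph \<Rightarrow> 'e list \<Rightarrow> nat \<Rightarrow>
   (('v, 'e, 'k::field) lpa, ('v, 'e, 'k) lpa set) module" where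
  "prufer_level K E c n =
     quotient_module (regular_module (leavitt_path_algebra K E)) (left_ideal_power K E c n)"

text \<open>
  For \<open>i \<le> j\<close>, the homomorphism sending \<open>1 + L(c - 1)\<^sup>i\<close> to \<open>(c - 1)\<^sup>j\<^sup>-\<^sup>i + L(c - 1)\<^sup>j\<close>, that is,
  \<open>a + L(c - 1)\<^sup>i\<close> to \<open>a(c - 1)\<^sup>j\<^sup>-\<^sup>i + L(c - 1)\<^sup>j\<close>.
\<close>

definition prufer_map ::
  "'k itself \<Rightarrow> ('v, 'e) pre_digraph \<Rightarrow> 'e list \<Rightarrow> nat \<Rightarrow> nat \<Rightarrow>
   ('v, 'e, 'k::field) lpa set \<Rightarrow> ('v, 'e, 'k) lpa set" where
  "prufer_map K E c i j S = (let L = leavitt_path_algebra K E in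
     \<Union>a\<in>S. left_ideal_power K E c j +>\<^bsub>L\<^esub>
       (a \<otimes>\<^bsub>L\<^esub> (lpa_path E c \<ominus>\<^bsub>L\<^esub> \<one>\<^bsub>L\<^esub>) [^]\<^bsub>L\<^esub> (j - i)))"

definition prufer_module ::
  "'k itself \<Rightarrow> ('v, 'e) pre_digraph \<Rightarrow> 'e list \<Rightarrow>
   (('v, 'e, 'k::field) lpa, (nat \<times> ('v, 'e, 'k) lpa set) set) module" where
  "prufer_module K E c = direct_limit {1..} (prufer_level K E c) (prufer_map K E c)"

end

theory Submission
  imports Defs "HOL-Computational_Algebra.Polynomial_FPS"
begin

text \<open>
  Let \<open>C\<close> be the tail class of \<open>z = c\<^sup>\<infinity>\<close>, and let \<open>K[[x]]\<close> act on \<open>K[x]\<close> by contraction, \<open>x\<close> shifting the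
  coefficients down. The functions from \<open>C\<close> to \<open>K[x]\<close> carry an action of the Leavitt path algebra like
  that on the Chen module, except that an edge contributes a factor \<open>1 + x\<close> when it is prepended
  to give \<open>z\<close>. Then \<open>c - 1\<close> acts at \<open>z\<close> as \<open>x\<close>, and the Pruefer module is isomorphic to the submodule
  of finitely supported functions.

  The module of all functions is always injective: \<open>K[x]\<close> is a divisible, hence injective, module over
  the polynomials in \<open>c - 1\<close>, and a homomorphism into the functions is determined by its value at \<open>z\<close>. If
  \<open>c\<close> is a maximal cycle then \<open>C\<close> is finite and both modules coincide. Otherwise there is a closed
  path \<open>d\<close> at the source of a path \<open>q \<in> C\<close> that does not begin with \<open>d\<close>, and for \<open>u\<close> supported at \<open>q\<close>
  the equation \<open>(d - 1) y = u\<close> has a solution, but none of finite support.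

  The Chen module consists of the functions with constant values; it is essential because ghost paths
  and powers of \<open>c - 1\<close> turn any finitely supported function into a constant at \<open>z\<close>. An endomorphism maps
  functions supported at \<open>z\<close> to such functions and commutes with the shift there, so it is contraction with
  a power series.
\<close>

section \<open>Power series acting on polynomials\<close>

text \<open>Contraction is Macaulay's inverse system: K[x] stands for K[x^-1], the injective hull of
  K over K[[x]]. A twist at the single path z suffices because c is basic: under deletion of the
  first edge, C is a tree with root z, closed up by the one loop c, so a turn of c meets z once.
  Baer's criterion over the Leavitt path algebra itself would require control over all its left
  ideals. Instead, only the value at z is extended. A homomorphism h into the functions is recovered
  from the functional x -> (h x)(z) by applying ghost paths first, and the functionals that arise
  are the K[x]-linear ones that vanish on every element killed by the ghost of a prefix of z. The
  extension problem thus moves to the principal ideal domain K[x], where divisibility is enough;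
  because of the vanishing condition, the partial functional to be extended lives on more than the
  given submodule. In the comparison with the direct limit, the generator of level n goes to x^(n-1)
  at z. The difficulty is that the annihilator of this function must be no larger than the left
  ideal generated by (c - 1)^n.\<close>

definition contract :: "'k::field fps \<Rightarrow> 'k poly \<Rightarrow> 'k poly" (infixr \<open>\<rhd>\<close> 70) where
  "f \<rhd> m = Abs_poly (\<lambda>i. \<Sum>j\<le>degree m. fps_nth f j * coeff m (i + j))"

text \<open>Terms beyond the degree vanish, so the summation bound may be enlarged; polynomials of
  different degrees can then be compared over one range.\<close>

lemma coeff_contract_bound:
  assumes "degree m \<le> N"
  shows "coeff (f \<rhd> m) i = (\<Sum>j\<le>N. fps_nth f j * coeff m (i + j))"
proof -
  have "coeff (f \<rhd> m) i = (\<Sum>j\<le>degree m. fps_nth f j * coeff m (i + j))"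
    unfolding contract_def
    by (subst coeff_Abs_poly[where n = "degree m"]) (auto intro!: sum.neutral coeff_eq_0)
  also have "\<dots> = (\<Sum>j\<le>N. fps_nth f j * coeff m (i + j))"
    using assms by (intro sum.mono_neutral_left) (auto intro!: coeff_eq_0)
  finally show ?thesis .
qed

lemma contract_add_right: "f \<rhd> (m + m') = f \<rhd> m + f \<rhd> m'"
proof (rule poly_eqI)
  fix i
  let ?N = "max (degree m) (degree m')"
  have "degree (m + m') \<le> ?N" "degree m \<le> ?N" "degree m' \<le> ?N"
    by (simp_all add: degree_add_le_max)
  then show "coeff (f \<rhd> (m + m')) i = coeff (f \<rhd> m + f \<rhd> m') i"
    by (simp add: coeff_contract_bound[of _ ?N] algebra_simps sum.distrib)
qed

lemma contract_add_left: "(f + g) \<rhd> m = f \<rhd> m + g \<rhd> m"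
  by (rule poly_eqI) (simp add: coeff_contract_bound[OF order_refl] algebra_simps sum.distrib)

lemma contract_zero_right [simp]: "f \<rhd> 0 = 0"
  by (rule poly_eqI) (simp add: coeff_contract_bound[OF order_refl])

lemma contract_zero_left [simp]: "0 \<rhd> m = 0"
  by (rule poly_eqI) (simp add: coeff_contract_bound[OF order_refl])

lemma contract_const [simp]: "fps_const k \<rhd> m = smult k m"
  by (rule poly_eqI) (simp add: coeff_contract_bound[OF order_refl] fps_const_def if_distrib[of "\<lambda>x. x * _"]
      sum.delta cong: if_cong)

lemma contract_one [simp]: "1 \<rhd> m = m"
  using contract_const[of 1 m] by simp

text \<open>The composite is a sum over a square of index pairs. Its terms outside the triangle
  \<open>a + b \<le> ?N\<close> vanish for degree reasons, and the triangle gives the Cauchy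
  product.\<close>

lemma contract_assoc: "(f * g) \<rhd> m = f \<rhd> g \<rhd> m"
proof (rule poly_eqI)
  fix i
  let ?N = "degree m"
  have d: "degree (g \<rhd> m) \<le> ?N"
    by (rule degree_le) (auto simp: coeff_contract_bound[OF order_refl] intro!: sum.neutral coeff_eq_0)
  have "coeff (f \<rhd> g \<rhd> m) i = (\<Sum>a\<le>?N. \<Sum>b\<le>?N. fps_nth f a * fps_nth g b * coeff m (i + a + b))"
    by (simp add: coeff_contract_bound[OF d, of f] coeff_contract_bound[of m, OF order_refl] sum_distrib_left mult.assoc)
  also have "\<dots> = (\<Sum>(a, b)\<in>{..?N} \<times> {..?N}. fps_nth f a * fps_nth g b * coeff m (i + a + b))"
    by (rule sum.cartesian_product)
  also have "\<dots> = (\<Sum>(a, b)\<in>{(a, b). a + b \<le> ?N}. fps_nth f a * fps_nth g b * coeff m (i + a + b))"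
    by (intro sum.mono_neutral_right) (auto intro!: coeff_eq_0)
  also have "\<dots> = (\<Sum>k\<le>?N. \<Sum>a\<le>k. fps_nth f a * fps_nth g (k - a) * coeff m (i + a + (k - a)))"
    by (rule sum.triangle_reindex_eq)
  also have "\<dots> = coeff ((f * g) \<rhd> m) i"
    by (simp add: coeff_contract_bound[OF order_refl] fps_mult_nth sum_distrib_right atLeast0AtMost add.assoc)
  finally show "coeff ((f * g) \<rhd> m) i = coeff (f \<rhd> g \<rhd> m) i" by simp
qed

lemma contract_smult: "f \<rhd> smult k m = smult k (f \<rhd> m)"
  using contract_assoc[of f "fps_const k" m] contract_assoc[of "fps_const k" f m]
  by (simp add: mult.commute)

lemma contract_commute: "f \<rhd> g \<rhd> m = g \<rhd> f \<rhd> m"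
  by (metis contract_assoc mult.commute)

lemma contract_minus_right: "f \<rhd> (- m) = - (f \<rhd> m)"
  using contract_smult[of f "-1" m] by simp

lemma contract_sum_right: "f \<rhd> (\<Sum>i\<in>A. m i) = (\<Sum>i\<in>A. f \<rhd> m i)"
  by (induction A rule: infinite_finite_induct) (simp_all add: contract_add_right)

lemma coeff_X_power_contract: "coeff (fps_X ^ n \<rhd> m) i = coeff m (i + n)"
proof (cases "n \<le> degree m")
  case True
  then show ?thesis
    by (simp add: coeff_contract_bound[OF order_refl] fps_X_power_iff
        if_distrib[of "\<lambda>x. x * _"] sum.delta cong: if_cong)
next
  case False
  then have "coeff m (i + n) = 0" by (intro coeff_eq_0) simp
  then show ?thesis using False
    by (auto simp add: coeff_contract_bound[OF order_refl] fps_X_power_iff intro!: sum.neutral)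
qed

lemma contract_X_power_eq_0: "degree m < n \<Longrightarrow> fps_X ^ n \<rhd> m = 0"
  by (rule poly_eqI) (simp add: coeff_X_power_contract coeff_eq_0)

lemma contract_X_power_monom: "i \<le> n \<Longrightarrow> fps_X ^ i \<rhd> monom k n = monom k (n - i)"
  by (rule poly_eqI) (auto simp: coeff_X_power_contract)

text \<open>f is a power of x times a unit. Multiplication by that power of x is a right inverse of
  the shift, and the unit is undone by its inverse series.\<close>

lemma contract_divisible:
  assumes "f \<noteq> (0 :: 'k::field fps)"
  shows "\<exists>m'. f \<rhd> m' = m"
proof -
  let ?n = "subdegree f"
  have f: "f = fps_X ^ ?n * unit_factor f"
    using assms by (metis fps_unit_factor_def subdegree_decompose mult.commute)
  have u: "fps_nth (unit_factor f) 0 \<noteq> 0" using assms by simp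
  have X: "fps_X ^ ?n \<rhd> (monom 1 ?n * m) = m"
    by (rule poly_eqI) (simp add: coeff_X_power_contract coeff_monom_mult)
  have "f \<rhd> inverse (unit_factor f) \<rhd> (monom 1 ?n * m) =
      ((fps_X ^ ?n * unit_factor f) * inverse (unit_factor f)) \<rhd> (monom 1 ?n * m)"
    by (subst f) (simp only: contract_assoc)
  also have "\<dots> = m"
    using u X by (simp add: mult.assoc inverse_mult_eq_1' )
  finally show ?thesis by blast
qed

text \<open>The coefficients of f up to n can be read off, reversed, from its effect on x^n. Both
  the annihilators of monomials and the series of an endomorphism are found in this way.\<close>

lemma coeff_contract_monom:
  "coeff (f \<rhd> monom (1 :: 'k::field) n) i = (if i \<le> n then fps_nth f (n - i) else 0)"
proof -
  have "coeff (f \<rhd> monom 1 n) i = (\<Sum>j\<le>n. if j = n - i \<and> i \<le> n then fps_nth f j else 0)"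
    by (subst coeff_contract_bound[of _ n]) (auto simp: degree_monom_le intro!: sum.cong)
  then show ?thesis by (auto simp: sum.delta)
qed

lemma contract_monom_eq_0_iff:
  "f \<rhd> monom 1 n = (0 :: 'k::field poly) \<longleftrightarrow> (\<forall>i\<le>n. fps_nth f i = 0)"
proof
  assume "f \<rhd> monom 1 n = 0"
  then have "coeff (f \<rhd> monom 1 n) (n - i) = 0" for i by simp
  then show "\<forall>i\<le>n. fps_nth f i = 0"
    unfolding coeff_contract_monom by (metis diff_diff_cancel diff_le_self)
qed (auto intro!: poly_eqI simp: coeff_contract_monom)

section \<open>Left modules and Baer's criterion\<close>

text \<open>The last premise stands in for the existence of negatives: with it, the scalar -1
  provides them.\<close>

lemma left_moduleI:
  fixes R (structure) and M (structure)
  assumes "ring R"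
    and add_closed: "\<And>x y. \<lbrakk>x \<in> carrier M; y \<in> carrier M\<rbrakk> \<Longrightarrow> x \<oplus>\<^bsub>M\<^esub> y \<in> carrier M"
    and zero_closed: "\<zero>\<^bsub>M\<^esub> \<in> carrier M"
    and add_assoc: "\<And>x y z. \<lbrakk>x \<in> carrier M; y \<in> carrier M; z \<in> carrier M\<rbrakk> \<Longrightarrow>
      (x \<oplus>\<^bsub>M\<^esub> y) \<oplus>\<^bsub>M\<^esub> z = x \<oplus>\<^bsub>M\<^esub> (y \<oplus>\<^bsub>M\<^esub> z)"
    and add_commute: "\<And>x y. \<lbrakk>x \<in> carrier M; y \<in> carrier M\<rbrakk> \<Longrightarrow> x \<oplus>\<^bsub>M\<^esub> y = y \<oplus>\<^bsub>M\<^esub> x"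
    and add_zero: "\<And>x. x \<in> carrier M \<Longrightarrow> \<zero>\<^bsub>M\<^esub> \<oplus>\<^bsub>M\<^esub> x = x"
    and smult_closed: "\<And>a x. \<lbrakk>a \<in> carrier R; x \<in> carrier M\<rbrakk> \<Longrightarrow> a \<odot>\<^bsub>M\<^esub> x \<in> carrier M"
    and smult_l_distr: "\<And>a b x. \<lbrakk>a \<in> carrier R; b \<in> carrier R; x \<in> carrier M\<rbrakk> \<Longrightarrow>
       (a \<oplus> b) \<odot>\<^bsub>M\<^esub> x = a \<odot>\<^bsub>M\<^esub> x \<oplus>\<^bsub>M\<^esub> b \<odot>\<^bsub>M\<^esub> x"
    and smult_r_distr: "\<And>a x y. \<lbrakk>a \<in> carrier R; x \<in> carrier M; y \<in> carrier M\<rbrakk> \<Longrightarrow>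
       a \<odot>\<^bsub>M\<^esub> (x \<oplus>\<^bsub>M\<^esub> y) = a \<odot>\<^bsub>M\<^esub> x \<oplus>\<^bsub>M\<^esub> a \<odot>\<^bsub>M\<^esub> y"
    and smult_assoc: "\<And>a b x. \<lbrakk>a \<in> carrier R; b \<in> carrier R; x \<in> carrier M\<rbrakk> \<Longrightarrow>
       (a \<otimes> b) \<odot>\<^bsub>M\<^esub> x = a \<odot>\<^bsub>M\<^esub> (b \<odot>\<^bsub>M\<^esub> x)"
    and smult_one: "\<And>x. x \<in> carrier M \<Longrightarrow> \<one> \<odot>\<^bsub>M\<^esub> x = x"
    and smult_null: "\<And>x. x \<in> carrier M \<Longrightarrow> \<zero> \<odot>\<^bsub>M\<^esub> x = \<zero>\<^bsub>M\<^esub>"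
  shows "left_module R M"
proof -
  interpret ring R by fact
  have inv: "(\<ominus> \<one>) \<odot>\<^bsub>M\<^esub> x \<oplus>\<^bsub>M\<^esub> x = \<zero>\<^bsub>M\<^esub>" if "x \<in> carrier M" for x
    using smult_l_distr[of "\<ominus> \<one>" \<one> x] smult_one[OF that] smult_null[OF that] that
    by (simp add: l_neg)
  have "abelian_group M"
  proof (rule abelian_groupI)
    fix x assume "x \<in> carrier M"
    then show "\<exists>y\<in>carrier M. y \<oplus>\<^bsub>M\<^esub> x = \<zero>\<^bsub>M\<^esub>"
      using inv smult_closed[of "\<ominus> \<one>" x] by auto
  qed (use assms in auto)
  then show ?thesis
    using assms by (intro left_module.intro left_module_axioms.intro) auto
qed

lemma regular_left_module:
  assumes "ring R"
  shows "left_module R (regular_module R)"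
proof -
  interpret ring R by fact
  show ?thesis
    by (rule left_moduleI)
      (auto simp: regular_module_def a_ac l_distr r_distr m_assoc ring_axioms)
qed

lemma (in abelian_group) add_eq_add_iff_diff:
  assumes "a \<in> carrier G" "b \<in> carrier G" "c \<in> carrier G" "d \<in> carrier G"
  shows "a \<oplus> b = c \<oplus> d \<longleftrightarrow> b \<ominus> d = c \<ominus> a"
proof
  assume "a \<oplus> b = c \<oplus> d"
  then have "\<ominus> a \<oplus> (a \<oplus> b) = \<ominus> a \<oplus> (c \<oplus> d)" by simp
  then have "b = \<ominus> a \<oplus> (c \<oplus> d)" using assms by (simp add: r_neg1)
  then have "b = (c \<ominus> a) \<oplus> d" using assms by (simp add: minus_eq a_assoc a_lcomm[of "\<ominus> a"])
  then show "b \<ominus> d = c \<ominus> a" using assms by (simp add: minus_eq a_assoc r_neg)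
next
  assume "b \<ominus> d = c \<ominus> a"
  then have "a \<oplus> (b \<ominus> d) \<oplus> d = a \<oplus> (c \<ominus> a) \<oplus> d" by simp
  then have "a \<oplus> b = (a \<oplus> (\<ominus> a \<oplus> c)) \<oplus> d"
    using assms by (simp add: minus_eq a_assoc l_neg a_comm[of "\<ominus> a" c])
  then show "a \<oplus> b = c \<oplus> d" using assms by (simp add: r_neg2)
qed

lemma (in left_module) smult_l_null: "x \<in> carrier M \<Longrightarrow> \<zero>\<^bsub>R\<^esub> \<odot>\<^bsub>M\<^esub> x = \<zero>\<^bsub>M\<^esub>"
  by (metis M.add.l_cancel_one' R.l_zero R.zero_closed smult_closed smult_l_distr)

lemma (in left_module) smult_r_null: "a \<in> carrier R \<Longrightarrow> a \<odot>\<^bsub>M\<^esub> \<zero>\<^bsub>M\<^esub> = \<zero>\<^bsub>M\<^esub>"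
  by (metis M.add.l_cancel_one' M.l_zero M.zero_closed smult_closed smult_r_distr)

lemma (in left_module) smult_l_minus:
  assumes "a \<in> carrier R" "x \<in> carrier M"
  shows "(\<ominus>\<^bsub>R\<^esub> a) \<odot>\<^bsub>M\<^esub> x = \<ominus>\<^bsub>M\<^esub> (a \<odot>\<^bsub>M\<^esub> x)"
proof -
  have "(\<ominus>\<^bsub>R\<^esub> a) \<odot>\<^bsub>M\<^esub> x \<oplus>\<^bsub>M\<^esub> a \<odot>\<^bsub>M\<^esub> x = \<zero>\<^bsub>M\<^esub>"
    using assms by (simp flip: smult_l_distr add: R.l_neg smult_l_null)
  then show ?thesis using assms by (simp add: M.minus_equality smult_closed)
qed

lemma (in left_module) smult_l_diff:
  assumes "a \<in> carrier R" "b \<in> carrier R" "x \<in> carrier M"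
  shows "(a \<ominus>\<^bsub>R\<^esub> b) \<odot>\<^bsub>M\<^esub> x = a \<odot>\<^bsub>M\<^esub> x \<ominus>\<^bsub>M\<^esub> b \<odot>\<^bsub>M\<^esub> x"
  using assms by (simp add: R.minus_eq M.minus_eq smult_l_distr smult_l_minus)

lemma (in left_module) uminus_eq_smult:
  "x \<in> carrier M \<Longrightarrow> \<ominus>\<^bsub>M\<^esub> x = (\<ominus>\<^bsub>R\<^esub> \<one>\<^bsub>R\<^esub>) \<odot>\<^bsub>M\<^esub> x"
  by (simp add: smult_l_minus smult_one)

lemma (in left_module) submodule_intro:
  assumes "H \<subseteq> carrier M" "\<zero>\<^bsub>M\<^esub> \<in> H"
    and "\<And>x y. x \<in> H \<Longrightarrow> y \<in> H \<Longrightarrow> x \<oplus>\<^bsub>M\<^esub> y \<in> H"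
    and "\<And>a x. a \<in> carrier R \<Longrightarrow> x \<in> H \<Longrightarrow> a \<odot>\<^bsub>M\<^esub> x \<in> H"
  shows "submodule H R M"
proof -
  have "\<ominus>\<^bsub>M\<^esub> x \<in> H" if "x \<in> H" for x
    using uminus_eq_smult[of x] assms(1) assms(4)[of "\<ominus>\<^bsub>R\<^esub> \<one>\<^bsub>R\<^esub>" x] that by auto
  then show ?thesis
    using assms by unfold_locales (auto simp: a_inv_def)
qed

text \<open>A partial homomorphism from B to P is kept as its graph. Extension is then inclusion of
  sets and unions of chains are again graphs, as Zorn's lemma wants it.\<close>

locale submodule_graph = B?: left_module R B + P?: left_module R P
  for R :: "('r, 's) ring_scheme" (structure) and B :: "('r, 'b, 'x) module_scheme" (structure)
    and P :: "('r, 'p, 'y) module_scheme" (structure) +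
  fixes G :: "('b \<times> 'p) set"
  assumes graph_subset: "G \<subseteq> carrier B \<times> carrier P"
    and graph_zero: "(\<zero>\<^bsub>B\<^esub>, \<zero>\<^bsub>P\<^esub>) \<in> G"
    and graph_add: "\<lbrakk>(x, y) \<in> G; (x', y') \<in> G\<rbrakk> \<Longrightarrow> (x \<oplus>\<^bsub>B\<^esub> x', y \<oplus>\<^bsub>P\<^esub> y') \<in> G"
    and graph_smult: "\<lbrakk>a \<in> carrier R; (x, y) \<in> G\<rbrakk> \<Longrightarrow> (a \<odot>\<^bsub>B\<^esub> x, a \<odot>\<^bsub>P\<^esub> y) \<in> G"
    and graph_unique: "\<lbrakk>(x, y) \<in> G; (x, y') \<in> G\<rbrakk> \<Longrightarrow> y = y'"
begin

text \<open>The scalars that carry b into the domain form a left ideal, and the partial homomorphism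
  induces a homomorphism on it. To this one Baer's hypothesis is applied.\<close>

lemma graph_hom_on_left_ideal:
  assumes b: "b \<in> carrier B"
  defines "J \<equiv> {a \<in> carrier R. \<exists>y. (a \<odot>\<^bsub>B\<^esub> b, y) \<in> G}"
    and "k \<equiv> (\<lambda>a. THE y. (a \<odot>\<^bsub>B\<^esub> b, y) \<in> G)"
  shows "submodule J R (regular_module R)" "k \<in> module_homs R ((regular_module R)\<lparr>carrier := J\<rparr>) P"
    and "\<And>a. a \<in> J \<Longrightarrow> (a \<odot>\<^bsub>B\<^esub> b, k a) \<in> G"
proof -
  interpret reg: left_module R "regular_module R"
    by (rule regular_left_module) unfold_locales
  have kI: "k a = y" if "(a \<odot>\<^bsub>B\<^esub> b, y) \<in> G" for a y
    unfolding k_def using that by (rule the_equality) (rule graph_unique[OF _ that])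
  then show k: "(a \<odot>\<^bsub>B\<^esub> b, k a) \<in> G" if "a \<in> J" for a
    using that unfolding J_def by auto
  show "submodule J R (regular_module R)"
  proof (rule reg.submodule_intro)
    show "\<zero>\<^bsub>regular_module R\<^esub> \<in> J"
      using b graph_zero by (auto simp: regular_module_def J_def B.smult_l_null)
    fix x y assume xy: "x \<in> J" "y \<in> J"
    then show "x \<oplus>\<^bsub>regular_module R\<^esub> y \<in> J"
      using graph_add[OF k[OF xy(1)] k[OF xy(2)]] b
      by (auto simp: regular_module_def J_def B.smult_l_distr)
  next
    fix a x assume "a \<in> carrier R" "x \<in> J"
    then show "a \<odot>\<^bsub>regular_module R\<^esub> x \<in> J"
      using graph_smult[OF _ k, of a x] b
      by (auto simp: regular_module_def J_def B.smult_assoc)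
  qed (auto simp: J_def regular_module_def)
  have "k (x \<oplus> y) = k x \<oplus>\<^bsub>P\<^esub> k y" if "x \<in> J" "y \<in> J" for x y
    using graph_add[OF k[OF that(1)] k[OF that(2)]] that b
    by (intro kI) (auto simp: J_def B.smult_l_distr)
  moreover have "k (a \<otimes> x) = a \<odot>\<^bsub>P\<^esub> k x" if "x \<in> J" "a \<in> carrier R" for a x
    using graph_smult[OF that(2) k[OF that(1)]] that b
    by (intro kI) (auto simp: J_def B.smult_assoc)
  moreover have "k x \<in> carrier P" if "x \<in> J" for x
    using k[OF that] graph_subset by auto
  ultimately show "k \<in> module_homs R ((regular_module R)\<lparr>carrier := J\<rparr>) P"
    by (auto simp: module_homs_def regular_module_def)
qed

text \<open>\<open>compat\<close> says that the value m proposed for b agrees with the values that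
  multiples of b already have; this is what well-definedness on the larger domain amounts
  to.\<close>

lemma graph_extend:
  assumes b: "b \<in> carrier B" and m: "m \<in> carrier P"
    and compat: "\<And>a y. a \<in> carrier R \<Longrightarrow> (a \<odot>\<^bsub>B\<^esub> b, y) \<in> G \<Longrightarrow> y = a \<odot>\<^bsub>P\<^esub> m"
  shows "submodule_graph R B P {(x \<oplus>\<^bsub>B\<^esub> a \<odot>\<^bsub>B\<^esub> b, y \<oplus>\<^bsub>P\<^esub> a \<odot>\<^bsub>P\<^esub> m) | x y a. (x, y) \<in> G \<and> a \<in> carrier R}"
    (is "submodule_graph R B P ?G'")
proof unfold_locales
  have cl: "x \<in> carrier B" "y \<in> carrier P" if "(x, y) \<in> G" for x y using that graph_subset by auto
  note [simp] = B.smult_closed P.smult_closed b m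
  show "?G' \<subseteq> carrier B \<times> carrier P" by (auto dest: cl)
  show "(\<zero>\<^bsub>B\<^esub>, \<zero>\<^bsub>P\<^esub>) \<in> ?G'"
    using graph_zero B.smult_l_null[OF b] P.smult_l_null[OF m]
    by (intro CollectI exI[of _ "\<zero>\<^bsub>B\<^esub>"] exI[of _ "\<zero>\<^bsub>P\<^esub>"] exI[of _ "\<zero>\<^bsub>R\<^esub>"]) simp
  {
    fix s t s' t' assume "(s, t) \<in> ?G'" "(s', t') \<in> ?G'"
    then obtain x y a x' y' a' where *: "(x, y) \<in> G" "a \<in> carrier R" "(x', y') \<in> G" "a' \<in> carrier R"
      and st: "s = x \<oplus>\<^bsub>B\<^esub> a \<odot>\<^bsub>B\<^esub> b" "t = y \<oplus>\<^bsub>P\<^esub> a \<odot>\<^bsub>P\<^esub> m" "s' = x' \<oplus>\<^bsub>B\<^esub> a' \<odot>\<^bsub>B\<^esub> b" "t' = y' \<oplus>\<^bsub>P\<^esub> a' \<odot>\<^bsub>P\<^esub> m"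
      by auto
    note [simp] = cl[OF *(1)] cl[OF *(3)] *(2,4)
    have "s \<oplus>\<^bsub>B\<^esub> s' = (x \<oplus>\<^bsub>B\<^esub> x') \<oplus>\<^bsub>B\<^esub> (a \<oplus> a') \<odot>\<^bsub>B\<^esub> b" "t \<oplus>\<^bsub>P\<^esub> t' = (y \<oplus>\<^bsub>P\<^esub> y') \<oplus>\<^bsub>P\<^esub> (a \<oplus> a') \<odot>\<^bsub>P\<^esub> m"
      unfolding st by (simp_all add: B.smult_l_distr P.smult_l_distr B.M.a_ac P.M.a_ac)
    moreover have "a \<oplus> a' \<in> carrier R" by simp
    ultimately show "(s \<oplus>\<^bsub>B\<^esub> s', t \<oplus>\<^bsub>P\<^esub> t') \<in> ?G'" using graph_add[OF *(1,3)] by blast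
    \<comment> \<open>Two decompositions of one element differ by a multiple of b that lies in the
      old domain, so \<open>compat\<close> determines its value.\<close>
    have "t = t'" if "s = s'"
    proof -
      have "(a \<ominus> a') \<odot>\<^bsub>B\<^esub> b = a \<odot>\<^bsub>B\<^esub> b \<ominus>\<^bsub>B\<^esub> a' \<odot>\<^bsub>B\<^esub> b" by (simp add: B.smult_l_diff)
      also have "\<dots> = x' \<ominus>\<^bsub>B\<^esub> x"
        using that unfolding st by (subst (asm) B.M.add_eq_add_iff_diff) auto
      also have "\<dots> = x' \<oplus>\<^bsub>B\<^esub> (\<ominus> \<one>) \<odot>\<^bsub>B\<^esub> x" by (simp add: B.M.minus_eq B.smult_l_minus B.smult_one)
      finally have "((a \<ominus> a') \<odot>\<^bsub>B\<^esub> b, y' \<oplus>\<^bsub>P\<^esub> (\<ominus> \<one>) \<odot>\<^bsub>P\<^esub> y) \<in> G"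
        using graph_add[OF *(3) graph_smult[OF _ *(1), of "\<ominus> \<one>"]] by simp
      then have "y' \<oplus>\<^bsub>P\<^esub> (\<ominus> \<one>) \<odot>\<^bsub>P\<^esub> y = (a \<ominus> a') \<odot>\<^bsub>P\<^esub> m" by (intro compat) auto
      then have 1: "y' \<ominus>\<^bsub>P\<^esub> y = a \<odot>\<^bsub>P\<^esub> m \<ominus>\<^bsub>P\<^esub> a' \<odot>\<^bsub>P\<^esub> m"
        by (simp add: P.M.minus_eq P.smult_l_minus P.smult_one P.smult_l_diff)
      then show ?thesis unfolding st by (subst P.M.add_eq_add_iff_diff) auto
    qed
  }
  note uniq = this
  show "t = t'" if "(s, t) \<in> ?G'" "(s, t') \<in> ?G'" for s t t'
    by (rule uniq[OF that refl])
  {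
    fix r s t assume r: "r \<in> carrier R" and "(s, t) \<in> ?G'"
    then obtain x y a where *: "(x, y) \<in> G" "a \<in> carrier R"
      and st: "s = x \<oplus>\<^bsub>B\<^esub> a \<odot>\<^bsub>B\<^esub> b" "t = y \<oplus>\<^bsub>P\<^esub> a \<odot>\<^bsub>P\<^esub> m"
      by auto
    note [simp] = cl[OF *(1)] *(2) r
    have "r \<odot>\<^bsub>B\<^esub> s = r \<odot>\<^bsub>B\<^esub> x \<oplus>\<^bsub>B\<^esub> (r \<otimes> a) \<odot>\<^bsub>B\<^esub> b" "r \<odot>\<^bsub>P\<^esub> t = r \<odot>\<^bsub>P\<^esub> y \<oplus>\<^bsub>P\<^esub> (r \<otimes> a) \<odot>\<^bsub>P\<^esub> m"
      unfolding st by (simp_all add: B.smult_r_distr P.smult_r_distr B.smult_assoc P.smult_assoc)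
    moreover have "r \<otimes> a \<in> carrier R" by simp
    ultimately show "(r \<odot>\<^bsub>B\<^esub> s, r \<odot>\<^bsub>P\<^esub> t) \<in> ?G'" using graph_smult[OF r *(1)] by blast
  }
qed

end

text \<open>A maximal extension of the partial homomorphism is total, since the value m that Baer's
  hypothesis supplies for a missing b would enlarge it. The start is an arbitrary graph because the
  later application, over a polynomial ring, has a domain larger than the submodule of
  interest.\<close>

theorem Baer_extension:
  assumes "submodule_graph R B P G0"
    and Baer: "\<And>J k. \<lbrakk>submodule J R (regular_module R); k \<in> module_homs R ((regular_module R)\<lparr>carrier := J\<rparr>) P\<rbrakk>
        \<Longrightarrow> \<exists>m\<in>carrier P. \<forall>a\<in>J. k a = a \<odot>\<^bsub>P\<^esub> m"
  shows "\<exists>h\<in>module_homs R B P. \<forall>(x, y)\<in>G0. h x = y"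
proof -
  interpret G0: submodule_graph R B P G0 by fact
  define \<G> where "\<G> = {G. submodule_graph R B P G \<and> G0 \<subseteq> G}"
  have "\<exists>G\<in>\<G>. \<forall>G'\<in>\<G>. G \<subseteq> G' \<longrightarrow> G' = G"
  proof (rule subset_Zorn_nonempty)
    show "\<G> \<noteq> {}" using assms(1) by (auto simp: \<G>_def)
    fix \<C> assume ne: "\<C> \<noteq> {}" and ch: "subset.chain \<G> \<C>"
    then obtain G1 where G1: "G1 \<in> \<C>" by auto
    have sg: "submodule_graph R B P G" "G0 \<subseteq> G" if "G \<in> \<C>" for G
      using ch that unfolding subset.chain_def \<G>_def by auto
    have dir: "\<exists>G\<in>\<C>. p \<in> G \<and> p' \<in> G" if "p \<in> \<Union>\<C>" "p' \<in> \<Union>\<C>" for p p'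
      using ch that unfolding subset.chain_def by blast
    have "submodule_graph R B P (\<Union>\<C>)"
    proof unfold_locales
      show "\<Union>\<C> \<subseteq> carrier B \<times> carrier P" using submodule_graph.graph_subset[OF sg(1)] by (intro Union_least)
      show "(\<zero>\<^bsub>B\<^esub>, \<zero>\<^bsub>P\<^esub>) \<in> \<Union>\<C>" using G1 submodule_graph.graph_zero[OF sg(1)] by (intro UnionI)
      fix x y x' y' assume "(x, y) \<in> \<Union>\<C>" "(x', y') \<in> \<Union>\<C>"
      then obtain G where "G \<in> \<C>" "(x, y) \<in> G" "(x', y') \<in> G" using dir by meson
      then show "(x \<oplus>\<^bsub>B\<^esub> x', y \<oplus>\<^bsub>P\<^esub> y') \<in> \<Union>\<C>"
        using submodule_graph.graph_add[OF sg(1)] by (intro UnionI)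
    next
      fix x y y' assume "(x, y) \<in> \<Union>\<C>" "(x, y') \<in> \<Union>\<C>"
      then obtain G where "G \<in> \<C>" "(x, y) \<in> G" "(x, y') \<in> G" using dir by meson
      then show "y = y'" using submodule_graph.graph_unique[OF sg(1)] by metis
    next
      fix a x y assume a: "a \<in> carrier R" and "(x, y) \<in> \<Union>\<C>"
      then obtain G where "G \<in> \<C>" "(x, y) \<in> G" by auto
      then show "(a \<odot>\<^bsub>B\<^esub> x, a \<odot>\<^bsub>P\<^esub> y) \<in> \<Union>\<C>"
        using submodule_graph.graph_smult[OF sg(1) a] by (intro UnionI)
    qed
    then show "\<Union>\<C> \<in> \<G>" using sg(2) G1 by (auto simp: \<G>_def)
  qed
  then obtain G where G\<G>: "G \<in> \<G>" and max\<G>: "\<forall>G'\<in>\<G>. G \<subseteq> G' \<longrightarrow> G' = G" by (rule bexE)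
  then have G: "submodule_graph R B P G" "G0 \<subseteq> G" by (simp_all add: \<G>_def)
  have max: "G' = G" if "submodule_graph R B P G'" "G \<subseteq> G'" for G'
    using max\<G> that G(2) by (simp add: \<G>_def)
  interpret G: submodule_graph R B P G by fact
  have total: "\<exists>y. (b, y) \<in> G" if b: "b \<in> carrier B" for b
  proof -
    let ?k = "\<lambda>a. THE y. (a \<odot>\<^bsub>B\<^esub> b, y) \<in> G"
    obtain m where m: "m \<in> carrier P"
      and km: "\<And>a. a \<in> carrier R \<Longrightarrow> \<exists>y. (a \<odot>\<^bsub>B\<^esub> b, y) \<in> G \<Longrightarrow> ?k a = a \<odot>\<^bsub>P\<^esub> m"
      using Baer[OF G.graph_hom_on_left_ideal(1,2)[OF b]] by auto
    let ?G' = "{(x \<oplus>\<^bsub>B\<^esub> a \<odot>\<^bsub>B\<^esub> b, y \<oplus>\<^bsub>P\<^esub> a \<odot>\<^bsub>P\<^esub> m) | x y a. (x, y) \<in> G \<and> a \<in> carrier R}"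
    have "y = a \<odot>\<^bsub>P\<^esub> m" if "a \<in> carrier R" "(a \<odot>\<^bsub>B\<^esub> b, y) \<in> G" for a y
      using G.graph_hom_on_left_ideal(3)[OF b, of a] km[of a] that G.graph_unique by auto
    then have sg: "submodule_graph R B P ?G'" by (rule G.graph_extend[OF b m])
    have "G \<subseteq> ?G'"
    proof
      fix p assume p: "p \<in> G"
      obtain x y where xy: "p = (x, y)" by (cases p)
      then have "x \<in> carrier B" "y \<in> carrier P" using p G.graph_subset by auto
      then have "p = (x \<oplus>\<^bsub>B\<^esub> \<zero>\<^bsub>R\<^esub> \<odot>\<^bsub>B\<^esub> b, y \<oplus>\<^bsub>P\<^esub> \<zero>\<^bsub>R\<^esub> \<odot>\<^bsub>P\<^esub> m)"
        using b m xy by (simp add: G0.B.smult_l_null G0.P.smult_l_null)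
      moreover have "\<zero>\<^bsub>R\<^esub> \<in> carrier R" by simp
      ultimately show "p \<in> ?G'" using p unfolding xy by (intro CollectI exI conjI)
    qed
    with sg have "?G' = G" by (rule max)
    moreover have "(\<zero>\<^bsub>B\<^esub> \<oplus>\<^bsub>B\<^esub> \<one>\<^bsub>R\<^esub> \<odot>\<^bsub>B\<^esub> b, \<zero>\<^bsub>P\<^esub> \<oplus>\<^bsub>P\<^esub> \<one>\<^bsub>R\<^esub> \<odot>\<^bsub>P\<^esub> m) \<in> ?G'"
      by (intro CollectI exI conjI) (rule refl, rule G.graph_zero, rule G0.B.R.one_closed)
    ultimately have "(\<zero>\<^bsub>B\<^esub> \<oplus>\<^bsub>B\<^esub> \<one>\<^bsub>R\<^esub> \<odot>\<^bsub>B\<^esub> b, \<zero>\<^bsub>P\<^esub> \<oplus>\<^bsub>P\<^esub> \<one>\<^bsub>R\<^esub> \<odot>\<^bsub>P\<^esub> m) \<in> G" by simp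
    then show ?thesis using b by (auto simp: G0.B.smult_one)
  qed
  define h where "h b = (THE y. (b, y) \<in> G)" for b
  have hI: "h b = y" if "(b, y) \<in> G" for b y
    unfolding h_def using that by (rule the_equality) (rule G.graph_unique[OF _ that])
  have hG: "(b, h b) \<in> G" if "b \<in> carrier B" for b
    using total[OF that] hI by auto
  have "h (x \<oplus>\<^bsub>B\<^esub> y) = h x \<oplus>\<^bsub>P\<^esub> h y" if "x \<in> carrier B" "y \<in> carrier B" for x y
    by (rule hI, rule G.graph_add) (use that hG in auto)
  moreover have "h (a \<odot>\<^bsub>B\<^esub> x) = a \<odot>\<^bsub>P\<^esub> h x" if "a \<in> carrier R" "x \<in> carrier B" for a x
    by (rule hI, rule G.graph_smult) (use that hG in auto)
  moreover have "h x \<in> carrier P" if "x \<in> carrier B" for x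
    using hG[OF that] G.graph_subset by auto
  ultimately have "h \<in> module_homs R B P"
    by (simp add: module_homs_def)
  moreover have "\<forall>(x, y)\<in>G0. h x = y" using G(2) hI by auto
  ultimately show ?thesis by blast
qed

text \<open>The condition on zero belongs to the notion because N is a bare record here: only with
  it do the module axioms carry over to N.\<close>

definition module_isos where
  "module_isos R M N = {f \<in> module_homs R M N. bij_betw f (carrier M) (carrier N) \<and> f \<zero>\<^bsub>M\<^esub> = \<zero>\<^bsub>N\<^esub>}"

lemma module_homsD:
  assumes "f \<in> module_homs R M N"
  shows "x \<in> carrier M \<Longrightarrow> f x \<in> carrier N"
    and "\<lbrakk>x \<in> carrier M; y \<in> carrier M\<rbrakk> \<Longrightarrow> f (x \<oplus>\<^bsub>M\<^esub> y) = f x \<oplus>\<^bsub>N\<^esub> f y"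
    and "\<lbrakk>a \<in> carrier R; x \<in> carrier M\<rbrakk> \<Longrightarrow> f (a \<odot>\<^bsub>M\<^esub> x) = a \<odot>\<^bsub>N\<^esub> f x"
  using assms by (auto simp: module_homs_def)

lemma module_homsI:
  assumes "\<And>x. x \<in> carrier M \<Longrightarrow> f x \<in> carrier N"
    and "\<And>x y. \<lbrakk>x \<in> carrier M; y \<in> carrier M\<rbrakk> \<Longrightarrow> f (x \<oplus>\<^bsub>M\<^esub> y) = f x \<oplus>\<^bsub>N\<^esub> f y"
    and "\<And>a x. \<lbrakk>a \<in> carrier R; x \<in> carrier M\<rbrakk> \<Longrightarrow> f (a \<odot>\<^bsub>M\<^esub> x) = a \<odot>\<^bsub>N\<^esub> f x"
  shows "f \<in> module_homs R M N"
  using assms by (auto simp: module_homs_def)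

lemma module_homs_zero:
  assumes "left_module R M" "left_module R N" "f \<in> module_homs R M N"
  shows "f \<zero>\<^bsub>M\<^esub> = \<zero>\<^bsub>N\<^esub>"
proof -
  interpret M: left_module R M by fact
  interpret N: left_module R N by fact
  have "f (\<zero>\<^bsub>R\<^esub> \<odot>\<^bsub>M\<^esub> \<zero>\<^bsub>M\<^esub>) = \<zero>\<^bsub>R\<^esub> \<odot>\<^bsub>N\<^esub> f \<zero>\<^bsub>M\<^esub>"
    using module_homsD(3)[OF assms(3)] by simp
  then show ?thesis
    using M.smult_l_null N.smult_l_null module_homsD(1)[OF assms(3)] by simp
qed

lemma module_homs_comp:
  assumes "f \<in> module_homs R M N" "g \<in> module_homs R N P"
  shows "(\<lambda>x. g (f x)) \<in> module_homs R M P"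
  by (rule module_homsI) (simp_all add: module_homsD[OF assms(1)] module_homsD[OF assms(2)])

text \<open>The axioms are equations that f carries from M to N. Quotients, isomorphic copies and
  principal left ideals become modules in this way.\<close>

lemma left_module_image:
  assumes "left_module R M" and hom: "f \<in> module_homs R M N"
    and car: "carrier N = f ` carrier M" and zero: "\<zero>\<^bsub>N\<^esub> = f \<zero>\<^bsub>M\<^esub>"
  shows "left_module R N"
proof -
  interpret M: left_module R M by fact
  note [simp] = module_homsD(2,3)[OF hom, symmetric]
  show ?thesis
    by (rule left_moduleI; (unfold car)?; (elim imageE)?)
      (auto simp: zero M.smult_closed M.smult_l_distr M.smult_r_distr M.smult_assoc M.smult_one
        M.smult_l_null M.M.a_ac M.R.ring_axioms)
qed

lemma left_module_transport:
  assumes "left_module R M" and f: "f \<in> module_isos R M N"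
  shows "left_module R N"
  by (rule left_module_image[OF assms(1), of f]) (use f in \<open>auto simp: module_isos_def bij_betw_def\<close>)

lemma (in left_module) quotient_module_props:
  assumes N: "submodule N R M"
  shows quotient_carrier: "carrier (quotient_module M N) = (\<lambda>x. N +>\<^bsub>M\<^esub> x) ` carrier M"
    and quotient_eq_iff: "\<lbrakk>x \<in> carrier M; y \<in> carrier M\<rbrakk> \<Longrightarrow> N +>\<^bsub>M\<^esub> x = N +>\<^bsub>M\<^esub> y \<longleftrightarrow> x \<ominus>\<^bsub>M\<^esub> y \<in> N"
    and quotient_hom: "(\<lambda>x. N +>\<^bsub>M\<^esub> x) \<in> module_homs R M (quotient_module M N)"
    and quotient_left_module: "left_module R (quotient_module M N)"
    and quotient_zero: "N +>\<^bsub>M\<^esub> \<zero>\<^bsub>M\<^esub> = \<zero>\<^bsub>quotient_module M N\<^esub>"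
proof -
  interpret N: submodule N R M by fact
  have "additive_subgroup N M"
    by (rule additive_subgroup.intro) (rule N.subgroup_axioms)
  from this M.abelian_group_axioms interpret A: abelian_subgroup N M
    by (rule abelian_subgroupI3)
  show car: "carrier (quotient_module M N) = (\<lambda>x. N +>\<^bsub>M\<^esub> x) ` carrier M"
    by (auto simp: quotient_module_def A_RCOSETS_def' )
  show eq: "N +>\<^bsub>M\<^esub> x = N +>\<^bsub>M\<^esub> y \<longleftrightarrow> x \<ominus>\<^bsub>M\<^esub> y \<in> N" if "x \<in> carrier M" "y \<in> carrier M" for x y
    using that A.a_rcos_module[of y x] A.a_rcos_self[of x]
      M.a_repr_independence[OF _ that(2) N.subgroup_axioms, of x]
    by (auto simp: M.minus_eq)
  \<comment> \<open>All cosets in the union that defines scalar multiplication coincide, as a maps N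
    into N.\<close>
  have smult: "(\<Union>y\<in>N +>\<^bsub>M\<^esub> x. N +>\<^bsub>M\<^esub> (a \<odot>\<^bsub>M\<^esub> y)) = N +>\<^bsub>M\<^esub> (a \<odot>\<^bsub>M\<^esub> x)"
    if "a \<in> carrier R" "x \<in> carrier M" for a x
  proof -
    have "N +>\<^bsub>M\<^esub> (a \<odot>\<^bsub>M\<^esub> y) = N +>\<^bsub>M\<^esub> (a \<odot>\<^bsub>M\<^esub> x)" if y: "y \<in> N +>\<^bsub>M\<^esub> x" for y
    proof -
      obtain m where m: "m \<in> N" "y = m \<oplus>\<^bsub>M\<^esub> x" using y by (auto simp: a_r_coset_def')
      then have "m \<in> carrier M" using A.a_subset by blast
      moreover have "a \<odot>\<^bsub>M\<^esub> m \<in> N" using m \<open>a \<in> carrier R\<close> by simp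
      ultimately show ?thesis
        using m \<open>a \<in> carrier R\<close> \<open>x \<in> carrier M\<close>
        by (subst eq) (simp_all add: smult_closed smult_r_distr M.minus_eq M.a_assoc M.r_neg)
    qed
    moreover have "x \<in> N +>\<^bsub>M\<^esub> x" using A.a_rcos_self that by simp
    ultimately show ?thesis by blast
  qed
  show hom: "(\<lambda>x. N +>\<^bsub>M\<^esub> x) \<in> module_homs R M (quotient_module M N)"
  proof (rule module_homsI)
    fix x y assume "x \<in> carrier M" "y \<in> carrier M"
    then show "N +>\<^bsub>M\<^esub> (x \<oplus>\<^bsub>M\<^esub> y) = (N +>\<^bsub>M\<^esub> x) \<oplus>\<^bsub>quotient_module M N\<^esub> (N +>\<^bsub>M\<^esub> y)"
      by (simp add: quotient_module_def A.a_rcos_sum)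
  next
    fix a x assume "a \<in> carrier R" "x \<in> carrier M"
    then show "N +>\<^bsub>M\<^esub> (a \<odot>\<^bsub>M\<^esub> x) = a \<odot>\<^bsub>quotient_module M N\<^esub> (N +>\<^bsub>M\<^esub> x)"
      using smult by (simp add: quotient_module_def)
  qed (simp add: car)
  show zero: "N +>\<^bsub>M\<^esub> \<zero>\<^bsub>M\<^esub> = \<zero>\<^bsub>quotient_module M N\<^esub>"
    using A.a_subset by (simp add: quotient_module_def)
  show "left_module R (quotient_module M N)"
    by (rule left_module_image[OF left_module_axioms hom car zero[symmetric]])
qed

lemma module_isos_inverse:
  assumes f: "f \<in> module_isos R M N" and M: "left_module R M"
  shows "inv_into (carrier M) f \<in> module_isos R N M"
proof -
  interpret M: left_module R M by fact
  have car: "carrier N = f ` carrier M" and zero: "\<zero>\<^bsub>N\<^esub> = f \<zero>\<^bsub>M\<^esub>"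
    and inj: "inj_on f (carrier M)" and hom: "f \<in> module_homs R M N"
    using f by (auto simp: module_isos_def bij_betw_def)
  have "bij_betw (inv_into (carrier M) f) (carrier N) (carrier M)"
    using inj unfolding car by (intro bij_betw_inv_into) (simp add: inj_on_imp_bij_betw)
  then show ?thesis
    using inj module_homsD(2,3)[OF hom, symmetric]
    by (auto simp: module_isos_def module_homs_def car zero M.smult_closed)
qed

lemma injective_module_transport:
  assumes "left_module R M" and f: "f \<in> module_isos R M N"
    and "injective_module TYPE('m) R M"
  shows "injective_module TYPE('m) R N"
  unfolding injective_module_def
proof (intro conjI allI impI)
  let ?f' = "inv_into (carrier M) f"
  show "left_module R N" using assms(1) f by (rule left_module_transport)
  fix A B :: "('a, 'm) module" and i g
  assume *: "left_module R A \<and> left_module R B \<and>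
    i \<in> module_homs R A B \<and> inj_on i (carrier A) \<and> g \<in> module_homs R A N"
  have f': "?f' \<in> module_homs R N M"
    using module_isos_inverse[OF f assms(1)] by (simp add: module_isos_def)
  have hom: "f \<in> module_homs R M N" using f by (simp add: module_isos_def)
  have "(\<lambda>x. ?f' (g x)) \<in> module_homs R A M" using * f' by (blast intro: module_homs_comp)
  then obtain h where h: "h \<in> module_homs R B M" "\<forall>x\<in>carrier A. h (i x) = ?f' (g x)"
    using assms(3) * unfolding injective_module_def by blast
  have "f (?f' (g x)) = g x" if "x \<in> carrier A" for x
    using f * that by (intro f_inv_into_f) (auto simp: module_isos_def bij_betw_def module_homs_def)
  then have "\<forall>x\<in>carrier A. f (h (i x)) = g x" using h(2) by simp
  then show "\<exists>h\<in>module_homs R B N. \<forall>x\<in>carrier A. h (i x) = g x"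
    by (intro bexI[OF _ module_homs_comp[OF h(1) hom]])
qed

text \<open>A submodule of N is pulled back along f to one of M; a nonzero element of the embedded V
  found there is pushed forward again.\<close>

lemma injective_envelope_transport:
  assumes "left_module R M" and f: "f \<in> module_isos R M N"
    and env: "injective_envelope TYPE('m) R V M"
  shows "injective_envelope TYPE('m) R V N"
proof -
  interpret M: left_module R M by fact
  have car: "carrier N = f ` carrier M" and zero: "\<zero>\<^bsub>N\<^esub> = f \<zero>\<^bsub>M\<^esub>"
    and inj: "inj_on f (carrier M)" and hom: "f \<in> module_homs R M N"
    using f by (auto simp: module_isos_def bij_betw_def)
  interpret N: left_module R N using assms(1) f by (rule left_module_transport)
  from env obtain g where g: "g \<in> module_homs R V M" "inj_on g (carrier V)"
    and ess: "\<And>S. submodule S R M \<Longrightarrow> S \<noteq> {\<zero>\<^bsub>M\<^esub>} \<Longrightarrow> S \<inter> g ` carrier V \<noteq> {\<zero>\<^bsub>M\<^esub>}"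
    unfolding injective_envelope_def by blast
  have gM: "g ` carrier V \<subseteq> carrier M" using g(1) by (auto simp: module_homs_def)
  have "S \<inter> (\<lambda>x. f (g x)) ` carrier V \<noteq> {\<zero>\<^bsub>N\<^esub>}" if S: "submodule S R N" "S \<noteq> {\<zero>\<^bsub>N\<^esub>}" for S
  proof -
    interpret S: submodule S R N by fact
    let ?T = "{u \<in> carrier M. f u \<in> S}"
    have S0: "\<zero>\<^bsub>N\<^esub> \<in> S" using S.one_closed by simp
    have Scar: "S \<subseteq> carrier N" using S.subset by simp
    have "submodule ?T R M"
    proof (rule M.submodule_intro)
      show "\<zero>\<^bsub>M\<^esub> \<in> ?T" using S0 zero by simp
    next
      fix x y assume "x \<in> ?T" "y \<in> ?T"
      then show "x \<oplus>\<^bsub>M\<^esub> y \<in> ?T" using S.m_closed by (simp add: module_homsD[OF hom])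
    next
      fix a x assume "a \<in> carrier R" "x \<in> ?T"
      then show "a \<odot>\<^bsub>M\<^esub> x \<in> ?T" by (simp add: module_homsD[OF hom] M.smult_closed)
    qed auto
    moreover have "?T \<noteq> {\<zero>\<^bsub>M\<^esub>}"
    proof
      assume T: "?T = {\<zero>\<^bsub>M\<^esub>}"
      have "s = \<zero>\<^bsub>N\<^esub>" if s: "s \<in> S" for s
      proof -
        obtain u where u: "u \<in> carrier M" "s = f u" using s Scar car by auto
        then have "u \<in> ?T" using s by simp
        then show ?thesis using u T zero by auto
      qed
      then have "S \<subseteq> {\<zero>\<^bsub>N\<^esub>}" by (intro subsetI) simp
      then show False using S(2) S0 by (auto simp: subset_singleton_iff)
    qed
    ultimately have "?T \<inter> g ` carrier V \<noteq> {\<zero>\<^bsub>M\<^esub>}" by (rule ess)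
    moreover have "\<zero>\<^bsub>M\<^esub> \<in> ?T" using S0 zero by simp
    moreover have "\<zero>\<^bsub>M\<^esub> \<in> g ` carrier V"
    proof -
      have V: "left_module R V" using env by (simp add: injective_envelope_def)
      then show ?thesis
        using module_homs_zero[OF V assms(1) g(1)] abelian_monoid.zero_closed[of V]
        by (metis abelian_group.axioms(1) image_eqI left_module.axioms(2))
    qed
    ultimately obtain x where x: "x \<in> carrier V" "f (g x) \<in> S" "g x \<noteq> \<zero>\<^bsub>M\<^esub>" by auto
    then have "f (g x) \<noteq> \<zero>\<^bsub>N\<^esub>" using inj gM zero M.M.zero_closed unfolding inj_on_def by (metis image_subset_iff)
    then show ?thesis using x by auto
  qed
  moreover have "inj_on (\<lambda>x. f (g x)) (carrier V)"
    using g(2) inj gM unfolding inj_on_def by (meson image_subset_iff)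
  moreover have "injective_module TYPE('m) R N"
    using env by (intro injective_module_transport[OF assms(1) f]) (simp add: injective_envelope_def)
  ultimately show ?thesis
    using env unfolding injective_envelope_def
    by (intro conjI bexI[OF _ module_homs_comp[OF g(1) hom]]) auto
qed

text \<open>Injective compatible maps \<theta> into N turn the identification in the limit into
  equality of images. The classes are then the fibres over the elements of N, and the isomorphism
  sends an element to its fibre.\<close>

lemma direct_limit_iso:
  assumes N: "left_module R N"
    and ne: "I \<noteq> {}"
    and zero: "\<And>i. i \<in> I \<Longrightarrow> \<zero>\<^bsub>M i\<^esub> \<in> carrier (M i) \<and> \<theta> i \<zero>\<^bsub>M i\<^esub> = \<zero>\<^bsub>N\<^esub>"
    and add: "\<And>i x y. \<lbrakk>i \<in> I; x \<in> carrier (M i); y \<in> carrier (M i)\<rbrakk> \<Longrightarrow> x \<oplus>\<^bsub>M i\<^esub> y \<in> carrier (M i)"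
    and smult: "\<And>i a x. \<lbrakk>i \<in> I; a \<in> carrier R; x \<in> carrier (M i)\<rbrakk> \<Longrightarrow> a \<odot>\<^bsub>M i\<^esub> x \<in> carrier (M i)"
    and hom: "\<And>i. i \<in> I \<Longrightarrow> \<theta> i \<in> module_homs R (M i) N"
    and inj: "\<And>i. i \<in> I \<Longrightarrow> inj_on (\<theta> i) (carrier (M i))"
    and surj: "\<And>u. u \<in> carrier N \<Longrightarrow> \<exists>i\<in>I. u \<in> \<theta> i ` carrier (M i)"
    and \<psi>: "\<And>i j x. \<lbrakk>i \<in> I; j \<in> I; i \<le> j; x \<in> carrier (M i)\<rbrakk> \<Longrightarrow>
      \<psi> i j x \<in> carrier (M j) \<and> \<theta> j (\<psi> i j x) = \<theta> i x"
  shows "(\<lambda>u. {(i, x). i \<in> I \<and> x \<in> carrier (M i) \<and> \<theta> i x = u}) \<in> module_isos R N (direct_limit I M \<psi>)"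
proof -
  interpret N: left_module R N by fact
  let ?F = "\<lambda>u. {(i, x). i \<in> I \<and> x \<in> carrier (M i) \<and> \<theta> i x = u}"
  let ?D = "direct_limit I M \<psi>"
  have max: "max i j \<in> I" if "i \<in> I" "j \<in> I" for i j using that by (simp add: max_def)
  have rel: "((i, x), (j, y)) \<in> dirlim_rel I M \<psi> \<longleftrightarrow>
      i \<in> I \<and> j \<in> I \<and> x \<in> carrier (M i) \<and> y \<in> carrier (M j) \<and> \<theta> i x = \<theta> j y" for i x j y
  proof (cases "i \<in> I \<and> j \<in> I \<and> x \<in> carrier (M i) \<and> y \<in> carrier (M j)")
    case True
    have "(\<exists>k\<in>I. i \<le> k \<and> j \<le> k \<and> \<psi> i k x = \<psi> j k y) \<longleftrightarrow> \<theta> i x = \<theta> j y"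
    proof
      assume "\<exists>k\<in>I. i \<le> k \<and> j \<le> k \<and> \<psi> i k x = \<psi> j k y"
      then show "\<theta> i x = \<theta> j y" using \<psi> True by metis
    next
      \<comment> \<open>Injectivity at the common index \<open>max i j\<close> forces the two images
        there to agree.\<close>
      assume "\<theta> i x = \<theta> j y"
      then have "\<theta> (max i j) (\<psi> i (max i j) x) = \<theta> (max i j) (\<psi> j (max i j) y)"
        using \<psi> True max by simp
      then have "\<psi> i (max i j) x = \<psi> j (max i j) y"
        using inj[OF max] \<psi> True max unfolding inj_on_def by (metis max.cobounded1 max.cobounded2)
      then show "\<exists>k\<in>I. i \<le> k \<and> j \<le> k \<and> \<psi> i k x = \<psi> j k y"
        using max True by (metis max.cobounded1 max.cobounded2)
    qed
    then show ?thesis using True by (simp add: dirlim_rel_def)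
  qed (auto simp: dirlim_rel_def)
  have cls: "dirlim_rel I M \<psi> `` {(i, x)} = ?F (\<theta> i x)" if "i \<in> I" "x \<in> carrier (M i)" for i x
    using that by (auto simp: rel)
  have car: "carrier ?D = ?F ` carrier N"
  proof
    show "carrier ?D \<subseteq> ?F ` carrier N"
      using module_homsD(1)[OF hom] by (auto simp: direct_limit_def quotient_def cls)
    show "?F ` carrier N \<subseteq> carrier ?D"
    proof (intro image_subsetI)
      fix u assume "u \<in> carrier N"
      then obtain i x where ix: "i \<in> I" "x \<in> carrier (M i)" "u = \<theta> i x" using surj by blast
      then show "?F u \<in> carrier ?D"
        unfolding direct_limit_def by (auto simp flip: cls simp: quotient_def)
    qed
  qed
  have mem: "\<exists>i x. i \<in> I \<and> x \<in> carrier (M i) \<and> \<theta> i x = u" if "u \<in> carrier N" for u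
    using surj[OF that] by blast
  have inj_F: "inj_on ?F (carrier N)"
  proof (rule inj_onI)
    fix u v assume uv: "u \<in> carrier N" "v \<in> carrier N" "?F u = ?F v"
    obtain i x where "(i, x) \<in> ?F u" using mem[OF uv(1)] by auto
    then show "u = v" using uv(3) by auto
  qed
  have "?F \<in> module_homs R N ?D"
  proof (rule module_homsI)
    fix u v assume u: "u \<in> carrier N" and v: "v \<in> carrier N"
    have "(\<Union>(i, x)\<in>?F u. \<Union>(j, y)\<in>?F v. dirlim_rel I M \<psi> ``
        {(max i j, \<psi> i (max i j) x \<oplus>\<^bsub>M (max i j)\<^esub> \<psi> j (max i j) y)}) =
      (\<Union>(i, x)\<in>?F u. \<Union>(j, y)\<in>?F v. ?F (u \<oplus>\<^bsub>N\<^esub> v))"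
    proof (rule SUP_cong[OF refl], clarify, rule SUP_cong[OF refl], clarify)
      fix i x j y assume "i \<in> I" "x \<in> carrier (M i)" "u = \<theta> i x" "j \<in> I" "y \<in> carrier (M j)" "v = \<theta> j y"
      then show "dirlim_rel I M \<psi> `` {(max i j, \<psi> i (max i j) x \<oplus>\<^bsub>M (max i j)\<^esub> \<psi> j (max i j) y)} =
          ?F (\<theta> i x \<oplus>\<^bsub>N\<^esub> \<theta> j y)"
        using max[of i j] by (simp add: cls add \<psi> module_homsD(2)[OF hom])
    qed
    also have "\<dots> = ?F (u \<oplus>\<^bsub>N\<^esub> v)" using mem[OF u] mem[OF v] by auto
    finally show "?F (u \<oplus>\<^bsub>N\<^esub> v) = ?F u \<oplus>\<^bsub>?D\<^esub> ?F v" by (simp add: direct_limit_def)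
  next
    fix a u assume a: "a \<in> carrier R" and u: "u \<in> carrier N"
    have "(\<Union>(i, x)\<in>?F u. dirlim_rel I M \<psi> `` {(i, a \<odot>\<^bsub>M i\<^esub> x)}) = (\<Union>(i, x)\<in>?F u. ?F (a \<odot>\<^bsub>N\<^esub> u))"
      by (rule SUP_cong[OF refl], clarify) (simp add: cls smult a module_homsD(3)[OF hom])
    also have "\<dots> = ?F (a \<odot>\<^bsub>N\<^esub> u)" using mem[OF u] by auto
    finally show "?F (a \<odot>\<^bsub>N\<^esub> u) = a \<odot>\<^bsub>?D\<^esub> ?F u" by (simp add: direct_limit_def)
  qed (auto simp: car)
  moreover have "?F \<zero>\<^bsub>N\<^esub> = \<zero>\<^bsub>?D\<^esub>"
  proof -
    have "(\<Union>i\<in>I. dirlim_rel I M \<psi> `` {(i, \<zero>\<^bsub>M i\<^esub>)}) = (\<Union>i\<in>I. ?F \<zero>\<^bsub>N\<^esub>)"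
      by (intro SUP_cong refl) (simp add: cls zero)
    then show ?thesis using ne by (simp add: direct_limit_def)
  qed
  ultimately show ?thesis
    using inj_F by (simp add: module_isos_def bij_betw_def car)
qed

section \<open>Modules over Leavitt path algebras\<close>

definition free_carrier :: "'x set \<Rightarrow> ('x fword \<Rightarrow>\<^sub>0 'k::field) set" where
  "free_carrier S = {a. \<forall>w\<in>Poly_Mapping.keys a. set (letters w) \<subseteq> S}"

lemma free_algebra_simps [simp]:
  "carrier (free_algebra S) = free_carrier S"
  "a \<otimes>\<^bsub>free_algebra S\<^esub> b = a * b"
  "a \<oplus>\<^bsub>free_algebra S\<^esub> b = a + b"
  "\<one>\<^bsub>free_algebra S\<^esub> = 1" "\<zero>\<^bsub>free_algebra S\<^esub> = 0"
  by (simp_all add: free_algebra_def ring_of_type_algebra_def free_carrier_def)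

lemma free_carrier_add: "\<lbrakk>a \<in> free_carrier S; b \<in> free_carrier S\<rbrakk> \<Longrightarrow> a + b \<in> free_carrier S"
  using keys_add[of a b] by (auto simp: free_carrier_def)

lemma free_carrier_uminus: "a \<in> free_carrier S \<Longrightarrow> - a \<in> free_carrier S"
  by (auto simp: in_keys_iff free_carrier_def)

lemma free_carrier_diff: "\<lbrakk>a \<in> free_carrier S; b \<in> free_carrier S\<rbrakk> \<Longrightarrow> a - b \<in> free_carrier S"
  using free_carrier_add[of a S "- b"] free_carrier_uminus[of b S] by simp

lemma free_carrier_mult: "\<lbrakk>a \<in> free_carrier S; b \<in> free_carrier S\<rbrakk> \<Longrightarrow> a * b \<in> free_carrier S"
  using keys_mult[of a b] by (fastforce simp: plus_fword_def free_carrier_def)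

lemma free_carrier_single: "set w \<subseteq> S \<Longrightarrow> Poly_Mapping.single (FWord w) k \<in> free_carrier S"
  by (auto simp: when_def in_keys_iff lookup_single free_carrier_def)

lemma free_carrier_monomial: "set w \<subseteq> S \<Longrightarrow> monomial w \<in> free_carrier S"
  unfolding monomial_def by (rule free_carrier_single)

lemma free_carrier_scalar: "Poly_Mapping.single 0 k \<in> free_carrier S"
  unfolding zero_fword_def by (rule free_carrier_single) simp

lemma free_carrier_one: "1 \<in> free_carrier S" and free_carrier_zero: "0 \<in> free_carrier S"
  by (simp_all add: zero_fword_def free_carrier_def)

lemma free_carrier_sum: "(\<And>i. i \<in> A \<Longrightarrow> f i \<in> free_carrier S) \<Longrightarrow> sum f A \<in> free_carrier S"
  by (induction A rule: infinite_finite_induct) (simp_all add: free_carrier_add free_carrier_zero)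

lemmas free_carrier_intros = free_carrier_add free_carrier_uminus free_carrier_diff free_carrier_sum
  free_carrier_mult free_carrier_monomial free_carrier_scalar free_carrier_one free_carrier_zero

lemma free_algebra_ring: "ring (free_algebra S :: ('x fword \<Rightarrow>\<^sub>0 'k::field) ring)"
proof (rule ringI)
  show "abelian_group (free_algebra S :: ('x fword \<Rightarrow>\<^sub>0 'k) ring)"
  proof (rule abelian_groupI)
    fix a assume "a \<in> carrier (free_algebra S :: ('x fword \<Rightarrow>\<^sub>0 'k) ring)"
    then show "\<exists>b\<in>carrier (free_algebra S). b \<oplus>\<^bsub>free_algebra S\<^esub> a = \<zero>\<^bsub>free_algebra S\<^esub>"
      using free_carrier_uminus[of a S] by (intro bexI[of _ "- a"]) auto
  qed (use free_carrier_intros in \<open>simp_all add: ac_simps\<close>)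
  show "Group.monoid (free_algebra S :: ('x fword \<Rightarrow>\<^sub>0 'k) ring)"
    by (rule monoidI) (use free_carrier_mult free_carrier_one in \<open>simp_all add: mult.assoc\<close>)
qed (simp_all add: algebra_simps)

lemma monomial_append: "monomial (xs @ ys) = monomial xs * monomial ys"
  by (simp add: monomial_def mult_single plus_fword_def)

lemma monomial_Cons: "monomial (x # xs) = monomial [x] * monomial xs"
  using monomial_append[of "[x]" xs] by simp

lemma monomial_Nil: "monomial [] = 1"
  by (simp add: monomial_def flip: zero_fword_def)

lemma single_eq_scalar_times_monomial:
  "Poly_Mapping.single (FWord w) k = Poly_Mapping.single 0 k * monomial w"
  by (simp add: monomial_def mult_single plus_fword_def zero_fword_def)

lemma scalar_commute:
  "a * Poly_Mapping.single 0 k = Poly_Mapping.single 0 k * (a :: 'x fword \<Rightarrow>\<^sub>0 'k::field)"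
proof (induction a rule: Poly_Mapping.update_induct)
  case (update f a b)
  have "Poly_Mapping.update a b f = f + Poly_Mapping.single a b"
    using update by (intro poly_mapping_eqI)
      (auto simp: lookup_update lookup_add lookup_single when_def in_keys_iff)
  then show ?case using update(3) by (simp add: algebra_simps mult_single)
qed simp

lemma free_algebra_induct [consumes 1, case_names word add]:
  assumes "a \<in> free_carrier S"
    and word: "\<And>w k. set w \<subseteq> S \<Longrightarrow> P (Poly_Mapping.single 0 k * monomial w)"
    and add: "\<And>a b. \<lbrakk>a \<in> free_carrier S; b \<in> free_carrier S; P a; P b\<rbrakk> \<Longrightarrow> P (a + b)"
  shows "P a"
  using assms(1)
proof (induction a rule: Poly_Mapping.update_induct)
  case const
  show ?case using word[of "[]" 0] by simp
next
  case (update f a b)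
  have eq: "Poly_Mapping.update a b f = f + Poly_Mapping.single a b"
    using update by (intro poly_mapping_eqI)
      (auto simp: lookup_update lookup_add lookup_single when_def in_keys_iff)
  have "a \<in> Poly_Mapping.keys (Poly_Mapping.update a b f)" "Poly_Mapping.keys f \<subseteq> Poly_Mapping.keys (Poly_Mapping.update a b f)"
    using update(2) by (auto simp: in_keys_iff lookup_update)
  then have a: "set (letters a) \<subseteq> S" and f: "f \<in> free_carrier S"
    using update.prems by (auto simp: free_carrier_def)
  have "P f" using update f by blast
  moreover have "P (Poly_Mapping.single a b)"
    using word[OF a, of b] by (simp flip: single_eq_scalar_times_monomial)
  moreover have "Poly_Mapping.single a b \<in> free_carrier S"
    using free_carrier_single[OF a, of b] by simp
  ultimately show ?case unfolding eq using add[OF f] by blast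
qed

section \<open>The quotient map onto the Leavitt path algebra\<close>

locale leavitt = fin_digraph E for E :: "('v, 'e) pre_digraph" +
  fixes K :: "'k::field itself"
begin

abbreviation FA :: "('v, 'e, 'k) lpa_free ring" where "FA \<equiv> free_algebra (lpa_gens E)"
abbreviation FC :: "('v, 'e, 'k) lpa_free set" where "FC \<equiv> free_carrier (lpa_gens E)"
abbreviation L :: "('v, 'e, 'k) lpa ring" where "L \<equiv> leavitt_path_algebra K E"

definition cls :: "('v, 'e, 'k) lpa_free \<Rightarrow> ('v, 'e, 'k) lpa" where
  "cls a = lpa_ideal E +>\<^bsub>FA\<^esub> a"

lemma gen_mono_FC [simp]:
  "v \<in> verts E \<Longrightarrow> monomial [Vertex v] \<in> FC"
  "e \<in> arcs E \<Longrightarrow> monomial [Edge e] \<in> FC"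
  "e \<in> arcs E \<Longrightarrow> monomial [Ghost e] \<in> FC"
  by (rule free_carrier_monomial; simp add: lpa_gens_def)+

lemma relations_FC: "lpa_relations E \<subseteq> FC"
proof
  fix r :: "('v, 'e, 'k) lpa_free" assume "r \<in> lpa_relations E"
  then show "r \<in> FC"
    by cases
      (auto simp only: split: if_splits intro!: free_carrier_diff free_carrier_monomial free_carrier_sum
        free_carrier_one free_carrier_zero, auto simp: lpa_gens_def)
qed

lemma lpa_ideal: "ideal (lpa_ideal E) FA"
  unfolding lpa_ideal_def by (rule ring.genideal_ideal[OF free_algebra_ring]) (use relations_FC in simp)

lemma L_ring: "ring L"
  unfolding leavitt_path_algebra_def by (rule ideal.quotient_is_ring[OF lpa_ideal])

lemma cls_hom: "cls \<in> ring_hom FA L"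
  unfolding leavitt_path_algebra_def cls_def[abs_def] by (rule ideal.rcos_ring_hom[OF lpa_ideal])

lemma cls_add: "\<lbrakk>a \<in> FC; b \<in> FC\<rbrakk> \<Longrightarrow> cls (a + b) = cls a \<oplus>\<^bsub>L\<^esub> cls b"
  using ring_hom_add[OF cls_hom] by simp

lemma cls_mult: "\<lbrakk>a \<in> FC; b \<in> FC\<rbrakk> \<Longrightarrow> cls (a * b) = cls a \<otimes>\<^bsub>L\<^esub> cls b"
  using ring_hom_mult[OF cls_hom] by simp

lemma cls_one: "cls 1 = \<one>\<^bsub>L\<^esub>"
  using ring_hom_one[OF cls_hom] by simp

lemma carrier_L: "carrier L = cls ` FC"
  unfolding leavitt_path_algebra_def FactRing_def A_RCOSETS_def' cls_def[abs_def] by auto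

lemma cls_closed [simp]: "a \<in> FC \<Longrightarrow> cls a \<in> carrier L"
  by (simp only: carrier_L image_eqI)

lemma mem_cls: "a \<in> FC \<Longrightarrow> a \<in> cls a"
  unfolding cls_def using ideal.axioms(1)[OF lpa_ideal]
  by (simp add: additive_subgroup.zero_closed a_r_coset_def r_coset_def free_algebra_def ring_of_type_algebra_def)
   (use additive_subgroup.zero_closed[OF ideal.axioms(1)[OF lpa_ideal]] in force)

lemma lpa_ideal_FC: "lpa_ideal E \<subseteq> FC"
  using ideal.Icarr[OF lpa_ideal] by auto

lemma cls_subset: "cls a = {x + a | x. x \<in> lpa_ideal E}"
  unfolding cls_def a_r_coset_def r_coset_def by auto

lemma cls_ideal: "x \<in> lpa_ideal E \<Longrightarrow> cls x = \<zero>\<^bsub>L\<^esub>"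
  unfolding cls_def leavitt_path_algebra_def FactRing_def
  using abelian_subgroup.a_rcos_const[OF abelian_subgroupI3[OF ideal.axioms(1)[OF lpa_ideal] ring.is_abelian_group[OF free_algebra_ring]]]
  by simp

lemma cls_zero: "cls 0 = \<zero>\<^bsub>L\<^esub>"
  using cls_ideal additive_subgroup.zero_closed[OF ideal.axioms(1)[OF lpa_ideal]] by simp

lemma cls_diff:
  assumes "a \<in> FC" "b \<in> FC" shows "cls (a - b) = cls a \<ominus>\<^bsub>L\<^esub> cls b"
proof -
  interpret L: ring L by (rule L_ring)
  have "cls (a - b) \<oplus>\<^bsub>L\<^esub> cls b = cls a"
    using assms cls_add[of "a - b" b] free_carrier_diff[of a _ b] by simp
  then show ?thesis
    using assms free_carrier_diff[of a _ b] by (metis L.add.inv_solve_right L.minus_eq cls_closed)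
qed

lemma relation_ideal: "(r :: ('v, 'e, 'k) lpa_free) \<in> lpa_relations E \<Longrightarrow> r \<in> lpa_ideal E"
  unfolding lpa_ideal_def
  by (rule subsetD[OF ring.genideal_self[OF free_algebra_ring]]) (simp_all add: relations_FC)

lemma cls_relation:
  assumes "a - b \<in> lpa_relations E" "a \<in> FC" "b \<in> FC"
  shows "cls a = cls b"
proof -
  interpret L: ring L by (rule L_ring)
  have "cls a \<ominus>\<^bsub>L\<^esub> cls b = \<zero>\<^bsub>L\<^esub>" using assms cls_diff[of a b] cls_ideal[OF relation_ideal] by simp
  then show ?thesis using assms by (simp only: L.r_right_minus_eq cls_closed)
qed

lemma lpa_path_eq: "lpa_path E p = cls (monomial (map Edge p))"
  by (simp add: lpa_path_def cls_def)

lemma path_FC: "set p \<subseteq> arcs E \<Longrightarrow> monomial (map Edge p) \<in> FC"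
  "set p \<subseteq> arcs E \<Longrightarrow> monomial (map Ghost p) \<in> FC"
  by (rule free_carrier_monomial; auto simp: lpa_gens_def)+

end

section \<open>Vertices, edges and ghost edges acting on a module\<close>

locale leavitt_module = leavitt E K + B?: left_module "leavitt_path_algebra K E" B
  for E :: "('v, 'e) pre_digraph" and K :: "'k::field itself"
    and B :: "(('v, 'e, 'k) lpa, 'b, 'x) module_scheme"
begin

text \<open>Elements of the free algebra act through their classes, so that words can be multiplied
  before passing to the quotient and the defining relations serve as rewrite rules.\<close>

definition act :: "('v, 'e, 'k) lpa_free \<Rightarrow> 'b \<Rightarrow> 'b" where
  "act a b = cls a \<odot>\<^bsub>B\<^esub> b"

abbreviation CB where "CB \<equiv> carrier B"
abbreviation vx where "vx v \<equiv> act (monomial [Vertex v])"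
abbreviation ed where "ed e \<equiv> act (monomial [Edge e])"
abbreviation gh where "gh e \<equiv> act (monomial [Ghost e])"
abbreviation sc where "sc k \<equiv> act (Poly_Mapping.single 0 k)"

lemma act_closed [simp]: "\<lbrakk>a \<in> FC; b \<in> CB\<rbrakk> \<Longrightarrow> act a b \<in> CB"
  by (simp add: act_def B.smult_closed)

lemma act_mult: "\<lbrakk>a \<in> FC; a' \<in> FC; b \<in> CB\<rbrakk> \<Longrightarrow> act (a * a') b = act a (act a' b)"
  by (simp add: act_def cls_mult B.smult_assoc)

lemma act_add: "\<lbrakk>a \<in> FC; a' \<in> FC; b \<in> CB\<rbrakk> \<Longrightarrow> act (a + a') b = act a b \<oplus>\<^bsub>B\<^esub> act a' b"
  by (simp add: act_def cls_add B.smult_l_distr)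

lemma act_diff: "\<lbrakk>a \<in> FC; a' \<in> FC; b \<in> CB\<rbrakk> \<Longrightarrow> act (a - a') b = act a b \<ominus>\<^bsub>B\<^esub> act a' b"
  by (simp add: act_def cls_diff B.smult_l_diff)

lemma act_add_right: "\<lbrakk>a \<in> FC; b \<in> CB; b' \<in> CB\<rbrakk> \<Longrightarrow> act a (b \<oplus>\<^bsub>B\<^esub> b') = act a b \<oplus>\<^bsub>B\<^esub> act a b'"
  by (simp add: act_def B.smult_r_distr)

lemma act_zero_right [simp]: "a \<in> FC \<Longrightarrow> act a \<zero>\<^bsub>B\<^esub> = \<zero>\<^bsub>B\<^esub>"
  by (simp add: act_def B.smult_r_null)

lemma act_one [simp]: "b \<in> CB \<Longrightarrow> act 1 b = b"
  by (simp add: act_def cls_one B.smult_one)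

lemma act_zero [simp]: "b \<in> CB \<Longrightarrow> act 0 b = \<zero>\<^bsub>B\<^esub>"
  by (simp add: act_def cls_zero B.smult_l_null)

lemma act_relation:
  assumes "a - b \<in> lpa_relations E" "a \<in> FC" "b \<in> FC"
  shows "act a x = act b x"
  using cls_relation[OF assms] by (simp add: act_def)

lemma act_sum:
  assumes "finite A" "\<And>i. i \<in> A \<Longrightarrow> f i \<in> FC" "b \<in> CB"
  shows "act (sum f A) b = finsum B (\<lambda>i. act (f i) b) A"
  using assms(1,2)
proof (induction A)
  case (insert i A)
  then have "sum f A \<in> FC" by (intro free_carrier_sum) auto
  then show ?case using insert assms(3) by (simp add: act_add Pi_def)
qed (use assms(3) in simp)

lemma monomial2_FC [simp]: "monomial [x] \<in> FC \<Longrightarrow> monomial [y] \<in> FC \<Longrightarrow> monomial [x, y] \<in> FC"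
  using free_carrier_mult[of "monomial [x]" _ "monomial [y]"] by (simp flip: monomial_Cons)

lemma act_monomial2:
  "\<lbrakk>monomial [x] \<in> FC; monomial [y] \<in> FC; b \<in> CB\<rbrakk> \<Longrightarrow> act (monomial [x, y]) b = act (monomial [x]) (act (monomial [y]) b)"
  by (subst monomial_Cons) (simp add: act_mult)

lemma vx_vx:
  assumes "v \<in> verts E" "u \<in> verts E" "b \<in> CB"
  shows "vx v (vx u b) = (if v = u then vx v b else \<zero>\<^bsub>B\<^esub>)"
  using act_relation[OF lpa_relations.vertices[OF assms(1,2)], of b] assms
  by (simp add: act_monomial2 free_carrier_zero split: if_splits)

lemma vx_ed_same: "\<lbrakk>e \<in> arcs E; b \<in> CB\<rbrakk> \<Longrightarrow> vx (tail E e) (ed e b) = ed e b"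
  using act_relation[OF lpa_relations.source_edge, of e b] by (simp add: act_monomial2)

lemma ed_vx_same: "\<lbrakk>e \<in> arcs E; b \<in> CB\<rbrakk> \<Longrightarrow> ed e (vx (head E e) b) = ed e b"
  using act_relation[OF lpa_relations.edge_range, of e b] by (simp add: act_monomial2)

lemma vx_gh_same: "\<lbrakk>e \<in> arcs E; b \<in> CB\<rbrakk> \<Longrightarrow> vx (head E e) (gh e b) = gh e b"
  using act_relation[OF lpa_relations.range_ghost, of e b] by (simp add: act_monomial2)

lemma gh_vx_same: "\<lbrakk>e \<in> arcs E; b \<in> CB\<rbrakk> \<Longrightarrow> gh e (vx (tail E e) b) = gh e b"
  using act_relation[OF lpa_relations.ghost_source, of e b] by (simp add: act_monomial2)

lemma vx_ed: "\<lbrakk>v \<in> verts E; e \<in> arcs E; b \<in> CB\<rbrakk> \<Longrightarrow> vx v (ed e b) = (if v = tail E e then ed e b else \<zero>\<^bsub>B\<^esub>)"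
  by (metis act_closed gen_mono_FC(1,2) tail_in_verts vx_ed_same vx_vx)

lemma ed_vx: "\<lbrakk>v \<in> verts E; e \<in> arcs E; b \<in> CB\<rbrakk> \<Longrightarrow> ed e (vx v b) = (if v = head E e then ed e b else \<zero>\<^bsub>B\<^esub>)"
  by (metis act_closed act_zero_right ed_vx_same gen_mono_FC(1,2) head_in_verts vx_vx)

lemma gh_vx: "\<lbrakk>v \<in> verts E; e \<in> arcs E; b \<in> CB\<rbrakk> \<Longrightarrow> gh e (vx v b) = (if v = tail E e then gh e b else \<zero>\<^bsub>B\<^esub>)"
  by (metis act_closed act_zero_right gh_vx_same gen_mono_FC(1,3) tail_in_verts vx_vx)

lemma gh_ed:
  assumes "e \<in> arcs E" "e' \<in> arcs E" "b \<in> CB"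
  shows "gh e (ed e' b) = (if e = e' then vx (head E e) b else \<zero>\<^bsub>B\<^esub>)"
  using act_relation[OF lpa_relations.CK1[OF assms(1,2)], of b] assms
  by (simp add: act_monomial2 free_carrier_zero split: if_splits)

lemma sc_commute: "\<lbrakk>a \<in> FC; b \<in> CB\<rbrakk> \<Longrightarrow> act a (sc k b) = sc k (act a b)"
  by (simp add: free_carrier_scalar scalar_commute flip: act_mult)

lemma act_Cons: "\<lbrakk>set (x # xs) \<subseteq> lpa_gens E; b \<in> CB\<rbrakk> \<Longrightarrow> act (monomial (x # xs)) b = act (monomial [x]) (act (monomial xs) b)"
  by (subst monomial_Cons) (simp add: act_mult free_carrier_monomial)

lemma act_append: "\<lbrakk>set xs \<subseteq> lpa_gens E; set ys \<subseteq> lpa_gens E; b \<in> CB\<rbrakk> \<Longrightarrow> act (monomial (xs @ ys)) b = act (monomial xs) (act (monomial ys) b)"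
  by (simp add: act_mult free_carrier_monomial monomial_append)

definition pa :: "'e list \<Rightarrow> 'b \<Rightarrow> 'b" where "pa p = act (monomial (map Edge p))"
text \<open>The star of e1 ... en is en* ... e1*, so the first edge of p is stripped first.\<close>

definition gp :: "'e list \<Rightarrow> 'b \<Rightarrow> 'b" where "gp p = act (monomial (rev (map Ghost p)))"

lemma pa_simps [simp]:
  "b \<in> CB \<Longrightarrow> pa [] b = b"
  "\<lbrakk>set (e # p) \<subseteq> arcs E; b \<in> CB\<rbrakk> \<Longrightarrow> pa (e # p) b = ed e (pa p b)"
  "\<lbrakk>set p \<subseteq> arcs E; b \<in> CB\<rbrakk> \<Longrightarrow> pa p b \<in> CB"
proof -
  have *: "set p \<subseteq> arcs E \<Longrightarrow> set (map Edge p) \<subseteq> lpa_gens E" for p by (auto simp: lpa_gens_def)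
  show "b \<in> CB \<Longrightarrow> pa [] b = b" by (simp add: pa_def monomial_Nil)
  show "\<lbrakk>set (e # p) \<subseteq> arcs E; b \<in> CB\<rbrakk> \<Longrightarrow> pa (e # p) b = ed e (pa p b)"
    using act_Cons[OF *[of "e # p", unfolded list.map], of b] by (simp add: pa_def)
  show "\<lbrakk>set p \<subseteq> arcs E; b \<in> CB\<rbrakk> \<Longrightarrow> pa p b \<in> CB"
    unfolding pa_def by (rule act_closed[OF free_carrier_monomial[OF *]])
qed

lemma gp_simps [simp]:
  "b \<in> CB \<Longrightarrow> gp [] b = b"
  "\<lbrakk>set (e # p) \<subseteq> arcs E; b \<in> CB\<rbrakk> \<Longrightarrow> gp (e # p) b = gp p (gh e b)"
  "\<lbrakk>set p \<subseteq> arcs E; b \<in> CB\<rbrakk> \<Longrightarrow> gp p b \<in> CB"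
proof -
  have *: "set p \<subseteq> arcs E \<Longrightarrow> set (map Ghost p) \<subseteq> lpa_gens E" for p by (auto simp: lpa_gens_def)
  show "b \<in> CB \<Longrightarrow> gp [] b = b" by (simp add: gp_def monomial_Nil)
  show "\<lbrakk>set (e # p) \<subseteq> arcs E; b \<in> CB\<rbrakk> \<Longrightarrow> gp (e # p) b = gp p (gh e b)"
    unfolding gp_def using *[of p] by (simp add: act_append lpa_gens_def)
  show "\<lbrakk>set p \<subseteq> arcs E; b \<in> CB\<rbrakk> \<Longrightarrow> gp p b \<in> CB"
    unfolding gp_def using *[of p] by (simp add: free_carrier_monomial)
qed

lemma gp_append: "\<lbrakk>set p \<subseteq> arcs E; set q \<subseteq> arcs E; b \<in> CB\<rbrakk> \<Longrightarrow> gp (p @ q) b = gp q (gp p b)"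
  by (induction p arbitrary: b) auto

lemma gp_zero [simp]: "set p \<subseteq> arcs E \<Longrightarrow> gp p \<zero>\<^bsub>B\<^esub> = \<zero>\<^bsub>B\<^esub>"
  by (induction p) auto

end

locale leavitt_module_pair = A?: leavitt_module E K A + B?: leavitt_module E K B
  for E :: "('v, 'e) pre_digraph" and K :: "'k::field itself"
    and A :: "(('v, 'e, 'k) lpa, 'a, 'y) module_scheme"
    and B :: "(('v, 'e, 'k) lpa, 'b, 'x) module_scheme"
begin

lemma module_homs_if_gens:
  assumes cl: "\<And>x. x \<in> carrier A \<Longrightarrow> f x \<in> carrier B"
    and add: "\<And>x y. \<lbrakk>x \<in> carrier A; y \<in> carrier A\<rbrakk> \<Longrightarrow> f (x \<oplus>\<^bsub>A\<^esub> y) = f x \<oplus>\<^bsub>B\<^esub> f y"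
    and scal: "\<And>k x. x \<in> carrier A \<Longrightarrow> f (A.sc k x) = B.sc k (f x)"
    and gens: "\<And>g x. \<lbrakk>g \<in> lpa_gens E; x \<in> carrier A\<rbrakk> \<Longrightarrow> f (A.act (monomial [g]) x) = B.act (monomial [g]) (f x)"
  shows "f \<in> module_homs L A B"
proof -
  have word_eq: "f (A.act (monomial w) x) = B.act (monomial w) (f x)" if "set w \<subseteq> lpa_gens E" "x \<in> carrier A" for w x
    using that
  proof (induction w)
    case (Cons g w)
    have "monomial w \<in> FC" using Cons.prems by (simp add: free_carrier_monomial)
    then show ?case using Cons gens[of g "A.act (monomial w) x"]
      by (simp add: A.act_Cons[of g w] B.act_Cons[of g w] cl)
  qed (simp add: monomial_Nil cl)
  have "f (A.act a x) = B.act a (f x)" if "a \<in> FC" "x \<in> carrier A" for a x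
    using that(1)
  proof (induction a rule: free_algebra_induct)
    case (word w k)
    have "monomial w \<in> FC" using word by (simp add: free_carrier_monomial)
    then show ?case using word that(2)
      by (simp add: word_eq A.act_mult B.act_mult free_carrier_scalar cl scal)
  next
    case (add a b)
    then show ?case using that(2) by (simp add: A.act_add B.act_add cl assms(2))
  qed
  then show ?thesis
    using cl add by (intro module_homsI) (auto simp: carrier_L A.act_def B.act_def)
qed

end

section \<open>The tail class of a closed path\<close>

lemma infinite_path_stl: "infinite_path E q \<Longrightarrow> infinite_path E (stl q)"
  unfolding infinite_path_def by (metis snth.simps(2))

lemma infinite_path_sdrop: "infinite_path E q \<Longrightarrow> infinite_path E (sdrop n q)"
  unfolding infinite_path_def by (simp add: sdrop_snth)

lemma infinite_path_SCons:
  "infinite_path E (e ## q) \<longleftrightarrow> e \<in> arcs E \<and> head E e = tail E (shd q) \<and> infinite_path E q"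
proof
  assume "infinite_path E (e ## q)"
  then show "e \<in> arcs E \<and> head E e = tail E (shd q) \<and> infinite_path E q"
    using infinite_path_stl[of E "e ## q"] unfolding infinite_path_def
    by (metis snth.simps(1) snth.simps(2) stream.sel(1) stream.sel(2))
next
  assume *: "e \<in> arcs E \<and> head E e = tail E (shd q) \<and> infinite_path E q"
  show "infinite_path E (e ## q)"
    unfolding infinite_path_def
  proof
    fix n show "(e ## q) !! n \<in> arcs E \<and> head E ((e ## q) !! n) = tail E ((e ## q) !! Suc n)"
      using * by (cases n) (auto simp: infinite_path_def)
  qed
qed

context wf_digraph
begin

lemma infinite_path_awalk:
  assumes "infinite_path G q"
  shows "awalk (tail G (shd q)) (stake n q) (tail G (q !! n))"
  using assms
proof (induction n arbitrary: q)
  case 0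
  then have "shd q \<in> arcs G" by (metis infinite_path_def snth.simps(1))
  then show ?case by (simp add: awalk_Nil_iff)
next
  case (Suc n)
  have q: "infinite_path G (shd q ## stl q)" using Suc.prems by simp
  show ?case using Suc.IH[OF infinite_path_stl[OF Suc.prems]] q
    unfolding infinite_path_SCons by (simp add: awalk_Cons_iff)
qed

lemma infinite_path_shift:
  "\<lbrakk>awalk u p (tail G (shd q)); infinite_path G q\<rbrakk> \<Longrightarrow> infinite_path G (p @- q)"
proof (induction p arbitrary: u)
  case (Cons e p)
  then show ?case by (cases p) (auto simp: awalk_Cons_iff infinite_path_SCons)
qed simp

lemma awalk_nth_Suc: "\<lbrakk>awalk u p v; Suc i < length p\<rbrakk> \<Longrightarrow> head G (p ! i) = tail G (p ! Suc i)"
proof (induction p arbitrary: u i)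
  case (Cons e p)
  then show ?case by (cases i; cases p) (auto simp: awalk_Cons_iff)
qed simp

lemma awalk_hd_last: "\<lbrakk>awalk u p v; p \<noteq> []\<rbrakk> \<Longrightarrow> tail G (hd p) = u \<and> head G (last p) = v"
proof (induction p arbitrary: u)
  case (Cons e p)
  then show ?case by (cases p) (auto simp: awalk_Cons_iff awalk_Nil_iff)
qed simp

lemma infinite_path_cycle:
  assumes "closed_w c"
  shows "infinite_path G (Stream.cycle c)"
proof -
  obtain u where u: "awalk u c u" and ne: "c \<noteq> []" using assms by (auto simp: closed_w_def)
  have nth: "Stream.cycle c !! n = c ! (n mod length c)" for n
  proof -
    have "Stream.cycle c !! n = shd (sdrop n (Stream.cycle c))" by simp
    also have "\<dots> = hd (rotate (n mod length c) c)" by (subst sdrop_cycle[OF ne]) simp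
    finally show ?thesis using ne by (simp add: hd_rotate_conv_nth)
  qed
  have "head G (c ! (n mod length c)) = tail G (c ! (Suc n mod length c))" for n
  proof (cases "Suc (n mod length c) < length c")
    case True
    then show ?thesis using awalk_nth_Suc[OF u True] by (simp add: mod_Suc)
  next
    case False
    then have l: "Suc (n mod length c) = length c"
      using ne by (metis Suc_lessI length_greater_0_conv mod_less_divisor)
    then have "c ! (n mod length c) = last c" using ne by (metis diff_Suc_1 last_conv_nth)
    moreover have "c ! (Suc n mod length c) = hd c" using l ne by (simp add: mod_Suc hd_conv_nth)
    ultimately show ?thesis using awalk_hd_last[OF u ne] by simp
  qed
  moreover have "c ! (n mod length c) \<in> arcs G" for n
    using u ne by (auto simp: awalk_def)
  ultimately show ?thesis by (simp only: infinite_path_def nth simp_thms)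
qed

end

declare Stream.cycle.sel(2) [simp del]

locale pruefer = leavitt E K for E :: "('v, 'e) pre_digraph" and K :: "'k::field itself" +
  fixes c :: "'e list"
  assumes basic: "basic_closed_path E c"
begin

abbreviation z where "z \<equiv> Stream.cycle c"
abbreviation C where "C \<equiv> tail_class E z"

lemma closed_c: "closed_w c" using basic by (simp add: basic_closed_path_def)

lemma c_ne: "c \<noteq> []" using closed_c by (auto simp: closed_w_def)

lemma c_arcs: "set c \<subseteq> arcs E" using closed_c by (auto simp: closed_w_def awalk_def)

lemma inf_z: "infinite_path E z" by (rule infinite_path_cycle[OF closed_c])

lemma z_in_C [simp]: "z \<in> C"
  using inf_z unfolding tail_class_def by blast

lemma C_inf: "q \<in> C \<Longrightarrow> infinite_path E q" by (simp add: tail_class_def)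

lemma C_shd: "q \<in> C \<Longrightarrow> shd q \<in> arcs E"
  using C_inf by (metis infinite_path_def snth.simps(1))

lemma C_head: "q \<in> C \<Longrightarrow> head E (shd q) = tail E (shd (stl q))"
  using C_inf by (metis infinite_path_def snth.simps)

lemma C_SCons: "e ## q \<in> C \<longleftrightarrow> e \<in> arcs E \<and> head E e = tail E (shd q) \<and> q \<in> C"
proof
  assume "e ## q \<in> C"
  then obtain m n where mn: "sdrop m z = sdrop n (e ## q)" and inf: "infinite_path E (e ## q)"
    by (auto simp: tail_class_def)
  have "sdrop (Suc m) z = sdrop n q"
    using arg_cong[OF mn, of stl] by (simp flip: sdrop_stl)
  then show "e \<in> arcs E \<and> head E e = tail E (shd q) \<and> q \<in> C"
    using inf unfolding tail_class_def infinite_path_SCons by blast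
next
  assume *: "e \<in> arcs E \<and> head E e = tail E (shd q) \<and> q \<in> C"
  then obtain m n where "sdrop m z = sdrop n q" by (auto simp: tail_class_def)
  then have "sdrop m z = sdrop (Suc n) (e ## q)" by simp
  then show "e ## q \<in> C"
    using * unfolding tail_class_def by (blast intro: infinite_path_SCons[THEN iffD2])
qed

lemma C_stl: "q \<in> C \<Longrightarrow> stl q \<in> C"
  using C_SCons[of "shd q" "stl q"] by simp

lemma C_sdrop: "q \<in> C \<Longrightarrow> sdrop n q \<in> C"
  by (induction n arbitrary: q) (auto intro: C_stl)

lemma C_ex_sdrop:
  assumes "q \<in> C" shows "\<exists>n. sdrop n q = z"
proof -
  obtain m n where mn: "sdrop m z = sdrop n q" using assms by (auto simp: tail_class_def)
  \<comment> \<open>Whole turns of c, at least m edges in all; dropping them from z gives z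
    back.\<close>
  let ?k = "length c * m"
  have "sdrop (n + (?k - m)) q = sdrop (?k - m) (sdrop m z)" using mn by simp
  also have "\<dots> = sdrop (m + (?k - m)) z" by simp
  also have "\<dots> = sdrop ?k z" using c_ne by (cases "length c") auto
  also have "\<dots> = z" using c_ne by simp
  finally show ?thesis by blast
qed

text \<open>By division with remainder, the least period p of z divides the length of c. Were it
  smaller than that length, c would be a proper power of the closed path
  \<open>stake p z\<close>.\<close>

lemma primitive:
  assumes "0 < k" "sdrop k z = z"
  shows "length c \<le> k"
proof (rule ccontr)
  assume "\<not> length c \<le> k"
  define p where "p = (LEAST k. 0 < k \<and> sdrop k z = z)"
  have p: "0 < p" "sdrop p z = z" using LeastI[of "\<lambda>k. 0 < k \<and> sdrop k z = z" k] assms unfolding p_def by auto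
  have least: "p \<le> j" if "0 < j" "sdrop j z = z" for j unfolding p_def by (rule Least_le) (use that in simp)
  have pk: "p < length c" using least[OF assms] \<open>\<not> _\<close> by simp
  have mult: "sdrop (p * m) z = z" for m
    by (induction m) (simp_all add: p(2) add.commute flip: sdrop_add)
  have "sdrop (length c mod p) z = sdrop (length c mod p) (sdrop (p * (length c div p)) z)" by (simp only: mult)
  also have "\<dots> = sdrop (length c) z" by simp
  also have "\<dots> = z" using c_ne by simp
  finally have "length c mod p = 0" using least[of "length c mod p"] p(1) by (metis gr0I mod_less_divisor not_less)
  then obtain m where m: "length c = p * m" by (metis mult_div_mod_eq add_0_right)
  define d where "d = stake p z"
  have "stake (p * m) z = concat (replicate m d)" for m
  proof (induction m)
    case (Suc m)
    have "stake (p * Suc m) z = stake p z @ stake (p * m) (sdrop p z)" by (simp only: stake_add mult_Suc_right)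
    then show ?case using Suc by (simp add: p(2) d_def)
  qed simp
  then have "c = concat (replicate m d)" using m c_ne by (metis stake_cycle_eq)
  moreover have "2 \<le> m" using m pk by (cases m; cases "m - 1") auto
  moreover have "closed_w d"
  proof -
    have "z !! p = shd z" using p(2) by (metis sdrop_simps(1))
    then have "awalk (tail E (shd z)) d (tail E (shd z))"
      using infinite_path_awalk[OF inf_z, of p] unfolding d_def by simp
    then show ?thesis using p(1) by (auto simp: closed_w_def d_def)
  qed
  ultimately show False using basic by (auto simp: basic_closed_path_def)
qed

text \<open>Taking the shortest path from q down to z makes \<open>\<tau>\<close> a spanning tree:
  prepending an edge extends \<open>\<tau> q\<close>, except when the result is z again, which
  closes the loop c.\<close>

definition nz where "nz q = (LEAST n. sdrop n q = z)"
definition \<tau> where "\<tau> q = stake (nz q) q"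

lemma \<tau>_shift: "q \<in> C \<Longrightarrow> \<tau> q @- z = q"
  unfolding \<tau>_def nz_def using LeastI_ex[OF C_ex_sdrop, of q] stake_sdrop[of "nz q" q] by (simp add: nz_def)

lemma \<tau>_z [simp]: "\<tau> z = []"
proof -
  have "nz z = 0" unfolding nz_def by (rule Least_equality) auto
  then show ?thesis by (simp add: \<tau>_def)
qed

lemma \<tau>_SCons:
  assumes "q \<in> C" "e ## q \<noteq> z"
  shows "\<tau> (e ## q) = e # \<tau> q"
proof -
  have "nz (e ## q) = Suc (nz q)"
    unfolding nz_def
    by (subst Least_Suc[of "\<lambda>n. sdrop n (e ## q) = z" "Suc (nz q)"])
      (use assms LeastI_ex[OF C_ex_sdrop, of q] in \<open>simp_all add: nz_def\<close>)
  then show ?thesis by (simp add: \<tau>_def)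
qed

text \<open>By primitivity, z recurs in \<open>stl z\<close> only after the rest of one full
  turn.\<close>

lemma \<tau>_stl_z: "\<tau> (stl z) = tl c"
proof -
  have "nz (stl z) = length c - 1"
    unfolding nz_def
  proof (rule Least_equality)
    show "sdrop (length c - 1) (stl z) = z"
    proof -
      have "Suc (length c - 1) = length c" using c_ne by simp
      then have "sdrop (Suc (length c - 1)) z = z" using sdrop_cycle_eq[OF c_ne] by simp
      then show ?thesis by (simp only: sdrop.simps(2))
    qed
    show "length c - 1 \<le> n" if "sdrop n (stl z) = z" for n
      using primitive[of "Suc n"] that by simp
  qed
  moreover have "stake (length c - 1) (stl z) = tl c"
  proof -
    have "Suc (length c - 1) = length c" using c_ne by simp
    then have "tl (stake (Suc (length c - 1)) z) = tl c" using stake_cycle_eq[OF c_ne] by simp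
    then show ?thesis by simp
  qed
  ultimately show ?thesis by (simp add: \<tau>_def)
qed

lemma shd_z: "shd z = hd c" by simp

lemma \<tau>_arcs: "q \<in> C \<Longrightarrow> set (\<tau> q) \<subseteq> arcs E"
  using C_inf infinite_path_awalk[of q "nz q"] by (auto simp: \<tau>_def awalk_def)

text \<open>Induction on the number of edges before z. The step excludes z, so it covers exactly the
  paths where \<open>\<tau>_SCons\<close> applies and where the twist introduced below is 1.\<close>

lemma C_induct [consumes 1, case_names z SCons]:
  assumes "q \<in> C" "P z"
    and "\<And>e q. \<lbrakk>q \<in> C; e ## q \<in> C; e ## q \<noteq> z; P q\<rbrakk> \<Longrightarrow> P (e ## q)"
  shows "P q"
proof -
  obtain n where "sdrop n q = z" using C_ex_sdrop[OF assms(1)] by blast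
  then show ?thesis using assms(1)
  proof (induction n arbitrary: q)
    case (Suc n)
    have "P (stl q)" using Suc C_stl by simp
    then show ?case
      using assms(2) assms(3)[where e = "shd q" and q = "stl q"] Suc.prems(2) C_stl[OF Suc.prems(2)]
      by (metis stream.collapse)
  qed (use assms(2) in simp)
qed

end

section \<open>Twisted functions on the tail class\<close>

type_synonym ('e, 'k) pfun = "'e stream \<Rightarrow> 'k poly"

lemma smult_sum_right: "smult k (sum f A) = (\<Sum>i\<in>A. smult k (f i))"
  by (induction A rule: infinite_finite_induct) (simp_all add: smult_add_right)

context pruefer
begin

text \<open>A turn of c that starts and ends at z meets this place once, so c acts there as 1 + x.
  The factor has to be a unit of K[[x]], as ghost edges must undo it.\<close>

definition tw :: "'e stream \<Rightarrow> 'k fps" where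
  "tw q = (if q = z then 1 + fps_X else 1)"

lemma tw_unit: "fps_nth (tw q) 0 \<noteq> 0" by (simp add: tw_def)

lemma tw_inverse [simp]: "tw q \<rhd> inverse (tw q) \<rhd> m = m" "inverse (tw q) \<rhd> tw q \<rhd> m = m"
  using inverse_mult_eq_1[OF tw_unit, of q] by (simp_all add: mult.commute flip: contract_assoc)

lemma tw_eq_0_iff [simp]: "tw q \<rhd> m = 0 \<longleftrightarrow> m = 0" "inverse (tw q) \<rhd> m = 0 \<longleftrightarrow> m = 0"
  by (metis contract_zero_right tw_inverse)+

text \<open>The action is described by values rather than on basis paths, so that it makes sense for
  infinite supports: the value at q comes from q itself, from \<open>stl q\<close> or from
  \<open>e ## q\<close>. The inverse twist of the ghost edges is dictated by the relations
  \<open>CK1\<close> and \<open>CK2\<close>.\<close>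

fun gact :: "('v, 'e) lpa_gen \<Rightarrow> ('e, 'k) pfun \<Rightarrow> ('e, 'k) pfun" where
  "gact (Vertex v) u q = (if v = tail E (shd q) then u q else 0)"
| "gact (Edge e) u q = (if q \<in> C \<and> shd q = e then tw q \<rhd> u (stl q) else 0)"
| "gact (Ghost e) u q = inverse (tw (e ## q)) \<rhd> u (e ## q)"

text \<open>\<open>UH\<close> is the product and \<open>UF\<close> the direct sum of copies of K[x]
  indexed by C; their members are total functions that vanish off C.\<close>

definition UH :: "('e, 'k) pfun set" where "UH = {u. \<forall>q. u q \<noteq> 0 \<longrightarrow> q \<in> C}"
definition UF :: "('e, 'k) pfun set" where "UF = {u \<in> UH. finite {q. u q \<noteq> 0}}"

lemma UH_outside: "u \<in> UH \<Longrightarrow> q \<notin> C \<Longrightarrow> u q = 0" by (auto simp: UH_def)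

lemma UHI: "(\<And>q. q \<notin> C \<Longrightarrow> u q = 0) \<Longrightarrow> u \<in> UH" by (auto simp: UH_def)

lemma UH_add: "\<lbrakk>u \<in> UH; u' \<in> UH\<rbrakk> \<Longrightarrow> (\<lambda>q. u q + u' q) \<in> UH"
  by (rule UHI) (simp add: UH_outside)

lemma UF_add:
  assumes "u \<in> UF" "u' \<in> UF" shows "(\<lambda>q. u q + u' q) \<in> UF"
proof -
  have "{q. u q + u' q \<noteq> 0} \<subseteq> {q. u q \<noteq> 0} \<union> {q. u' q \<noteq> 0}" by auto
  then have "finite {q. u q + u' q \<noteq> 0}"
    by (rule finite_subset) (use assms in \<open>simp add: UF_def\<close>)
  then show ?thesis using assms UH_add[of u u'] by (simp add: UF_def)
qed

lemma UF_UH: "u \<in> UF \<Longrightarrow> u \<in> UH" by (simp add: UF_def)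

lemma gact_UH: "u \<in> UH \<Longrightarrow> gact g u \<in> UH"
  by (cases g) (auto simp: UH_def C_SCons split: if_splits)

lemma gact_UF:
  assumes "u \<in> UF" shows "gact g u \<in> UF"
proof -
  let ?s = "{q. u q \<noteq> 0}"
  have fin: "finite ?s" using assms by (simp add: UF_def)
  have "finite {q. gact g u q \<noteq> 0}"
  proof (cases g)
    case (Vertex v)
    then show ?thesis by (intro finite_subset[OF _ fin]) auto
  next
    case (Edge e)
    have "{q. gact g u q \<noteq> 0} \<subseteq> (##) e ` ?s"
    proof
      fix q assume "q \<in> {q. gact g u q \<noteq> 0}"
      then have "q = e ## stl q" "u (stl q) \<noteq> 0" using Edge by (auto split: if_splits)
      then show "q \<in> (##) e ` ?s" by (metis (mono_tags, lifting) image_eqI mem_Collect_eq)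
    qed
    then show ?thesis using fin by (meson finite_imageI finite_subset)
  next
    case (Ghost e)
    have "{q. gact g u q \<noteq> 0} \<subseteq> stl ` ?s"
    proof
      fix q assume "q \<in> {q. gact g u q \<noteq> 0}"
      then have "u (e ## q) \<noteq> 0" using Ghost by auto
      then show "q \<in> stl ` ?s" by (metis (mono_tags, lifting) image_eqI mem_Collect_eq stream.sel(2))
    qed
    then show ?thesis using fin by (meson finite_imageI finite_subset)
  qed
  then show ?thesis using gact_UH[OF UF_UH[OF assms]] by (simp add: UF_def)
qed

lemma gact_add: "gact g (\<lambda>q. u q + u' q) q = gact g u q + gact g u' q"
  by (cases g) (auto simp: contract_add_right)

lemma gact_smult: "gact g (\<lambda>q. smult k (u q)) q = smult k (gact g u q)"
  by (cases g) (auto simp: contract_smult)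

lemma gact_contract: "gact g (\<lambda>q. f \<rhd> u q) q = f \<rhd> gact g u q"
  by (cases g) (auto intro: contract_commute)

definition wact :: "('v, 'e) lpa_gen list \<Rightarrow> ('e, 'k) pfun \<Rightarrow> ('e, 'k) pfun" where
  "wact w u = foldr gact w u"

lemma wact_simps [simp]: "wact [] u = u" "wact (g # w) u = gact g (wact w u)"
  by (simp_all add: wact_def)

lemma wact_append: "wact (w @ w') u = wact w (wact w' u)"
  by (simp add: wact_def)

lemma wact_UH: "u \<in> UH \<Longrightarrow> wact w u \<in> UH" by (induction w) (auto intro: gact_UH)

lemma wact_UF: "u \<in> UF \<Longrightarrow> wact w u \<in> UF" by (induction w) (auto intro: gact_UF)

lemma wact_add: "wact w (\<lambda>q. u q + u' q) = (\<lambda>q. wact w u q + wact w u' q)"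
  by (induction w) (auto simp: gact_add)

lemma wact_smult: "wact w (\<lambda>q. smult k (u q)) = (\<lambda>q. smult k (wact w u q))"
  by (induction w) (auto simp: gact_smult)

lemma wact_contract: "wact w (\<lambda>q. f \<rhd> u q) = (\<lambda>q. f \<rhd> wact w u q)"
  by (induction w) (auto simp: gact_contract)

definition lact :: "('v, 'e, 'k) lpa_free \<Rightarrow> ('e, 'k) pfun \<Rightarrow> ('e, 'k) pfun" where
  "lact a u q = (\<Sum>w\<in>Poly_Mapping.keys a. smult (Poly_Mapping.lookup a w) (wact (letters w) u q))"

lemma lact_superset:
  assumes "finite A" "Poly_Mapping.keys a \<subseteq> A"
  shows "lact a u q = (\<Sum>w\<in>A. smult (Poly_Mapping.lookup a w) (wact (letters w) u q))"
  unfolding lact_def by (rule sum.mono_neutral_left) (use assms in \<open>auto simp: in_keys_iff\<close>)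

lemma lact_add: "lact (a + b) u q = lact a u q + lact b u q"
proof -
  let ?A = "Poly_Mapping.keys a \<union> Poly_Mapping.keys b"
  have "Poly_Mapping.keys (a + b) \<subseteq> ?A" by (rule keys_add)
  then show ?thesis
    by (simp add: lact_superset[of ?A] lookup_add smult_add_left sum.distrib)
qed

lemma lact_single: "lact (Poly_Mapping.single w k) u q = smult k (wact (letters w) u q)"
  by (subst lact_superset[of "{w}"]) auto

lemma lact_zero [simp]: "lact 0 u q = 0" by (simp add: lact_def)

lemma lact_one [simp]: "lact 1 u = u"
  by (rule ext) (simp add: lact_single zero_fword_def flip: single_one)

lemma lact_uminus: "lact (- a) u q = - lact a u q"
  using lact_add[of a "- a" u q] by (simp add: eq_neg_iff_add_eq_0 add.commute)

lemma lact_diff: "lact (a - b) u q = lact a u q - lact b u q"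
  using lact_add[of a "- b" u q] by (simp add: lact_uminus)

lemma lact_sum: "lact (sum f A) u q = (\<Sum>i\<in>A. lact (f i) u q)"
  by (induction A rule: infinite_finite_induct) (simp_all add: lact_add)

lemma lact_monomial [simp]: "lact (monomial w) u = wact w u"
  by (rule ext) (simp add: monomial_def lact_single)

lemma lact_scalar: "lact (Poly_Mapping.single 0 k) u q = smult k (u q)"
  by (simp add: lact_single zero_fword_def)

lemma lact_add_right: "lact a (\<lambda>q. u q + u' q) q = lact a u q + lact a u' q"
  by (simp add: lact_def wact_add smult_add_right sum.distrib)

lemma lact_smult_right: "lact a (\<lambda>q. smult k (u q)) q = smult k (lact a u q)"
  by (simp add: lact_def wact_smult smult_sum_right mult.commute)

lemma lact_contract: "lact a (\<lambda>q. f \<rhd> u q) q = f \<rhd> lact a u q"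
  by (simp add: lact_def wact_contract contract_sum_right contract_smult)

lemma free_carrier_UNIV: "a \<in> free_carrier UNIV" by (simp add: free_carrier_def)

lemma lact_mult: "lact (a * b) u = lact a (lact b u)"
  using free_carrier_UNIV[of a]
proof (induction a rule: free_algebra_induct)
  case (word w k)
  show ?case
    using free_carrier_UNIV[of b]
  proof (induction b rule: free_algebra_induct)
    case (word w' k')
    have "Poly_Mapping.single 0 k * monomial w * (Poly_Mapping.single 0 k' * monomial w') =
        Poly_Mapping.single (FWord (w @ w')) (k * k')"
      by (simp add: mult_single plus_fword_def flip: single_eq_scalar_times_monomial)
    moreover have "lact (Poly_Mapping.single (FWord w') k') u = (\<lambda>q. smult k' (wact w' u q))"
      by (rule ext) (simp add: lact_single)
    ultimately show ?case
      by (intro ext) (simp add: lact_single wact_append wact_smult flip: single_eq_scalar_times_monomial)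
  next
    case (add b b')
    have "lact (b + b') u = (\<lambda>q. lact b u q + lact b' u q)" by (rule ext) (rule lact_add)
    then show ?case using add by (intro ext) (simp add: distrib_left lact_add lact_add_right)
  qed
next
  case (add a a')
  then show ?case by (intro ext) (simp add: distrib_right lact_add)
qed

lemma lact_UH: "u \<in> UH \<Longrightarrow> lact a u \<in> UH"
  unfolding UH_def lact_def using wact_UH[of u] by (auto simp: UH_def intro!: sum.neutral)

lemma lact_UF: assumes "u \<in> UF" shows "lact a u \<in> UF"
proof -
  have "{q. lact a u q \<noteq> 0} \<subseteq> (\<Union>w\<in>Poly_Mapping.keys a. {q. wact (letters w) u q \<noteq> 0})"
  proof
    fix q assume "q \<in> {q. lact a u q \<noteq> 0}"
    then have "(\<Sum>w\<in>Poly_Mapping.keys a. smult (Poly_Mapping.lookup a w) (wact (letters w) u q)) \<noteq> 0"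
      by (simp add: lact_def)
    then obtain w where "w \<in> Poly_Mapping.keys a" "smult (Poly_Mapping.lookup a w) (wact (letters w) u q) \<noteq> 0"
      by (rule sum.not_neutral_contains_not_neutral)
    then show "q \<in> (\<Union>w\<in>Poly_Mapping.keys a. {q. wact (letters w) u q \<noteq> 0})" by auto
  qed
  moreover have "finite (\<Union>w\<in>Poly_Mapping.keys a. {q. wact (letters w) u q \<noteq> 0})"
    using wact_UF[OF assms] by (auto simp: UF_def)
  ultimately have "finite {q. lact a u q \<noteq> 0}" by (rule finite_subset)
  then show ?thesis using lact_UH[OF UF_UH[OF assms]] by (simp add: UF_def)
qed

lemma lact_relation:
  assumes "r \<in> lpa_relations E" "u \<in> UH"
  shows "lact r u q = 0"
  using assms(1)
proof cases
  case (vertices v v')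
  then show ?thesis by (auto simp: lact_diff)
next
  case (source_edge e)
  then show ?thesis by (auto simp: lact_diff)
next
  case (edge_range e)
  then show ?thesis using C_head[of q] by (auto simp: lact_diff)
next
  case (range_ghost e)
  then show ?thesis using UH_outside[OF assms(2), of "e ## q"] by (auto simp: lact_diff C_SCons)
next
  case (ghost_source e)
  then show ?thesis by (auto simp: lact_diff)
next
  case (CK1 e e')
  then show ?thesis using UH_outside[OF assms(2), of q] by (auto simp: lact_diff C_SCons)
next
  case (CK2 v)
  \<comment> \<open>At q only the first edge of q contributes, and its twist cancels against the
    inverse.\<close>
  have "(\<Sum>e\<in>out_arcs E v. wact [Edge e, Ghost e] u q) =
      (\<Sum>e\<in>out_arcs E v. if e = shd q then if q \<in> C then u q else 0 else 0)"
    by (intro sum.cong) auto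
  also have "\<dots> = (if v = tail E (shd q) then u q else 0)"
    using CK2(3) UH_outside[OF assms(2), of q] C_shd[of q] by (auto simp: sum.delta)
  finally show ?thesis using CK2(1) by (simp add: lact_diff lact_sum)
next
  case unit
  have "(\<Sum>v\<in>verts E. wact [Vertex v] u q) = (\<Sum>v\<in>verts E. if v = tail E (shd q) then u q else 0)"
    by (intro sum.cong) auto
  also have "\<dots> = u q"
    using UH_outside[OF assms(2), of q] tail_in_verts[OF C_shd[of q]] by (cases "q \<in> C") (auto simp: sum.delta)
  finally show ?thesis using unit by (simp add: lact_diff lact_sum)
qed

text \<open>The annihilator of \<open>UH\<close> is a two-sided ideal, closed under right
  multiplication because \<open>UH\<close> is stable; it contains the relations and therefore all
  they generate.\<close>

lemma lact_ideal:
  assumes "a \<in> lpa_ideal E" "u \<in> UH"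
  shows "lact a u = (\<lambda>_. 0)"
proof -
  let ?ker = "{a \<in> FC. \<forall>u\<in>UH. lact a u = (\<lambda>_. 0)}"
  have kerI: "a \<in> ?ker" if "a \<in> FC" "\<And>u q. u \<in> UH \<Longrightarrow> lact a u q = 0" for a
    using that by (auto intro: ext)
  have kerD: "a \<in> FC" "\<And>u. u \<in> UH \<Longrightarrow> lact a u = (\<lambda>_. 0)" if "a \<in> ?ker" for a
    using that by simp_all
  have zero: "lact a (\<lambda>_. 0) = (\<lambda>_. 0)" for a
    using lact_smult_right[of a 0 "\<lambda>_. 0"] by (intro ext) simp
  have "ideal ?ker FA"
  proof (rule idealI[OF free_algebra_ring])
    show "subgroup ?ker (add_monoid FA)"
    proof (rule subgroup.intro)
      show "?ker \<subseteq> carrier (add_monoid FA)" by auto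
      show "\<one>\<^bsub>add_monoid FA\<^esub> \<in> ?ker" by (rule kerI) (simp_all add: free_carrier_zero)
    next
      fix a b assume a: "a \<in> ?ker" and b: "b \<in> ?ker"
      show "a \<otimes>\<^bsub>add_monoid FA\<^esub> b \<in> ?ker"
        by (rule kerI) (simp_all add: lact_add free_carrier_add kerD[OF a] kerD[OF b])
    next
      fix a assume a: "a \<in> ?ker"
      have "\<ominus>\<^bsub>FA\<^esub> a = - a"
        by (rule abelian_group.minus_equality[OF ring.is_abelian_group[OF free_algebra_ring]])
          (simp_all add: free_carrier_uminus kerD(1)[OF a])
      then have "inv\<^bsub>add_monoid FA\<^esub> a = - a" by (simp only: a_inv_def)
      moreover have "- a \<in> ?ker"
        by (rule kerI) (simp_all add: lact_uminus free_carrier_uminus kerD[OF a])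
      ultimately show "inv\<^bsub>add_monoid FA\<^esub> a \<in> ?ker" by (simp only:)
    qed
    fix a b assume a: "a \<in> ?ker" and b: "b \<in> carrier FA"
    show "b \<otimes>\<^bsub>FA\<^esub> a \<in> ?ker"
      by (rule kerI) (use b in \<open>simp_all add: lact_mult free_carrier_mult zero kerD[OF a]\<close>)
    show "a \<otimes>\<^bsub>FA\<^esub> b \<in> ?ker"
      by (rule kerI) (use b in \<open>simp_all add: lact_mult free_carrier_mult kerD[OF a] lact_UH\<close>)
  qed
  moreover have "lpa_relations E \<subseteq> ?ker"
    by (intro subsetI kerI) (use relations_FC lact_relation in auto)
  ultimately have "lpa_ideal E \<subseteq> ?ker"
    unfolding lpa_ideal_def by (rule ring.genideal_minimal[OF free_algebra_ring])
  then show ?thesis using assms kerD(2) by blast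
qed

text \<open>A class acts through an arbitrary representative, which \<open>lact_ideal\<close> makes
  harmless on \<open>UH\<close>. The carrier is a parameter so that one definition serves both
  \<open>UF\<close> and \<open>UH\<close>.\<close>

definition TM :: "('e, 'k) pfun set \<Rightarrow> (('v, 'e, 'k) lpa, ('e, 'k) pfun) module" where
  "TM W = \<lparr>carrier = W, monoid.mult = undefined, one = undefined, ring.zero = (\<lambda>_. 0),
     add = (\<lambda>u u' q. u q + u' q), module.smult = (\<lambda>A u. lact (SOME a. a \<in> A) u)\<rparr>"

lemma TM_simps [simp]:
  "carrier (TM W) = W" "\<zero>\<^bsub>TM W\<^esub> = (\<lambda>_. 0)" "u \<oplus>\<^bsub>TM W\<^esub> u' = (\<lambda>q. u q + u' q)"
  by (simp_all add: TM_def)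

lemma TM_smult:
  assumes "a \<in> FC" "u \<in> UH"
  shows "cls a \<odot>\<^bsub>TM W\<^esub> u = lact a u"
proof -
  have "(SOME b. b \<in> cls a) \<in> cls a" using mem_cls[OF assms(1)] by (rule someI)
  then obtain x where x: "x \<in> lpa_ideal E" "(SOME b. b \<in> cls a) = x + a" unfolding cls_subset by auto
  then have "cls a \<odot>\<^bsub>TM W\<^esub> u = lact (x + a) u" by (simp add: TM_def)
  also have "\<dots> = lact a u" by (rule ext) (simp add: lact_add lact_ideal[OF x(1) assms(2)])
  finally show ?thesis .
qed

lemma TM_left_module:
  assumes "W = UH \<or> W = UF"
  shows "left_module L (TM W)"
proof -
  have WU: "u \<in> UH" if "u \<in> W" for u using assms that by (auto simp: UF_def)
  have add: "(\<lambda>q. u q + u' q) \<in> W" if "u \<in> W" "u' \<in> W" for u u'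
    using assms that UH_add UF_add by auto
  have lact: "lact a u \<in> W" if "u \<in> W" for a u using assms that lact_UH lact_UF by auto
  show ?thesis
  proof (rule left_moduleI[OF L_ring]; (unfold carrier_L)?; (elim imageE)?)
    show "\<zero>\<^bsub>TM W\<^esub> \<in> carrier (TM W)" using assms by (auto simp: UH_def UF_def)
  next
    fix u assume "u \<in> carrier (TM W)"
    then show "\<one>\<^bsub>L\<^esub> \<odot>\<^bsub>TM W\<^esub> u = u" "\<zero>\<^bsub>L\<^esub> \<odot>\<^bsub>TM W\<^esub> u = \<zero>\<^bsub>TM W\<^esub>"
      using WU[of u] TM_smult[OF free_carrier_one, of u W] TM_smult[OF free_carrier_zero, of u W]
      by (auto simp: cls_one cls_zero)
  qed (auto simp: add lact TM_smult WU free_carrier_add free_carrier_mult lact_add lact_add_right lact_mult lact_UH add.assoc add.commute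
      simp flip: cls_add cls_mult)
qed

lemma UF_left_module: "left_module L (TM UF)" and UH_left_module: "left_module L (TM UH)"
  by (simp_all add: TM_left_module)

end

section \<open>Polynomials in c - 1 and normal forms\<close>

context pruefer
begin

definition xc :: "('v, 'e, 'k) lpa_free" where "xc = monomial (map Edge c) - 1"

lemma pathc_FC [simp]: "monomial (map Edge c) \<in> FC" by (rule path_FC[OF c_arcs])

lemma xc_FC [simp]: "xc \<in> FC" by (simp add: xc_def free_carrier_diff free_carrier_one)

lemma xc_power_FC [simp]: "xc ^ n \<in> FC"
  by (induction n) (simp_all add: free_carrier_one free_carrier_mult)

text \<open>Evaluation p(c - 1), carried out in the free algebra; it is multiplicative because
  scalars are central there.\<close>

definition ev :: "'k poly \<Rightarrow> ('v, 'e, 'k) lpa_free" where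
  "ev p = fold_coeffs (\<lambda>a f. Poly_Mapping.single 0 a + xc * f) p 0"

lemma ev_0 [simp]: "ev 0 = 0" by (simp add: ev_def)

lemma ev_pCons: "ev (pCons a p) = Poly_Mapping.single 0 a + xc * ev p"
  by (cases "a = 0 \<and> p = 0") (auto simp: ev_def)

lemma ev_FC [simp]: "ev p \<in> FC"
  by (induction p) (simp_all add: ev_pCons free_carrier_intros)

lemma ev_add: "ev (p + q) = ev p + ev q"
  by (induction p q rule: poly_induct2) (simp_all add: ev_pCons single_add algebra_simps)

lemma ev_smult: "ev (smult k p) = Poly_Mapping.single 0 k * ev p"
proof (induction p)
  case (pCons a p)
  have "xc * (Poly_Mapping.single 0 k * ev p) = Poly_Mapping.single 0 k * (xc * ev p)"
    by (simp only: scalar_commute[of xc] flip: mult.assoc)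
  then show ?case using pCons by (simp add: ev_pCons mult_single distrib_left)
qed simp

lemma ev_mult: "ev (p * q) = ev p * ev q"
  by (induction p) (simp_all add: ev_pCons ev_add ev_smult algebra_simps)

lemma ev_1 [simp]: "ev 1 = 1" by (simp add: one_pCons ev_pCons)

lemma ev_X_power: "ev ([:0, 1:] ^ n) = xc ^ n"
  by (induction n) (simp_all add: ev_pCons)

lemma ev_1_X: "ev [:1, 1:] = monomial (map Edge c)"
  by (simp add: ev_pCons xc_def)

definition delta :: "'e stream \<Rightarrow> 'k poly \<Rightarrow> ('e, 'k) pfun" where
  "delta q m = (\<lambda>q'. if q' = q then m else 0)"

lemma delta_simps [simp]: "delta q m q = m" "q' \<noteq> q \<Longrightarrow> delta q m q' = 0" "delta q 0 = (\<lambda>_. 0)"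
  by (auto simp: delta_def)

lemma delta_UF [simp]: "q \<in> C \<Longrightarrow> delta q m \<in> UF"
  by (auto simp: UF_def UH_def delta_def)

lemma gact_Edge_delta:
  "e ## q \<in> C \<Longrightarrow> gact (Edge e) (delta q m) = delta (e ## q) (tw (e ## q) \<rhd> m)"
proof
  fix q' assume "e ## q \<in> C"
  then show "gact (Edge e) (delta q m) q' = delta (e ## q) (tw (e ## q) \<rhd> m) q'"
    by (cases q'; cases "q' = e ## q") (auto simp: delta_def)
qed

lemma wact_\<tau>_delta: "q \<in> C \<Longrightarrow> wact (map Edge (\<tau> q)) (delta z m) = delta q m"
proof (induction q rule: C_induct)
  case (SCons e q)
  then show ?case by (simp add: \<tau>_SCons gact_Edge_delta) (simp add: tw_def)
qed simp

lemma z_Cons: "hd c ## stl z = z"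
  using stream.collapse[of z] by simp

lemma c_Cons: "c = hd c # \<tau> (stl z)"
  using c_ne by (simp add: \<tau>_stl_z)

lemma map_c: "map f c = f (hd c) # map f (\<tau> (stl z))"
  using arg_cong[OF c_Cons, of "map f"] by simp

text \<open>All edges of c but the first move the support from z to \<open>stl z\<close> along
  \<open>\<tau>\<close>, untwisted; the first edge then returns it to z and contributes the factor 1
  + x.\<close>

lemma wact_c_delta: "wact (map Edge c) (delta z m) = delta z ((1 + fps_X) \<rhd> m)"
proof -
  have "wact (map Edge c) (delta z m) = gact (Edge (hd c)) (delta (stl z) m)"
    by (simp only: map_c wact_simps wact_\<tau>_delta[OF C_stl[OF z_in_C]])
  also have "\<dots> = delta z ((1 + fps_X) \<rhd> m)"
    by (subst gact_Edge_delta) (simp_all only: z_Cons z_in_C tw_def if_True simp_thms)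
  finally show ?thesis .
qed

lemma wact_\<tau>: "\<lbrakk>q \<in> C; u \<in> UH\<rbrakk> \<Longrightarrow> wact (map Edge (\<tau> q)) u q = u z"
proof (induction q rule: C_induct)
  case (SCons e q)
  then show ?case by (simp add: \<tau>_SCons) (simp add: tw_def)
qed simp

lemma wact_c: "u \<in> UH \<Longrightarrow> wact (map Edge c) u z = (1 + fps_X) \<rhd> u z"
  by (simp add: map_c wact_\<tau>[OF C_stl[OF z_in_C]] tw_def)

lemma wact_ghost_\<tau>: "q \<in> C \<Longrightarrow> wact (rev (map Ghost (\<tau> q))) u z = u q"
proof (induction q arbitrary: u rule: C_induct)
  case (SCons e q)
  then show ?case by (simp add: \<tau>_SCons wact_append) (simp add: tw_def)
qed simp

lemma lact_xc_delta: "lact xc (delta z m) = delta z (fps_X \<rhd> m)"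
  by (rule ext) (simp add: xc_def lact_diff wact_c_delta contract_add_left, simp add: delta_def)

lemma lact_ev_delta: "lact (ev p) (delta z m) = delta z (fps_of_poly p \<rhd> m)"
proof (induction p)
  case (pCons a p)
  show ?case
    by (rule ext) (simp add: ev_pCons lact_add lact_scalar lact_mult pCons lact_xc_delta fps_of_poly_pCons
        contract_add_left contract_assoc mult.commute[of _ fps_X], simp add: delta_def)
qed simp

lemma lact_xc_power_delta: "lact (xc ^ n) (delta z m) = delta z (fps_X ^ n \<rhd> m)"
  using lact_ev_delta[of "[:0, 1:] ^ n" m] by (simp add: ev_X_power fps_of_poly_power)

lemma UF_induct [consumes 1, case_names zero add]:
  assumes "f \<in> UF" "P (\<lambda>_. 0)"
    and "\<And>f q m. \<lbrakk>f \<in> UF; P f; q \<in> C; f q = 0\<rbrakk> \<Longrightarrow> P (\<lambda>q'. f q' + delta q m q')"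
  shows "P f"
proof -
  have "finite {q. f q \<noteq> 0}" using assms(1) by (simp add: UF_def)
  then show ?thesis using assms(1)
  proof (induction "{q. f q \<noteq> 0}" arbitrary: f rule: finite_induct)
    case empty
    then have "f = (\<lambda>_. 0)" by auto
    then show ?case using assms(2) by simp
  next
    case (insert q S)
    let ?g = "f(q := 0)"
    have S: "S = {q. ?g q \<noteq> 0}" using insert.hyps(2,4) by auto
    have "q \<in> C" using insert.prems insert.hyps(4) UH_outside[OF UF_UH[OF insert.prems], of q] by auto
    moreover have "?g \<in> UF"
    proof -
      have "finite {q. ?g q \<noteq> 0}" using insert.hyps(1) S by simp
      moreover have "?g \<in> UH" by (rule UHI) (simp add: UH_outside[OF UF_UH[OF insert.prems]])
      ultimately show ?thesis by (simp add: UF_def)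
    qed
    moreover have "f = (\<lambda>q'. ?g q' + delta q (f q) q')" by (auto simp: delta_def)
    moreover have "?g q = 0" by simp
    ultimately show ?case using assms(3)[of ?g q "f q"] insert.hyps(3)[OF S] by metis
  qed
qed

text \<open>Normal forms modulo left multiples of a power of c - 1: the path from q to z followed by
  a polynomial in c - 1. The coefficients are finitely many polynomials indexed by C, so
  \<open>UF\<close> itself serves to index the forms.\<close>

definition spn :: "('e, 'k) pfun \<Rightarrow> ('v, 'e, 'k) lpa_free" where
  "spn f = (\<Sum>q\<in>{q. f q \<noteq> 0}. monomial (map Edge (\<tau> q)) * ev (f q))"

lemma \<tau>_FC [simp]: "q \<in> C \<Longrightarrow> monomial (map Edge (\<tau> q)) \<in> FC"
  by (rule path_FC[OF \<tau>_arcs])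

lemma spn_superset:
  assumes "finite S" "{q. f q \<noteq> 0} \<subseteq> S"
  shows "spn f = (\<Sum>q\<in>S. monomial (map Edge (\<tau> q)) * ev (f q))"
  unfolding spn_def by (rule sum.mono_neutral_left) (use assms in auto)

lemma spn_add:
  assumes "f \<in> UF" "g \<in> UF" shows "spn (\<lambda>q. f q + g q) = spn f + spn g"
proof -
  let ?S = "{q. f q \<noteq> 0} \<union> {q. g q \<noteq> 0}"
  have fin: "finite ?S" using assms by (simp add: UF_def)
  have "{q. f q + g q \<noteq> 0} \<subseteq> ?S" by auto
  then show ?thesis
    by (simp add: spn_superset[OF fin] ev_add distrib_left sum.distrib)
qed

lemma spn_delta [simp]: "spn (delta q m) = monomial (map Edge (\<tau> q)) * ev m"
  by (subst spn_superset[of "{q}"]) (auto simp: delta_def)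

lemma spn_zero [simp]: "spn (\<lambda>_. 0) = 0" by (simp add: spn_def)

lemma spn_FC: "f \<in> UF \<Longrightarrow> spn f \<in> FC"
  unfolding spn_def
  by (rule free_carrier_sum) (auto simp: UF_def UH_def intro!: free_carrier_mult)

text \<open>Different q do not interfere, so the coefficient polynomials can be tested one by one.
  This yields the independence of the normal forms.\<close>

lemma lact_spn:
  assumes "f \<in> UF" shows "lact (spn f) (delta z m) = (\<lambda>q. fps_of_poly (f q) \<rhd> m)"
  using assms
proof (induction f rule: UF_induct)
  case (add f q n)
  then show ?case
    by (intro ext) (simp add: spn_add lact_add lact_mult lact_ev_delta wact_\<tau>_delta fps_of_poly_add
        contract_add_left, auto simp: delta_def)
qed auto

end

section \<open>Vectors killed by a power of c - 1\<close>

locale pruefer_module = pruefer E K c + leavitt_module E K B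
  for E :: "('v, 'e) pre_digraph" and K :: "'k::field itself" and c :: "'e list"
    and B :: "(('v, 'e, 'k) lpa, 'b, 'x) module_scheme"
begin

lemma pa_c: "y \<in> CB \<Longrightarrow> pa c y = act xc y \<oplus>\<^bsub>B\<^esub> y"
  by (simp add: pa_def xc_def act_diff free_carrier_one B.M.minus_eq B.M.a_assoc B.M.l_neg)

abbreviation v0 where "v0 \<equiv> tail E (hd c)"

lemma v0_verts [simp]: "v0 \<in> verts E" using c_arcs c_ne by (metis hd_in_set subsetD tail_in_verts)

lemma pa_c_Cons: "y \<in> CB \<Longrightarrow> pa c y = ed (hd c) (pa (tl c) y)"
  using pa_simps(2)[of "hd c" "tl c" y] c_arcs c_ne by simp

lemma pa_c_ev: "b \<in> CB \<Longrightarrow> pa c (act (ev p) b) = act (ev ([:1, 1:] * p)) b"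
  unfolding ev_mult ev_1_X by (simp add: pa_def act_mult)

lemma hd_arcs [simp]: "hd c \<in> arcs E" "set (tl c) \<subseteq> arcs E"
  using c_arcs c_ne by (auto dest: list.set_sel(2))

end

locale pruefer_torsion = pruefer_module E K c B
  for E :: "('v, 'e) pre_digraph" and K :: "'k::field itself" and c :: "'e list"
    and B :: "(('v, 'e, 'k) lpa, 'b, 'x) module_scheme" +
  fixes b :: 'b and n :: nat
  assumes b_closed [simp]: "b \<in> carrier B" and torsion: "act (xc ^ n) b = \<zero>\<^bsub>B\<^esub>"
begin

text \<open>The normal forms applied to b. They turn out to exhaust the submodule generated by
  b.\<close>

definition G :: "'b set" where "G = (\<lambda>f. act (spn f) b) ` UF"

lemma G_zero: "\<zero>\<^bsub>B\<^esub> \<in> G"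
  unfolding G_def by (rule image_eqI[of _ _ "\<lambda>_. 0"]) (auto simp: UF_def UH_def)

lemma G_add: "\<lbrakk>x \<in> G; y \<in> G\<rbrakk> \<Longrightarrow> x \<oplus>\<^bsub>B\<^esub> y \<in> G"
proof -
  assume "x \<in> G" "y \<in> G"
  then obtain f g where fg: "f \<in> UF" "g \<in> UF" "x = act (spn f) b" "y = act (spn g) b"
    by (auto simp: G_def)
  then have "x \<oplus>\<^bsub>B\<^esub> y = act (spn (\<lambda>q. f q + g q)) b" by (simp add: spn_add act_add spn_FC)
  then show ?thesis unfolding G_def using UF_add[OF fg(1,2)] by (rule image_eqI)
qed

lemma G_term: "q \<in> C \<Longrightarrow> pa (\<tau> q) (act (ev p) b) \<in> G"
  unfolding G_def by (rule image_eqI[of _ _ "delta q p"]) (auto simp: act_mult pa_def)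

lemma ev_torsion: "act (xc ^ n) (act (ev p) b) = \<zero>\<^bsub>B\<^esub>"
proof -
  have "act (xc ^ n) (act (ev p) b) = act (ev p) (act (xc ^ n) b)"
    by (simp flip: act_mult ev_X_power ev_mult add: mult.commute)
  then show ?thesis by (simp add: torsion)
qed

lemma ev_torsion': "act (ev (p * [:0, 1:] ^ n)) b = \<zero>\<^bsub>B\<^esub>"
  by (simp add: ev_mult ev_X_power act_mult torsion)

text \<open>Write y as c y minus (c - 1) y: the first term is fixed by the source of c, the second
  by the induction hypothesis.\<close>

lemma vx_torsion: "\<lbrakk>y \<in> CB; act (xc ^ k) y = \<zero>\<^bsub>B\<^esub>\<rbrakk> \<Longrightarrow> vx v0 y = y"
proof (induction k arbitrary: y)
  case (Suc k)
  have y': "act xc y \<in> CB" "act (xc ^ k) (act xc y) = \<zero>\<^bsub>B\<^esub>"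
    using Suc.prems by (simp_all flip: act_mult power_Suc2)
  have "vx v0 (pa c y) = pa c y" using Suc.prems(1) by (simp add: pa_c_Cons vx_ed)
  then have "act xc y \<oplus>\<^bsub>B\<^esub> vx v0 y = act xc y \<oplus>\<^bsub>B\<^esub> y"
    using Suc.prems(1) Suc.IH[OF y'] y' by (simp add: pa_c act_add_right)
  then show ?case using y'(1) Suc.prems(1) by (simp del: B.M.add.r_cancel_one)
qed simp

lemma vx_term:
  assumes "q \<in> C"
  shows "vx (tail E (shd q)) (pa (\<tau> q) (act (ev p) b)) = pa (\<tau> q) (act (ev p) b)"
  using assms
proof (induction q rule: C_induct)
  case z
  show ?case using vx_torsion[OF _ ev_torsion, of p] by simp
next
  case (SCons e q')
  then show ?case using C_shd[OF SCons(2)] \<tau>_arcs[OF SCons(1)] by (simp add: \<tau>_SCons vx_ed_same)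
qed

text \<open>Generators move a normal form along the tree given by \<open>\<tau>\<close>, or kill it.
  The exceptions occur at z: the edge that closes the loop multiplies the coefficient by 1 + x, and
  a ghost edge applied there requires dividing it by 1 + x, which the torsion of b permits.\<close>

lemma G_gen:
  assumes q: "q \<in> C" and g: "g \<in> lpa_gens E"
  shows "act (monomial [g]) (pa (\<tau> q) (act (ev p) b)) \<in> G"
proof -
  let ?t = "pa (\<tau> q) (act (ev p) b)"
  have cl [simp]: "?t \<in> CB" using \<tau>_arcs[OF q] by simp
  have tv: "tail E (shd q) \<in> verts E" using C_shd[OF q] by simp
  consider (V) v where "g = Vertex v" "v \<in> verts E" | (D) e where "g = Edge e" "e \<in> arcs E"
    | (H) e where "g = Ghost e" "e \<in> arcs E" using g by (auto simp: lpa_gens_def)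
  then show ?thesis
  proof cases
    case V
    have "vx v ?t = (if v = tail E (shd q) then ?t else \<zero>\<^bsub>B\<^esub>)"
      using vx_vx[OF V(2) tv cl] vx_term[OF q, of p] by (auto split: if_splits)
    then show ?thesis using V G_zero G_term[OF q] by simp
  next
    case D
    have *: "ed e ?t = (if tail E (shd q) = head E e then ed e ?t else \<zero>\<^bsub>B\<^esub>)"
      using ed_vx[OF tv D(2) cl] by (simp only: vx_term[OF q])
    have "ed e ?t \<in> G" if h: "tail E (shd q) = head E e"
    proof (cases "e ## q = z")
      case False
      have "ed e ?t = pa (\<tau> (e ## q)) (act (ev p) b)"
        using D \<tau>_arcs[OF q] by (simp add: \<tau>_SCons[OF q False])
      then show ?thesis using G_term[of "e ## q" p] D h q by (simp add: C_SCons)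
    next
      case True
      then have "e = hd c" "q = stl z"
        by (metis shd_z stream.sel(1), metis stream.sel(2))
      then have "ed e ?t = pa c (act (ev p) b)" by (simp only: \<tau>_stl_z) (simp add: pa_c_Cons)
      also have "\<dots> = pa (\<tau> z) (act (ev ([:1, 1:] * p)) b)"
        unfolding pa_c_ev[OF b_closed] \<tau>_z by (rule pa_simps(1)[symmetric]) simp
      finally show ?thesis by (simp only: G_term[OF z_in_C])
    qed
    then show ?thesis using * D G_zero by (cases "tail E (shd q) = head E e") auto
  next
    case H
    have main: "gh e (ed e' (pa (\<tau> q') (act (ev r) b))) \<in> G" if "q' \<in> C" "e' ## q' \<in> C" for e' q' r
    proof -
      have "head E e' = tail E (shd q')" "e' \<in> arcs E" using that by (simp_all add: C_SCons)
      then have "gh e (ed e' (pa (\<tau> q') (act (ev r) b))) = (if e = e' then pa (\<tau> q') (act (ev r) b) else \<zero>\<^bsub>B\<^esub>)"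
        using H \<tau>_arcs[OF that(1)] vx_term[OF that(1), of r] by (simp add: gh_ed)
      then show ?thesis using G_zero G_term[OF that(1)] by simp
    qed
    show ?thesis using q
    proof (induction q rule: C_induct)
      case z
      \<comment> \<open>For y = -x, the finite geometric series inverts 1 - y = 1 + x modulo y^n,
        and the remainder kills b. So \<open>act (ev p) b\<close> becomes a turn of c applied to
        \<open>act (ev r) b\<close>, whose first edge the ghost edge can cancel.\<close>
      define y :: "'k poly" where "y = [:0, - 1:]"
      define r where "r = (\<Sum>i<n. y ^ i) * p"
      have "y ^ n = smult ((- 1) ^ n) ([:0, 1:] ^ n)"
        by (simp add: y_def flip: smult_power)
      then have "p * y ^ n = smult ((- 1) ^ n) p * [:0, 1:] ^ n" by simp
      then have 0: "act (ev (p * y ^ n)) b = \<zero>\<^bsub>B\<^esub>" by (simp only: ev_torsion')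
      have "1 - y ^ n = (1 - y) * (\<Sum>i<n. y ^ i)" by (rule one_diff_power_eq)
      moreover have "1 - y = [:1, 1:]" by (simp add: y_def one_pCons)
      ultimately have "p - p * y ^ n = [:1, 1:] * r" unfolding r_def by (metis mult.assoc mult.commute mult.right_neutral right_diff_distrib)
      then have "p = [:1, 1:] * r + p * y ^ n" by (simp only: diff_eq_eq)
      then have "act (ev p) b = act (ev ([:1, 1:] * r + p * y ^ n)) b" by (rule arg_cong)
      also have "\<dots> = pa c (act (ev r) b)"
        unfolding ev_add pa_c_ev[OF b_closed] by (subst act_add) (simp_all add: 0)
      also have "\<dots> = ed (hd c) (pa (\<tau> (stl z)) (act (ev r) b))"
        by (simp only: \<tau>_stl_z) (simp add: pa_c_Cons)
      finally have "gh e (act (ev p) b) = gh e (ed (hd c) (pa (\<tau> (stl z)) (act (ev r) b)))" by simp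
      also have "\<dots> \<in> G" by (rule main) (simp_all only: z_Cons z_in_C C_stl)
      finally show ?case using H by simp
    next
      case (SCons e' q')
      then have "e' \<in> arcs E" by (simp add: C_SCons)
      then show ?case using H main[OF SCons(1,2), of p] \<tau>_arcs[OF SCons(1)] by (simp add: \<tau>_SCons[OF SCons(1,3)])
    qed
  qed
qed

lemma G_gens:
  assumes g: "g \<in> lpa_gens E" and "x \<in> G"
  shows "act (monomial [g]) x \<in> G"
proof -
  have gFC: "monomial [g] \<in> FC" using g by (intro free_carrier_monomial) simp
  obtain f where f: "f \<in> UF" "x = act (spn f) b" using assms(2) by (auto simp: G_def)
  from f(1) have "act (monomial [g]) (act (spn f) b) \<in> G"
  proof (induction f rule: UF_induct)
    case zero
    then show ?case using gFC G_zero by simp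
  next
    case (add f q m)
    have "act (monomial [g]) (act (spn (delta q m)) b) \<in> G"
      using G_gen[OF add.hyps(2) g, of m] add.hyps(2) by (simp add: act_mult pa_def)
    then show ?case using add gFC delta_UF[OF add.hyps(2), of m] G_add
      by (simp add: spn_add act_add act_add_right spn_FC del: spn_delta)
  qed
  then show ?thesis using f by simp
qed

lemma G_all: "a \<in> FC \<Longrightarrow> act a b \<in> G"
proof (induction a rule: free_algebra_induct)
  case (word w k)
  have "act (monomial w) (sc k b) \<in> G" using word
  proof (induction w)
    case Nil
    have "sc k b = pa (\<tau> z) (act (ev [:k:]) b)" by (simp add: ev_pCons free_carrier_scalar)
    then show ?case using G_term[OF z_in_C, of "[:k:]"] by (simp add: monomial_Nil free_carrier_scalar)
  next
    case (Cons g w)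
    then show ?case using G_gens[of g "act (monomial w) (sc k b)"]
      by (simp add: act_Cons[of g w] free_carrier_scalar)
  qed
  then show ?case using word
    by (simp add: act_mult sc_commute free_carrier_scalar free_carrier_monomial)
next
  case (add a a')
  then show ?case by (simp add: act_add G_add)
qed

end

section \<open>The Pruefer module\<close>

context pruefer
begin

text \<open>The image of the generator of level n. For n \<ge> 1, (c - 1)^n kills it while (c -
  1)^(n-1) leaves the constant 1 at z.\<close>

abbreviation \<xi> where "\<xi> n \<equiv> delta z (monom 1 (n - 1))"
abbreviation RM where "RM \<equiv> regular_module L"
abbreviation NI where "NI \<equiv> left_ideal_power K E c"

lemma lpa_path_minus_one: "lpa_path E c \<ominus>\<^bsub>L\<^esub> \<one>\<^bsub>L\<^esub> = cls xc"
  by (simp add: lpa_path_eq xc_def cls_diff free_carrier_one cls_one)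

lemma cls_power: "cls xc [^]\<^bsub>L\<^esub> (n::nat) = cls (xc ^ n)"
proof -
  interpret L: ring L by (rule L_ring)
  show ?thesis
    by (induction n) (simp_all add: cls_one cls_mult power_Suc2 del: power_Suc)
qed

lemma NI_eq: "NI n = (\<lambda>a. cls (a * xc ^ n)) ` FC"
proof -
  have "NI n = (\<lambda>A. A \<otimes>\<^bsub>L\<^esub> cls (xc ^ n)) ` carrier L"
    unfolding left_ideal_power_def Let_def lpa_path_minus_one cls_power by auto
  also have "\<dots> = (\<lambda>a. cls a \<otimes>\<^bsub>L\<^esub> cls (xc ^ n)) ` FC"
    by (simp add: carrier_L image_image)
  also have "\<dots> = (\<lambda>a. cls (a * xc ^ n)) ` FC"
    by (rule image_cong) (simp_all add: cls_mult)
  finally show ?thesis .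
qed

lemma RM_simps [simp]:
  "carrier RM = carrier L" "x \<oplus>\<^bsub>RM\<^esub> y = x \<oplus>\<^bsub>L\<^esub> y" "x \<odot>\<^bsub>RM\<^esub> y = x \<otimes>\<^bsub>L\<^esub> y" "\<zero>\<^bsub>RM\<^esub> = \<zero>\<^bsub>L\<^esub>"
  by (simp_all add: regular_module_def)

lemma RM_left_module: "left_module L RM" by (rule regular_left_module[OF L_ring])

lemma RM_coset: "S +>\<^bsub>RM\<^esub> x = S +>\<^bsub>L\<^esub> x"
  by (simp add: a_r_coset_def r_coset_def)

lemma RM_minus: "\<lbrakk>x \<in> carrier L; y \<in> carrier L\<rbrakk> \<Longrightarrow> x \<ominus>\<^bsub>RM\<^esub> y = x \<ominus>\<^bsub>L\<^esub> y"
proof -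
  interpret L: ring L by (rule L_ring)
  interpret RM: left_module L RM by (rule RM_left_module)
  assume xy: "x \<in> carrier L" "y \<in> carrier L"
  have "\<ominus>\<^bsub>RM\<^esub> y = \<ominus>\<^bsub>L\<^esub> y"
    by (rule RM.M.minus_equality) (use xy in \<open>simp_all add: L.l_neg\<close>)
  then show ?thesis by (simp add: a_minus_def)
qed

lemma NI_submodule: "submodule (NI n) L RM"
proof -
  interpret RM: left_module L RM by (rule RM_left_module)
  show ?thesis
  proof (rule RM.submodule_intro)
    show "NI n \<subseteq> carrier RM" unfolding NI_eq by (auto simp: free_carrier_mult)
    show "\<zero>\<^bsub>RM\<^esub> \<in> NI n"
      unfolding NI_eq by (rule image_eqI[of _ _ 0]) (simp_all add: cls_zero free_carrier_zero)
    show "x \<oplus>\<^bsub>RM\<^esub> y \<in> NI n" if xy: "x \<in> NI n" "y \<in> NI n" for x y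
    proof -
      obtain a b where ab: "a \<in> FC" "b \<in> FC" "x = cls (a * xc ^ n)" "y = cls (b * xc ^ n)"
        using xy by (auto simp: NI_eq)
      then show ?thesis
        unfolding NI_eq by (intro image_eqI[of _ _ "a + b"])
          (simp_all add: cls_add free_carrier_add free_carrier_mult distrib_right)
    qed
    show "r \<odot>\<^bsub>RM\<^esub> x \<in> NI n" if rx: "r \<in> carrier L" "x \<in> NI n" for r x
    proof -
      obtain a b where ab: "a \<in> FC" "b \<in> FC" "r = cls b" "x = cls (a * xc ^ n)"
        using rx by (auto simp: NI_eq carrier_L)
      then show ?thesis
        unfolding NI_eq by (intro image_eqI[of _ _ "b * a"])
          (simp_all add: cls_mult free_carrier_mult mult.assoc)
    qed
  qed
qed

lemmas level_carrier = left_module.quotient_carrier[OF RM_left_module NI_submodule, folded prufer_level_def]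
  and level_eq_iff = left_module.quotient_eq_iff[OF RM_left_module NI_submodule, folded prufer_level_def]
  and level_hom = left_module.quotient_hom[OF RM_left_module NI_submodule, folded prufer_level_def]
  and level_left_module = left_module.quotient_left_module[OF RM_left_module NI_submodule, folded prufer_level_def]
  and level_zero = left_module.quotient_zero[OF RM_left_module NI_submodule, folded prufer_level_def]

definition cst :: "nat \<Rightarrow> ('v, 'e, 'k) lpa_free \<Rightarrow> ('v, 'e, 'k) lpa set" where
  "cst n a = NI n +>\<^bsub>RM\<^esub> cls a"

lemma cst_carrier: "carrier (prufer_level K E c n) = cst n ` FC"
  unfolding level_carrier by (simp add: carrier_L image_image cst_def)

lemma cst_closed: "a \<in> FC \<Longrightarrow> cst n a \<in> carrier (prufer_level K E c n)"
  by (simp add: cst_carrier)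

lemma cst_eq_iff: "\<lbrakk>a \<in> FC; b \<in> FC\<rbrakk> \<Longrightarrow> cst n a = cst n b \<longleftrightarrow> cls (a - b) \<in> NI n"
  unfolding cst_def by (simp add: level_eq_iff RM_minus cls_diff)

lemma cst_add: "\<lbrakk>a \<in> FC; b \<in> FC\<rbrakk> \<Longrightarrow> cst n (a + b) = cst n a \<oplus>\<^bsub>prufer_level K E c n\<^esub> cst n b"
  unfolding cst_def using module_homsD(2)[OF level_hom, of "cls a" "cls b" n] by (simp add: cls_add)

lemma cst_mult: "\<lbrakk>a \<in> FC; b \<in> FC\<rbrakk> \<Longrightarrow> cst n (a * b) = cls a \<odot>\<^bsub>prufer_level K E c n\<^esub> cst n b"
  unfolding cst_def using module_homsD(3)[OF level_hom, of "cls a" "cls b" n] by (simp add: cls_mult)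

lemma cst_zero: "cst n 0 = \<zero>\<^bsub>prufer_level K E c n\<^esub>"
  unfolding cst_def using level_zero[of n] by (simp add: cls_zero)

lemma level_torsion:
  "pruefer_torsion E K c (prufer_level K E c n) (cst n 1) n"
proof -
  interpret Q: leavitt_module E K "prufer_level K E c n"
    by (rule leavitt_module.intro[OF leavitt_axioms level_left_module])
  have "Q.act (xc ^ n) (cst n 1) = cst n (xc ^ n)"
    using cst_mult[of "xc ^ n" 1 n] by (simp add: Q.act_def free_carrier_one)
  also have "\<dots> = cst n 0"
    by (subst cst_eq_iff) (auto simp: NI_eq free_carrier_zero intro!: image_eqI[of _ _ 1] free_carrier_one)
  finally have "Q.act (xc ^ n) (cst n 1) = \<zero>\<^bsub>prufer_level K E c n\<^esub>" by (simp add: cst_zero)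
  then show ?thesis
    by (intro pruefer_torsion.intro pruefer_module.intro pruefer_axioms Q.leavitt_module_axioms pruefer_torsion_axioms.intro)
      (simp_all add: cst_closed free_carrier_one)
qed

lemma xc_power_\<xi>: "1 \<le> n \<Longrightarrow> lact (xc ^ n) (\<xi> n) = (\<lambda>_. 0)"
  by (simp add: lact_xc_power_delta contract_X_power_eq_0 degree_monom_eq)

lemma lact_zero_right [simp]: "lact a (\<lambda>_. 0) = (\<lambda>_. 0)"
  using lact_smult_right[of a 0 "\<lambda>_. 0"] by (intro ext) simp

lemma lact_cong:
  assumes "cls a = cls b" "a \<in> FC" "b \<in> FC" "u \<in> UH" shows "lact a u = lact b u"
  using TM_smult[of a u UH] TM_smult[of b u UH] assms by simp

lemma delta_UH [simp]: "q \<in> C \<Longrightarrow> delta q m \<in> UH" by (simp add: UF_UH)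

text \<open>This is where primitivity of the closed path enters, through the normal form of elements modulo
  the left ideal.\<close>

lemma NI_iff:
  assumes a: "a \<in> FC" and n: "1 \<le> n"
  shows "cls a \<in> NI n \<longleftrightarrow> lact a (\<xi> n) = (\<lambda>_. 0)"
proof
  assume "cls a \<in> NI n"
  then obtain y where "y \<in> FC" "cls a = cls (y * xc ^ n)" by (auto simp: NI_eq)
  then have "lact a (\<xi> n) = lact (y * xc ^ n) (\<xi> n)"
    using a by (intro lact_cong) (simp_all add: free_carrier_mult)
  then show "lact a (\<xi> n) = (\<lambda>_. 0)" by (simp only: lact_mult xc_power_\<xi>[OF n] lact_zero_right)
next
  assume 0: "lact a (\<xi> n) = (\<lambda>_. 0)"
  interpret T: pruefer_torsion E K c "prufer_level K E c n" "cst n 1" n by (rule level_torsion)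
  have act1: "T.act b (cst n 1) = cst n b" if "b \<in> FC" for b
    using cst_mult[OF that free_carrier_one] by (simp add: T.act_def)
  \<comment> \<open>A normal form with the same effect as a on the generator of the level.\<close>
  obtain f where f: "f \<in> UF" "T.act a (cst n 1) = T.act (spn f) (cst n 1)"
    using T.G_all[OF a] unfolding T.G_def by auto
  then have "cls (a - spn f) \<in> NI n"
    using a by (simp add: act1 spn_FC cst_eq_iff)
  then obtain y where y: "y \<in> FC" "cls (a - spn f) = cls (y * xc ^ n)" by (auto simp: NI_eq)
  then have "lact (a - spn f) (\<xi> n) = lact (y * xc ^ n) (\<xi> n)"
    using a f by (intro lact_cong) (simp_all add: free_carrier_mult free_carrier_diff spn_FC)
  also have "\<dots> = (\<lambda>_. 0)" by (simp only: lact_mult xc_power_\<xi>[OF n] lact_zero_right)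
  finally have *: "lact (spn f) (\<xi> n) q = 0" for q
    using lact_diff[of a "spn f" "\<xi> n" q] by (simp only: 0 diff_0 neg_0_equal_iff_equal)
  have "T.act (spn f) (cst n 1) = \<zero>\<^bsub>prufer_level K E c n\<^esub>"
  proof -
    \<comment> \<open>Each coefficient of the normal form contracts x^(n-1) to 0, hence is divisible
      by x^n and kills the generator of the level.\<close>
    have ev0: "T.act (ev (f q)) (cst n 1) = \<zero>\<^bsub>prufer_level K E c n\<^esub>" for q
    proof -
      have "fps_of_poly (f q) \<rhd> monom 1 (n - 1) = 0" using *[of q] by (simp add: lact_spn[OF f(1)])
      then have "coeff (f q) i = 0" if "i < n" for i
        using that by (auto simp: contract_monom_eq_0_iff)
      then have "monom 1 n dvd f q" by (simp add: monom_1_dvd_iff')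
      then obtain r where "f q = monom 1 n * r" by (rule dvdE)
      then have "f q = r * [:0, 1:] ^ n" by (simp only: monom_altdef smult_1_left mult.commute)
      then show ?thesis by (simp only: T.ev_torsion')
    qed
    have "T.act (spn f) (cst n 1) = (\<Oplus>\<^bsub>prufer_level K E c n\<^esub>q\<in>{q. f q \<noteq> 0}. T.act (monomial (map Edge (\<tau> q)) * ev (f q)) (cst n 1))"
      unfolding spn_def using f(1) by (intro T.act_sum) (auto simp: UF_def UH_def intro!: free_carrier_mult)
    also have "\<dots> = (\<Oplus>\<^bsub>prufer_level K E c n\<^esub>q\<in>{q. f q \<noteq> 0}. \<zero>\<^bsub>prufer_level K E c n\<^esub>)"
      using f(1) by (intro T.B.M.finsum_cong') (auto simp: UF_def UH_def T.act_mult ev0)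
    finally show ?thesis by simp
  qed
  then have "cst n a = cst n 0" using f(2) a by (simp add: act1 cst_zero)
  then show "cls a \<in> NI n" using a by (simp add: cst_eq_iff free_carrier_zero)
qed

text \<open>On level n \<ge> 1 this is the map from a + L(c - 1)^n to the function a \<xi>; by
  \<open>NI_iff\<close> it is well defined and injective.\<close>

definition \<theta> :: "nat \<Rightarrow> ('v, 'e, 'k) lpa set \<Rightarrow> ('e, 'k) pfun" where
  "\<theta> n S = lact (SOME a. a \<in> FC \<and> S = cst n a) (\<xi> n)"

lemma \<theta>_cst:
  assumes "a \<in> FC" "1 \<le> n" shows "\<theta> n (cst n a) = lact a (\<xi> n)"
proof -
  define b where "b = (SOME b. b \<in> FC \<and> cst n a = cst n b)"
  have b: "b \<in> FC" "cst n a = cst n b"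
    unfolding b_def using someI[of "\<lambda>b. b \<in> FC \<and> cst n a = cst n b" a] assms by simp_all
  then have "cls (a - b) \<in> NI n" using assms by (simp only: cst_eq_iff)
  then have 0: "lact (a - b) (\<xi> n) = (\<lambda>_. 0)"
    by (rule NI_iff[THEN iffD1, rotated 2]) (use assms b in \<open>simp_all add: free_carrier_diff\<close>)
  have "lact a (\<xi> n) = lact b (\<xi> n)"
  proof
    fix q show "lact a (\<xi> n) q = lact b (\<xi> n) q"
      using lact_diff[of a b "\<xi> n" q] unfolding 0 by simp
  qed
  then show ?thesis by (simp add: \<theta>_def b_def)
qed

text \<open>Right multiplication by (c - 1)^(j-i) takes the left ideal of level i into that of level
  j, so all cosets in the union defining \<open>prufer_map\<close> coincide.\<close>

lemma cst_prufer_map: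
  assumes "a \<in> FC" "i \<le> j" shows "prufer_map K E c i j (cst i a) = cst j (a * xc ^ (j - i))"
proof -
  interpret RM: left_module L RM by (rule RM_left_module)
  have N: "additive_subgroup (NI i) RM"
    using NI_submodule[of i] by (simp add: additive_subgroup_def submodule_def)
  interpret A: abelian_subgroup "NI i" RM
    using N by (rule abelian_subgroupI3) (rule RM.M.abelian_group_axioms)
  have "NI j +>\<^bsub>L\<^esub> (A \<otimes>\<^bsub>L\<^esub> cls (xc ^ (j - i))) = cst j (a * xc ^ (j - i))" if A: "A \<in> cst i a" for A
  proof -
    obtain m where m: "m \<in> NI i" "A = m \<oplus>\<^bsub>L\<^esub> cls a"
      using A unfolding cst_def a_r_coset_def' by auto
    then obtain y where y: "y \<in> FC" "m = cls (y * xc ^ i)" by (auto simp: NI_eq)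
    define a' where "a' = y * xc ^ i + a"
    have a': "a' \<in> FC" "A = cls a'"
      using y m assms(1) by (simp_all add: a'_def cls_add free_carrier_add free_carrier_mult)
    have "a' * xc ^ (j - i) - a * xc ^ (j - i) = y * (xc ^ i * xc ^ (j - i))"
      by (simp add: a'_def algebra_simps)
    also have "xc ^ i * xc ^ (j - i) = xc ^ j" using assms(2) by (simp flip: power_add)
    finally have "cls (a' * xc ^ (j - i) - a * xc ^ (j - i)) \<in> NI j" using y by (simp add: NI_eq)
    then have "cst j (a' * xc ^ (j - i)) = cst j (a * xc ^ (j - i))"
      using a' assms(1) by (simp only: cst_eq_iff free_carrier_mult xc_power_FC)
    then show ?thesis using a' by (simp add: cst_def RM_coset cls_mult)
  qed
  moreover have "cst i a \<noteq> {}" using A.a_rcos_self[of "cls a"] assms(1) by (auto simp: cst_def)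
  ultimately show ?thesis
    unfolding prufer_map_def Let_def lpa_path_minus_one cls_power by auto
qed

text \<open>The polynomials of degree below n form a cyclic module with generator x^(n-1): p is m
  with its coefficients reversed. The clause for m = 0 keeps the support finite when p is chosen
  pointwise.\<close>

lemma ex_contract_monom:
  assumes "degree m < n"
  shows "\<exists>p. fps_of_poly p \<rhd> monom 1 (n - 1) = m \<and> (m = 0 \<longrightarrow> p = 0)"
proof -
  define p where "p = (\<Sum>j<n. monom (coeff m (n - Suc j)) j)"
  have c: "coeff p i = (if i < n then coeff m (n - Suc i) else 0)" for i
    by (simp add: p_def coeff_sum sum.delta)
  have "coeff (fps_of_poly p \<rhd> monom 1 (n - 1)) i = coeff m i" for i
  proof (cases "i < n")
    case True
    then have "n - 1 - i < n" "n - Suc (n - 1 - i) = i" "i \<le> n - 1" by simp_all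
    then show ?thesis by (simp add: coeff_contract_monom c)
  next
    case False
    then show ?thesis using assms by (simp add: coeff_contract_monom coeff_eq_0)
  qed
  then show ?thesis by (intro exI[of _ p]) (auto simp: p_def poly_eq_iff)
qed

lemma UF_generated:
  assumes "u \<in> UF" shows "\<exists>n\<ge>1. \<exists>a\<in>FC. u = lact a (\<xi> n)"
proof -
  have fin: "finite {q. u q \<noteq> 0}" using assms by (simp add: UF_def)
  \<comment> \<open>A strict bound for all degrees on the finite support, and at least 1 because the
    levels start there.\<close>
  define n where "n = Suc (\<Sum>q\<in>{q. u q \<noteq> 0}. degree (u q))"
  have deg: "degree (u q) < n" for q
    using member_le_sum[of q "{q. u q \<noteq> 0}" "\<lambda>q. degree (u q)"] fin
    by (cases "u q = 0") (auto simp: n_def less_Suc_eq_le)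
  have "\<forall>q. \<exists>p. fps_of_poly p \<rhd> monom 1 (n - 1) = u q \<and> (u q = 0 \<longrightarrow> p = 0)"
    by (intro allI ex_contract_monom deg)
  from choice[OF this] obtain f
    where f: "\<And>q. fps_of_poly (f q) \<rhd> monom 1 (n - 1) = u q" "\<And>q. u q = 0 \<Longrightarrow> f q = 0"
    by auto
  have "{q. f q \<noteq> 0} \<subseteq> {q. u q \<noteq> 0}" using f by auto
  then have fUF: "f \<in> UF" using assms finite_subset[OF _ fin] by (auto simp: UF_def UH_def)
  have "u = lact (spn f) (\<xi> n)" unfolding lact_spn[OF fUF] f(1) ..
  then show ?thesis using spn_FC[OF fUF] by (intro exI[of _ n] conjI bexI[of _ "spn f"]) (simp_all add: n_def)
qed

text \<open>The maps \<theta> are compatible because (c - 1)^(j-i) takes the generator for j to that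
  for i. They are injective by \<open>NI_iff\<close> and cover \<open>UF\<close> by
  \<open>UF_generated\<close>, so the limit is \<open>UF\<close>.\<close>

lemma prufer_iso: "\<exists>\<Phi>. \<Phi> \<in> module_isos L (TM UF) (prufer_module K E c)"
proof -
  have \<xi>UF: "\<xi> n \<in> UF" for n by simp
  have "(\<lambda>u. {(i, x). i \<in> {1..} \<and> x \<in> carrier (prufer_level K E c i) \<and> \<theta> i x = u}) \<in>
      module_isos L (TM UF) (direct_limit {1..} (prufer_level K E c) (prufer_map K E c))"
  proof (rule direct_limit_iso)
    show "left_module L (TM UF)" by (rule UF_left_module)
    fix i :: nat assume i: "i \<in> {1..}"
    then have i1: "1 \<le> i" by simp
    note th = \<theta>_cst[OF _ i1]
    interpret Q: left_module L "prufer_level K E c i" by (rule level_left_module)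
    show "\<zero>\<^bsub>prufer_level K E c i\<^esub> \<in> carrier (prufer_level K E c i) \<and> \<theta> i \<zero>\<^bsub>prufer_level K E c i\<^esub> = \<zero>\<^bsub>TM UF\<^esub>"
      using \<theta>_cst[OF free_carrier_zero i1] by (simp flip: cst_zero add: cst_closed free_carrier_zero)
        (rule ext, simp)
    show "x \<oplus>\<^bsub>prufer_level K E c i\<^esub> y \<in> carrier (prufer_level K E c i)"
      if "x \<in> carrier (prufer_level K E c i)" "y \<in> carrier (prufer_level K E c i)" for x y
      using that by simp
    show "a \<odot>\<^bsub>prufer_level K E c i\<^esub> x \<in> carrier (prufer_level K E c i)"
      if "a \<in> carrier L" "x \<in> carrier (prufer_level K E c i)" for a x
      using that by (rule Q.smult_closed)
    show "\<theta> i \<in> module_homs L (prufer_level K E c i) (TM UF)"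
    proof (rule module_homsI)
      fix x assume "x \<in> carrier (prufer_level K E c i)"
      then show "\<theta> i x \<in> carrier (TM UF)" by (auto simp: cst_carrier th lact_UF)
    next
      fix x y assume "x \<in> carrier (prufer_level K E c i)" "y \<in> carrier (prufer_level K E c i)"
      then show "\<theta> i (x \<oplus>\<^bsub>prufer_level K E c i\<^esub> y) = \<theta> i x \<oplus>\<^bsub>TM UF\<^esub> \<theta> i y"
        by (auto simp: cst_carrier th lact_add free_carrier_add simp flip: cst_add)
    next
      fix r x assume "r \<in> carrier L" "x \<in> carrier (prufer_level K E c i)"
      then show "\<theta> i (r \<odot>\<^bsub>prufer_level K E c i\<^esub> x) = r \<odot>\<^bsub>TM UF\<^esub> \<theta> i x"
        by (auto simp: cst_carrier carrier_L th lact_mult free_carrier_mult TM_smult lact_UH simp flip: cst_mult)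
    qed
    show "inj_on (\<theta> i) (carrier (prufer_level K E c i))"
    proof (rule inj_onI)
      fix x y assume "x \<in> carrier (prufer_level K E c i)" "y \<in> carrier (prufer_level K E c i)" "\<theta> i x = \<theta> i y"
      then obtain a b where ab: "a \<in> FC" "b \<in> FC" "x = cst i a" "y = cst i b" "lact a (\<xi> i) = lact b (\<xi> i)"
        by (auto simp: cst_carrier th)
      then have "lact (a - b) (\<xi> i) = (\<lambda>_. 0)" by (intro ext) (simp add: lact_diff)
      then have "cls (a - b) \<in> NI i"
        by (rule NI_iff[THEN iffD2, rotated 2]) (use ab i1 in \<open>simp_all add: free_carrier_diff\<close>)
      then show "x = y" using ab by (simp only: cst_eq_iff)
    qed
    fix j x assume j: "j \<in> {1..}" "i \<le> j" "x \<in> carrier (prufer_level K E c i)"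
    then obtain a where a: "a \<in> FC" "x = cst i a" by (auto simp: cst_carrier)
    have "lact (xc ^ (j - i)) (\<xi> j) = \<xi> i"
      using j i by (simp add: lact_xc_power_delta contract_X_power_monom)
    then show "prufer_map K E c i j x \<in> carrier (prufer_level K E c j) \<and> \<theta> j (prufer_map K E c i j x) = \<theta> i x"
      using a j i by (simp add: cst_prufer_map \<theta>_cst cst_closed free_carrier_mult lact_mult)
  next
    fix u assume "u \<in> carrier (TM UF)"
    then obtain n a where "1 \<le> n" "a \<in> FC" "u = lact a (\<xi> n)" using UF_generated[of u] by auto
    then show "\<exists>i\<in>{1..}. u \<in> \<theta> i ` carrier (prufer_level K E c i)"
      by (intro bexI[of _ n] image_eqI[of _ _ "cst n a"]) (simp_all add: \<theta>_cst cst_closed)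
  qed auto
  then show ?thesis unfolding prufer_module_def by blast
qed

end

section \<open>Injectivity\<close>

definition poly_ring :: "'k::field poly ring" where
  "poly_ring = ring_of_type_algebra"

lemma poly_ring_simps [simp]:
  "carrier poly_ring = UNIV" "p \<otimes>\<^bsub>poly_ring\<^esub> q = p * q" "p \<oplus>\<^bsub>poly_ring\<^esub> q = p + q"
  "\<one>\<^bsub>poly_ring\<^esub> = 1" "\<zero>\<^bsub>poly_ring\<^esub> = 0"
  by (simp_all add: poly_ring_def ring_of_type_algebra_def)

lemma poly_ring_ring: "ring poly_ring"
  unfolding poly_ring_def by (rule ring_from_type_algebra)

definition contract_module :: "('k::field poly, 'k poly) module" where
  "contract_module = \<lparr>carrier = UNIV, monoid.mult = undefined, one = undefined, ring.zero = 0,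
     add = (+), module.smult = (\<lambda>p m. fps_of_poly p \<rhd> m)\<rparr>"

lemma contract_module_simps [simp]:
  "carrier contract_module = UNIV" "m \<oplus>\<^bsub>contract_module\<^esub> m' = m + m'" "\<zero>\<^bsub>contract_module\<^esub> = 0"
  "p \<odot>\<^bsub>contract_module\<^esub> m = fps_of_poly p \<rhd> m"
  by (simp_all add: contract_module_def)

lemma contract_left_module: "left_module poly_ring contract_module"
  by (rule left_moduleI[OF poly_ring_ring])
    (simp_all add: fps_of_poly_add fps_of_poly_mult contract_add_left contract_add_right contract_assoc)

text \<open>A nonzero ideal of K[x] is generated by an element p of least degree, and divisibility
  provides an m that p sends to the prescribed image of p.\<close>

lemma contract_module_Baer:
  fixes J :: "'k::field poly set"
  assumes J: "submodule J poly_ring (regular_module poly_ring)"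
    and k: "k \<in> module_homs poly_ring ((regular_module poly_ring)\<lparr>carrier := J\<rparr>) contract_module"
  shows "\<exists>m\<in>carrier contract_module. \<forall>a\<in>J. k a = a \<odot>\<^bsub>contract_module\<^esub> m"
proof -
  interpret J: submodule J poly_ring "regular_module poly_ring" by fact
  have add: "a + b \<in> J" if "a \<in> J" "b \<in> J" for a b
    using J.m_closed[OF that] by (simp add: regular_module_def)
  have mult: "a * b \<in> J" if "b \<in> J" for a b
    using J.smult_closed[of a b] that by (simp add: regular_module_def)
  have k_mult: "k (a * b) = fps_of_poly a \<rhd> k b" if "b \<in> J" for a b
    using k that by (auto simp: module_homs_def regular_module_def)
  show ?thesis
  proof (cases "J \<subseteq> {0}")
    case True
    have "k a = fps_of_poly a \<rhd> 0" if "a \<in> J" for a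
      using k_mult[OF that, of 0] True that by auto
    then show ?thesis by (intro bexI[of _ 0]) simp_all
  next
    case False
    then obtain p0 where p0: "p0 \<in> J \<and> p0 \<noteq> 0" by auto
    from ex_has_least_nat[of "\<lambda>p. p \<in> J \<and> p \<noteq> 0" p0 Polynomial.degree, OF p0]
    obtain p where p: "p \<in> J" "p \<noteq> 0"
      and min: "\<And>q. \<lbrakk>q \<in> J; q \<noteq> 0\<rbrakk> \<Longrightarrow> Polynomial.degree p \<le> Polynomial.degree q"
      by auto
    obtain m where m: "fps_of_poly p \<rhd> m = k p"
      using contract_divisible[of "fps_of_poly p" "k p"] p(2) fps_of_poly_eq_iff[of p 0] by auto
    have "k a = fps_of_poly a \<rhd> m" if "a \<in> J" for a
    proof -
      have "a mod p = a + (- (a div p)) * p" by (simp add: minus_div_mult_eq_mod[symmetric])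
      then have "a mod p \<in> J" using add[OF that mult[OF p(1)], of "- (a div p)"] by simp
      then have "a mod p = 0" using min[of "a mod p"] degree_mod_less[OF p(2), of a] by force
      then have a: "a = (a div p) * p" using div_mult_mod_eq[of a p] by simp
      have "k a = k ((a div p) * p)" using a by (rule arg_cong)
      also have "\<dots> = (fps_of_poly (a div p) * fps_of_poly p) \<rhd> m"
        by (simp only: k_mult[OF p(1)] contract_assoc m)
      also have "\<dots> = fps_of_poly a \<rhd> m" by (simp only: a[symmetric] flip: fps_of_poly_mult)
      finally show ?thesis .
    qed
    then show ?thesis by (intro bexI[of _ m]) simp_all
  qed
qed

section \<open>Restriction of scalars to K[x] and invisible elements\<close>

context pruefer_module
begin

definition poly_module :: "('k poly, 'b) module" where
  "poly_module = \<lparr>carrier = CB, monoid.mult = undefined, one = undefined, ring.zero = \<zero>\<^bsub>B\<^esub>,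
     add = add B, module.smult = (\<lambda>p b. act (ev p) b)\<rparr>"

lemma poly_module_simps [simp]:
  "carrier poly_module = CB" "x \<oplus>\<^bsub>poly_module\<^esub> y = x \<oplus>\<^bsub>B\<^esub> y" "\<zero>\<^bsub>poly_module\<^esub> = \<zero>\<^bsub>B\<^esub>"
  "p \<odot>\<^bsub>poly_module\<^esub> b = act (ev p) b"
  by (simp_all add: poly_module_def)

lemma poly_left_module: "left_module poly_ring poly_module"
  by (rule left_moduleI[OF poly_ring_ring])
    (simp_all add: ev_add ev_mult act_add act_mult act_add_right B.M.a_ac)

text \<open>Homomorphisms into the functions send these elements to functions vanishing at \<open>z\<close>.\<close>

definition invisible :: "'b set" where
  "invisible = {y \<in> CB. \<exists>n. gp (stake n z) y = \<zero>\<^bsub>B\<^esub>}"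

lemma z_arcs: "set (stake n z) \<subseteq> arcs E"
  using infinite_path_awalk[OF inf_z, of n] by (auto simp: awalk_def)

lemma gp_add: "\<lbrakk>set p \<subseteq> arcs E; x \<in> CB; y \<in> CB\<rbrakk> \<Longrightarrow> gp p (x \<oplus>\<^bsub>B\<^esub> y) = gp p x \<oplus>\<^bsub>B\<^esub> gp p y"
  by (induction p arbitrary: x y) (simp_all add: act_add_right)

lemma gp_ghost_word_FC: "set p \<subseteq> arcs E \<Longrightarrow> monomial (rev (map Ghost p)) \<in> FC"
  by (rule free_carrier_monomial) (auto simp: lpa_gens_def)

lemma act_diff_right: "\<lbrakk>a \<in> FC; x \<in> CB; y \<in> CB\<rbrakk> \<Longrightarrow> act a (x \<ominus>\<^bsub>B\<^esub> y) = act a x \<ominus>\<^bsub>B\<^esub> act a y"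
proof -
  assume *: "a \<in> FC" "x \<in> CB" "y \<in> CB"
  have "act a (x \<ominus>\<^bsub>B\<^esub> y) \<oplus>\<^bsub>B\<^esub> act a y = act a x"
    using * by (simp add: B.M.minus_eq B.M.a_assoc B.M.l_neg flip: act_add_right)
  then show ?thesis using * by (metis B.M.add.inv_solve_right B.M.minus_closed B.M.minus_eq act_closed)
qed

lemma gp_diff: "\<lbrakk>set p \<subseteq> arcs E; x \<in> CB; y \<in> CB\<rbrakk> \<Longrightarrow> gp p (x \<ominus>\<^bsub>B\<^esub> y) = gp p x \<ominus>\<^bsub>B\<^esub> gp p y"
  unfolding gp_def by (rule act_diff_right[OF gp_ghost_word_FC])

lemma gp_stake_mono:
  assumes "y \<in> CB" "gp (stake n z) y = \<zero>\<^bsub>B\<^esub>" "n \<le> m" shows "gp (stake m z) y = \<zero>\<^bsub>B\<^esub>"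
proof -
  have "set (stake (m - n) (sdrop n z)) \<subseteq> arcs E"
    using infinite_path_awalk[OF infinite_path_sdrop[OF inf_z]] by (auto simp: awalk_def)
  then have "gp (stake n z @ stake (m - n) (sdrop n z)) y = \<zero>\<^bsub>B\<^esub>"
    using assms z_arcs by (subst gp_append) simp_all
  then show ?thesis using assms(3) by (simp only: stake_add) simp
qed

lemma invisible_zero: "\<zero>\<^bsub>B\<^esub> \<in> invisible"
  using z_arcs by (auto simp: invisible_def)

lemma invisible_add:
  assumes "x \<in> invisible" "y \<in> invisible" shows "x \<oplus>\<^bsub>B\<^esub> y \<in> invisible"
proof -
  obtain n m where nm: "gp (stake n z) x = \<zero>\<^bsub>B\<^esub>" "gp (stake m z) y = \<zero>\<^bsub>B\<^esub>" and cl: "x \<in> CB" "y \<in> CB"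
    using assms by (auto simp: invisible_def)
  have "gp (stake (max n m) z) (x \<oplus>\<^bsub>B\<^esub> y) = \<zero>\<^bsub>B\<^esub>"
    using gp_stake_mono[OF cl(1) nm(1), of "max n m"] gp_stake_mono[OF cl(2) nm(2), of "max n m"] cl z_arcs
    by (simp add: gp_add)
  then show ?thesis using cl by (auto simp: invisible_def)
qed

lemma gp_act_central: "\<lbrakk>set p \<subseteq> arcs E; y \<in> CB\<rbrakk> \<Longrightarrow> gp p (sc k y) = sc k (gp p y)"
  unfolding gp_def by (rule sc_commute[OF gp_ghost_word_FC])

lemma gp_vx:
  assumes "set p \<subseteq> arcs E" "p \<noteq> []" "y \<in> CB"
  shows "gp p (vx (tail E (hd p)) y) = gp p y"
  using assms by (cases p) (simp_all add: gh_vx_same)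

lemma gp_pa:
  assumes "awalk u p w" "p \<noteq> []" "y \<in> CB"
  shows "gp p (pa p y) = vx w y"
  using assms
proof (induction p arbitrary: u)
  case (Cons e p)
  then have e: "e \<in> arcs E" "u = tail E e" "awalk (head E e) p w" by (auto simp: awalk_Cons_iff)
  then have p: "set p \<subseteq> arcs E" by (auto simp: awalk_def)
  have "gp (e # p) (pa (e # p) y) = gp p (vx (head E e) (pa p y))"
    using e p Cons.prems by (simp add: gh_ed)
  also have "\<dots> = vx w y"
  proof (cases p)
    case Nil
    then have "w = head E e" using e(3) by (simp add: awalk_Nil_iff)
    then show ?thesis using Nil e(1) \<open>y \<in> CB\<close> by simp
  next
    case (Cons e' p')
    then have "tail E (hd p) = head E e" using e(3) by (simp add: awalk_Cons_iff)
    then have "gp p (vx (head E e) (pa p y)) = gp p (pa p y)"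
      using gp_vx[of p "pa p y"] p Cons Cons.prems \<open>y \<in> CB\<close> by simp
    then show ?thesis using Cons.IH[OF e(3)] Cons \<open>y \<in> CB\<close> by simp
  qed
  finally show ?case .
qed simp

lemma awalk_c: "awalk v0 c v0"
  using closed_c awalk_hd_last[of _ c] c_ne by (auto simp: closed_w_def)

lemma stake_c_append: "stake (length c + n) z = c @ stake n z"
  using c_ne by (simp flip: stake_add)

lemma stake_Suc_c: "stake (Suc (length c)) z = c @ [hd c]"
  using stake_c_append[of 1] by simp

text \<open>A ghost turn of c cancels c and leaves its source vertex, which the ghost of a nonempty
  prefix of z absorbs. So a turn of c is put in front of the prefix that kills y.\<close>

lemma invisible_pa_c:
  assumes "y \<in> invisible" shows "pa c y \<in> invisible"
proof -
  obtain n where n: "gp (stake n z) y = \<zero>\<^bsub>B\<^esub>" and y: "y \<in> CB" using assms by (auto simp: invisible_def)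
  \<comment> \<open>One more edge ensures that the prefix is nonempty.\<close>
  have n': "gp (stake (Suc n) z) y = \<zero>\<^bsub>B\<^esub>" by (rule gp_stake_mono[OF y n]) simp
  define s where "s = stake (Suc n) z"
  have s: "set s \<subseteq> arcs E" "s \<noteq> []" "hd s = hd c" using z_arcs[of "Suc n"] by (simp_all add: s_def)
  have "gp (c @ s) (pa c y) = gp s (vx v0 y)"
    using gp_append[of c s "pa c y"] gp_pa[OF awalk_c c_ne y] s y c_arcs by simp
  also have "\<dots> = gp s y" using gp_vx[OF s(1,2) y] by (simp only: s(3))
  finally have "gp (stake (length c + Suc n) z) (pa c y) = \<zero>\<^bsub>B\<^esub>"
    unfolding stake_c_append using n' by (simp only: s_def)
  then show ?thesis using y c_arcs pa_simps(3) unfolding invisible_def by blast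
qed

lemma invisible_sc:
  assumes "y \<in> invisible" shows "sc k y \<in> invisible"
proof -
  obtain n where n: "gp (stake n z) y = \<zero>\<^bsub>B\<^esub>" and y: "y \<in> CB" using assms by (auto simp: invisible_def)
  have "gp (stake n z) (sc k y) = \<zero>\<^bsub>B\<^esub>"
    using y z_arcs by (simp add: gp_act_central n free_carrier_scalar)
  then show ?thesis using y by (auto simp: invisible_def free_carrier_scalar)
qed

lemma invisible_uminus: "y \<in> invisible \<Longrightarrow> \<ominus>\<^bsub>B\<^esub> y \<in> invisible"
proof -
  assume y: "y \<in> invisible"
  then have yc: "y \<in> CB" by (simp add: invisible_def)
  have "act (Poly_Mapping.single 0 (- 1)) y \<oplus>\<^bsub>B\<^esub> act 1 y = act 0 y"
    using yc act_add[of "Poly_Mapping.single 0 (- 1)" 1 y]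
    by (simp add: free_carrier_scalar free_carrier_one flip: single_one single_add)
  then have "sc (- 1) y = \<ominus>\<^bsub>B\<^esub> y"
    using yc by (intro B.M.minus_equality[symmetric]) (simp_all add: free_carrier_scalar)
  then show ?thesis using invisible_sc[OF y, of "- 1"] by simp
qed

lemma invisible_xc: "y \<in> invisible \<Longrightarrow> act xc y \<in> invisible"
proof -
  assume y: "y \<in> invisible"
  then have yc: "y \<in> CB" by (simp add: invisible_def)
  have "act xc y = pa c y \<oplus>\<^bsub>B\<^esub> (\<ominus>\<^bsub>B\<^esub> y)"
    using yc pa_c[OF yc] by (simp add: B.M.a_assoc B.M.r_neg)
  then show ?thesis using invisible_add[OF invisible_pa_c[OF y] invisible_uminus[OF y]] by simp
qed

lemma invisible_closed: "y \<in> invisible \<Longrightarrow> y \<in> CB" by (simp add: invisible_def)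

lemma invisible_ev: "y \<in> invisible \<Longrightarrow> act (ev p) y \<in> invisible"
proof (induction p)
  case 0
  then show ?case using invisible_zero invisible_closed by simp
next
  case (pCons a p)
  then show ?case
    by (simp add: ev_pCons act_add act_mult invisible_closed free_carrier_scalar free_carrier_mult invisible_add
        invisible_sc invisible_xc)
qed

end

context pruefer
begin

lemma TM_leavitt_module: "leavitt_module E K (TM UH)"
  by (rule leavitt_module.intro[OF leavitt_axioms UH_left_module])

lemma TM_act: "\<lbrakk>a \<in> FC; u \<in> UH\<rbrakk> \<Longrightarrow> leavitt_module.act E (TM UH) a u = lact a u"
  by (simp add: leavitt_module.act_def[OF TM_leavitt_module] TM_smult)

lemma lact_ev_at_z: "u \<in> UH \<Longrightarrow> lact (ev p) u z = fps_of_poly p \<rhd> u z"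
proof (induction p)
  case (pCons a p)
  have "lact xc (lact (ev p) u) z = fps_X \<rhd> lact (ev p) u z"
    using lact_UH[OF pCons.prems] by (simp add: xc_def lact_diff wact_c contract_add_left)
  then show ?case using pCons
    by (simp add: ev_pCons lact_add lact_scalar lact_mult fps_of_poly_pCons contract_add_left contract_assoc
        mult.commute[of _ fps_X])
qed simp

text \<open>A ghost path only relocates values and multiplies them by units.\<close>

lemma wact_ghost_eq_0_iff: "wact (rev (map Ghost p)) u q = 0 \<longleftrightarrow> u (p @- q) = 0"
proof (induction p arbitrary: u)
  case (Cons e p)
  have "wact (rev (map Ghost (e # p))) u q = 0 \<longleftrightarrow> gact (Ghost e) u (p @- q) = 0"
    by (simp add: wact_append Cons del: gact.simps)
  then show ?case by simp
qed simp

lemma wact_ghost_stake_eq_0: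
  "wact (rev (map Ghost (stake n q))) u (sdrop n q) = 0 \<Longrightarrow> u q = 0"
  by (simp add: wact_ghost_eq_0_iff stake_sdrop)

lemma wact_path_eq_0: "stake (length r) q \<noteq> r \<Longrightarrow> wact (map Edge r) u q = 0"
proof (induction r arbitrary: q)
  case (Cons e r)
  then show ?case by (cases "shd q = e") auto
qed simp

end

section \<open>Extending homomorphisms into the functions\<close>

locale pruefer_extension = B?: pruefer_module E K c B + A?: leavitt_module E K A
  for E :: "('v, 'e) pre_digraph" and K :: "'k::field itself" and c :: "'e list"
    and B :: "(('v, 'e, 'k) lpa, 'b, 'x) module_scheme"
    and A :: "(('v, 'e, 'k) lpa, 'a, 'y) module_scheme" +
  fixes i :: "'a \<Rightarrow> 'b" and g :: "'a \<Rightarrow> ('e, 'k) pfun"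
  assumes i_hom: "i \<in> module_homs L A B" and i_inj: "inj_on i (carrier A)"
    and g_hom: "g \<in> module_homs L A (TM UH)"
begin

lemma i_closed [simp]: "a \<in> carrier A \<Longrightarrow> i a \<in> carrier B" by (rule module_homsD(1)[OF i_hom])

lemma i_add: "\<lbrakk>a \<in> carrier A; b \<in> carrier A\<rbrakk> \<Longrightarrow> i (a \<oplus>\<^bsub>A\<^esub> b) = i a \<oplus>\<^bsub>B\<^esub> i b"
  by (rule module_homsD(2)[OF i_hom])

lemma i_act: "\<lbrakk>r \<in> FC; a \<in> carrier A\<rbrakk> \<Longrightarrow> i (A.act r a) = B.act r (i a)"
  unfolding A.act_def B.act_def by (rule module_homsD(3)[OF i_hom]) simp_all

lemma i_zero: "i \<zero>\<^bsub>A\<^esub> = \<zero>\<^bsub>B\<^esub>"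
  by (rule module_homs_zero[OF A.B.left_module_axioms B.B.left_module_axioms i_hom])

lemma g_UH: "a \<in> carrier A \<Longrightarrow> g a \<in> UH" using module_homsD(1)[OF g_hom] by simp

lemma g_add: "\<lbrakk>a \<in> carrier A; b \<in> carrier A\<rbrakk> \<Longrightarrow> g (a \<oplus>\<^bsub>A\<^esub> b) q = g a q + g b q"
  using module_homsD(2)[OF g_hom] by simp

lemma g_act: "\<lbrakk>r \<in> FC; a \<in> carrier A\<rbrakk> \<Longrightarrow> g (A.act r a) = lact r (g a)"
  using module_homsD(3)[OF g_hom, of "cls r" a] by (simp add: A.act_def TM_smult g_UH)

lemma g_zero: "g \<zero>\<^bsub>A\<^esub> q = 0"
  using module_homs_zero[OF A.B.left_module_axioms UH_left_module g_hom] by simp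

lemma g_diff: "\<lbrakk>a \<in> carrier A; b \<in> carrier A\<rbrakk> \<Longrightarrow> g (a \<ominus>\<^bsub>A\<^esub> b) q = g a q - g b q"
proof -
  assume ab: "a \<in> carrier A" "b \<in> carrier A"
  have "a \<ominus>\<^bsub>A\<^esub> b \<oplus>\<^bsub>A\<^esub> b = a" using ab by (simp add: A.B.M.minus_eq A.B.M.a_assoc A.B.M.l_neg)
  then have "g (a \<ominus>\<^bsub>A\<^esub> b) q + g b q = g a q" using g_add[of "a \<ominus>\<^bsub>A\<^esub> b" b q] ab by simp
  then show ?thesis by (simp add: eq_diff_eq)
qed

text \<open>The ghost of a prefix of z that kills \<open>i a\<close> kills a, by injectivity of i,
  and hence \<open>g a\<close>; but on functions it does not lose the value at z.\<close>

lemma g_invisible: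
  assumes "a \<in> carrier A" "i a \<in> B.invisible" shows "g a z = 0"
proof -
  obtain n where n: "B.gp (stake n z) (i a) = \<zero>\<^bsub>B\<^esub>" using assms(2) by (auto simp: B.invisible_def)
  let ?w = "monomial (rev (map Ghost (stake n z))) :: ('v, 'e, 'k) lpa_free"
  have w: "?w \<in> FC" by (rule B.gp_ghost_word_FC[OF B.z_arcs])
  have "i (A.act ?w a) = i \<zero>\<^bsub>A\<^esub>" using n w assms(1) by (simp add: i_act i_zero B.gp_def)
  then have "A.act ?w a = \<zero>\<^bsub>A\<^esub>" using i_inj w assms(1) by (simp add: inj_on_def)
  then have "wact (rev (map Ghost (stake n z))) (g a) (sdrop n z) = 0"
    using g_act[OF w assms(1)] g_zero by simp
  then show ?thesis by (rule wact_ghost_stake_eq_0)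
qed

text \<open>The functional is prescribed on the image of i, by evaluating g at z, and to be 0 on the
  invisible elements. Both prescriptions agree on the overlap by \<open>g_invisible\<close>.\<close>

definition G0 :: "('b \<times> 'k poly) set" where
  "G0 = {(i a \<oplus>\<^bsub>B\<^esub> y, g a z) | a y. a \<in> carrier A \<and> y \<in> B.invisible}"

lemma G0_graph: "submodule_graph poly_ring B.poly_module contract_module G0"
proof (intro submodule_graph.intro B.poly_left_module contract_left_module submodule_graph_axioms.intro)
  note [simp] = B.invisible_closed
  show "G0 \<subseteq> carrier B.poly_module \<times> carrier contract_module" by (auto simp: G0_def)
  show "(\<zero>\<^bsub>B.poly_module\<^esub>, \<zero>\<^bsub>contract_module\<^esub>) \<in> G0"
    unfolding G0_def using B.invisible_zero
    by (intro CollectI exI[of _ "\<zero>\<^bsub>A\<^esub>"] exI[of _ "\<zero>\<^bsub>B\<^esub>"]) (simp add: i_zero g_zero)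
  {
    fix s t s' t' assume "(s, t) \<in> G0" "(s', t') \<in> G0"
    then obtain a y a' y' where *: "a \<in> carrier A" "y \<in> B.invisible" "a' \<in> carrier A" "y' \<in> B.invisible"
      "s = i a \<oplus>\<^bsub>B\<^esub> y" "t = g a z" "s' = i a' \<oplus>\<^bsub>B\<^esub> y'" "t' = g a' z"
      by (auto simp: G0_def)
    then show "(s \<oplus>\<^bsub>B.poly_module\<^esub> s', t \<oplus>\<^bsub>contract_module\<^esub> t') \<in> G0"
      unfolding G0_def
      by (intro CollectI exI[of _ "a \<oplus>\<^bsub>A\<^esub> a'"] exI[of _ "y \<oplus>\<^bsub>B\<^esub> y'"])
        (simp add: i_add g_add B.invisible_add B.B.M.a_ac)
    have "t = t'" if "s = s'"
    proof -
      have "i a \<oplus>\<^bsub>B\<^esub> y = i a' \<oplus>\<^bsub>B\<^esub> y'" using that * by simp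
      then have "y' \<ominus>\<^bsub>B\<^esub> y = i a \<ominus>\<^bsub>B\<^esub> i a'"
        using * by (subst B.B.M.add_eq_add_iff_diff[symmetric]) simp_all
      also have "\<dots> = i (a \<ominus>\<^bsub>A\<^esub> a')"
      proof -
        have "i (a \<ominus>\<^bsub>A\<^esub> a') \<oplus>\<^bsub>B\<^esub> i a' = i a"
          using * i_add[of "a \<ominus>\<^bsub>A\<^esub> a'" a'] by (simp add: A.B.M.minus_eq A.B.M.a_assoc A.B.M.l_neg)
        then show ?thesis
          using * by (metis A.B.M.minus_closed B.B.M.add.inv_solve_right B.B.M.minus_eq i_closed)
      qed
      finally have "i (a \<ominus>\<^bsub>A\<^esub> a') = y' \<oplus>\<^bsub>B\<^esub> (\<ominus>\<^bsub>B\<^esub> y)" by (simp add: B.B.M.minus_eq)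
      then have "i (a \<ominus>\<^bsub>A\<^esub> a') \<in> B.invisible"
        using B.invisible_add[OF *(4) B.invisible_uminus[OF *(2)]] by simp
      then have "g (a \<ominus>\<^bsub>A\<^esub> a') z = 0" using * by (intro g_invisible) simp_all
      then show ?thesis using * by (simp add: g_diff)
    qed
  }
  note uniq = this
  show "t = t'" if "(s, t) \<in> G0" "(s, t') \<in> G0" for s t t'
    by (rule uniq[OF that refl])
  fix p s t assume "(s, t) \<in> G0"
  then obtain a y where *: "a \<in> carrier A" "y \<in> B.invisible" "s = i a \<oplus>\<^bsub>B\<^esub> y" "t = g a z"
    by (auto simp: G0_def)
  then show "(p \<odot>\<^bsub>B.poly_module\<^esub> s, p \<odot>\<^bsub>contract_module\<^esub> t) \<in> G0"
    unfolding G0_def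
    by (intro CollectI exI[of _ "A.act (ev p) a"] exI[of _ "B.act (ev p) y"])
      (simp add: i_act g_act B.invisible_ev B.act_add_right lact_ev_at_z g_UH)
qed

text \<open>Baer's criterion is used here over K[x], for a single functional; the full homomorphism
  is rebuilt from it afterwards.\<close>

lemma ex_functional:
  obtains \<phi> where "\<And>x y. \<lbrakk>x \<in> carrier B; y \<in> carrier B\<rbrakk> \<Longrightarrow> \<phi> (x \<oplus>\<^bsub>B\<^esub> y) = \<phi> x + \<phi> y"
    "\<And>p x. x \<in> carrier B \<Longrightarrow> \<phi> (B.act (ev p) x) = fps_of_poly p \<rhd> \<phi> x"
    "\<And>a. a \<in> carrier A \<Longrightarrow> \<phi> (i a) = g a z"
    "\<And>y. y \<in> B.invisible \<Longrightarrow> \<phi> y = 0"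
proof -
  obtain \<phi> where \<phi>: "\<phi> \<in> module_homs poly_ring B.poly_module contract_module"
    and ext: "\<forall>(x, y)\<in>G0. \<phi> x = y"
    using Baer_extension[OF G0_graph contract_module_Baer] by blast
  show thesis
  proof (rule that[of \<phi>])
    fix a assume a: "a \<in> carrier A"
    then have "(i a, g a z) \<in> G0"
      unfolding G0_def using B.invisible_zero
      by (intro CollectI exI[of _ a] exI[of _ "\<zero>\<^bsub>B\<^esub>"]) simp
    then show "\<phi> (i a) = g a z" using ext by auto
  next
    fix y assume y: "y \<in> B.invisible"
    then have "(y, 0) \<in> G0"
      unfolding G0_def
      by (intro CollectI exI[of _ "\<zero>\<^bsub>A\<^esub>"] exI[of _ y]) (simp add: i_zero g_zero B.invisible_closed)
    then show "\<phi> y = 0" using ext by auto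
  qed (use module_homsD[OF \<phi>] in simp_all)
qed

end

context pruefer_extension
begin

text \<open>The value of a function at q is its value at z after the ghost of
  \<open>\<tau> q\<close>. This forces the definition of h from \<open>\<phi>\<close>, and what
  remains is equivariance under the generators, which is formal away from z. At z, where
  \<open>\<tau>\<close> is empty, elements are compared after the ghost of a prefix of z, using that
  \<open>\<phi>\<close> vanishes on invisible elements.\<close>

theorem extension_exists: "\<exists>h\<in>module_homs L B (TM UH). \<forall>a\<in>carrier A. h (i a) = g a"
proof (rule ex_functional)
  fix \<phi> assume add: "\<And>x y. \<lbrakk>x \<in> carrier B; y \<in> carrier B\<rbrakk> \<Longrightarrow> \<phi> (x \<oplus>\<^bsub>B\<^esub> y) = \<phi> x + \<phi> y"
    and ev: "\<And>p x. x \<in> carrier B \<Longrightarrow> \<phi> (B.act (ev p) x) = fps_of_poly p \<rhd> \<phi> x"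
    and phi_i: "\<And>a. a \<in> carrier A \<Longrightarrow> \<phi> (i a) = g a z"
    and inv: "\<And>y. y \<in> B.invisible \<Longrightarrow> \<phi> y = 0"
  note [simp] = B.hd_arcs
  have zero: "\<phi> \<zero>\<^bsub>B\<^esub> = 0" by (rule inv[OF B.invisible_zero])
  have sc: "\<phi> (B.sc k x) = smult k (\<phi> x)" if "x \<in> carrier B" for k x
    using ev[OF that, of "[:k:]"] by (simp add: ev_pCons fps_of_poly_const)
  \<comment> \<open>Equality may be tested after the ghost of any prefix of z, since the difference
    is then invisible.\<close>
  have eqI: "\<phi> x = \<phi> y"
    if "x \<in> carrier B" "y \<in> carrier B" "B.gp (stake n z) x = B.gp (stake n z) y" for n x y
  proof -
    have "B.gp (stake n z) (x \<ominus>\<^bsub>B\<^esub> y) = B.gp (stake n z) x \<ominus>\<^bsub>B\<^esub> B.gp (stake n z) y"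
      using that B.z_arcs by (intro B.gp_diff)
    also have "\<dots> = \<zero>\<^bsub>B\<^esub>" using that B.z_arcs by (simp add: B.B.M.minus_eq B.B.M.r_neg)
    finally have "B.gp (stake n z) (x \<ominus>\<^bsub>B\<^esub> y) = \<zero>\<^bsub>B\<^esub>" .
    then have "x \<ominus>\<^bsub>B\<^esub> y \<in> B.invisible" unfolding B.invisible_def using that(1,2) by (intro CollectI conjI exI[of _ n]) simp_all
    moreover have "\<phi> x = \<phi> (x \<ominus>\<^bsub>B\<^esub> y) + \<phi> y"
      using add[of "x \<ominus>\<^bsub>B\<^esub> y" y] that by (simp add: B.B.M.minus_eq B.B.M.a_assoc B.B.M.l_neg)
    ultimately show ?thesis by (simp add: inv)
  qed
  have stake1: "stake 1 z = [hd c]" by simp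
  have gp1: "B.gp (stake 1 z) x = B.gh (hd c) x" if "x \<in> carrier B" for x
    unfolding stake1 using that by simp
  have \<tau>cl [simp]: "B.gp (\<tau> q) x \<in> carrier B" if "q \<in> C" "x \<in> carrier B" for q x
    using \<tau>_arcs that by simp
  have vertex: "\<phi> (B.gp (\<tau> q) (B.vx w x)) = (if w = tail E (shd q) then \<phi> (B.gp (\<tau> q) x) else 0)"
    if "q \<in> C" "w \<in> verts E" "x \<in> carrier B" for q w x
    using that
  proof (induction q rule: C_induct)
    case z
    \<comment> \<open>As \<open>\<tau> z\<close> is empty, nothing absorbs the vertex yet; one ghost
      edge of z does.\<close>
    have "B.gp (stake 1 z) (B.vx w x) = B.gp (stake 1 z) (if w = B.v0 then x else \<zero>\<^bsub>B\<^esub>)"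
      using z by (simp only: gp1 B.act_closed gen_mono_FC B.B.M.zero_closed split: if_split)
        (simp add: B.gh_vx)
    from eqI[OF _ _ this] show ?case using z by (auto simp: zero split: if_splits)
  next
    case (SCons e q)
    then have e: "e \<in> arcs E" by (simp add: C_SCons)
    then show ?case using SCons \<tau>_arcs[OF SCons.hyps(1)]
      by (auto simp: \<tau>_SCons B.gh_vx zero)
  qed
  have edge: "\<phi> (B.gp (\<tau> q) (B.ed e x)) = (if shd q = e then tw q \<rhd> \<phi> (B.gp (\<tau> (stl q)) x) else 0)"
    if "q \<in> C" "e \<in> arcs E" "x \<in> carrier B" for q e x
    using that
  proof (induction q rule: C_induct)
    case z
    show ?case
    proof (cases "e = hd c")
      case False
      then have "B.gp (stake 1 z) (B.ed e x) = B.gp (stake 1 z) \<zero>\<^bsub>B\<^esub>"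
        using z by (simp only: gp1 B.act_closed gen_mono_FC B.B.M.zero_closed) (simp add: B.gh_ed)
      from eqI[OF _ _ this] show ?thesis using z False by (simp add: zero)
    next
      case True
      \<comment> \<open>The edge that closes the loop has to produce the factor 1 + x. The edge
        applied to x and c applied to \<open>?y\<close> agree after the ghost of one turn and one
        more edge, which absorbs the vertex left by cancelling c; and under \<open>\<phi>\<close>
        the path c becomes 1 + x.\<close>
      let ?y = "B.gp (tl c) x"
      have y: "?y \<in> carrier B" using z by simp
      have pc: "B.pa c ?y \<in> carrier B" using y c_arcs by simp
      have "B.gp (stake (Suc (length c)) z) (B.pa c ?y) = B.gp [hd c] (B.gp c (B.pa c ?y))"
        unfolding B.stake_Suc_c using pc c_arcs by (intro B.gp_append) simp_all
      also have "\<dots> = B.gp [hd c] ?y"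
        using B.gp_pa[OF B.awalk_c c_ne y] B.gp_vx[of "[hd c]" ?y] y by simp
      also have "\<dots> = B.gp (tl c @ [hd c]) x"
        using z by (simp add: B.gp_append)
      also have "\<dots> = B.gp (tl c @ [hd c]) (B.vx (tail E (hd (tl c @ [hd c]))) x)"
        using z by (intro B.gp_vx[symmetric]) simp_all
      \<comment> \<open>The appended edge covers the case of a loop, where \<open>tl c\<close> is
        empty.\<close>
      also have "tail E (hd (tl c @ [hd c])) = head E (hd c)"
      proof -
        have "awalk (tail E (shd z)) (c @ [hd c]) (tail E (z !! Suc (length c)))"
          using infinite_path_awalk[OF inf_z, of "Suc (length c)"] unfolding B.stake_Suc_c .
        then have "awalk (tail E (shd z)) (hd c # (tl c @ [hd c])) (tail E (z !! Suc (length c)))"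
          using c_ne by (metis append_Cons list.collapse)
        then show ?thesis unfolding awalk_Cons_iff using awalk_hd_last by blast
      qed
      also have "B.gp (tl c @ [hd c]) (B.vx (head E (hd c)) x) = B.gp (stake (Suc (length c)) z) (B.ed (hd c) x)"
      proof -
        have "stake (Suc (length c)) z = hd c # tl c @ [hd c]" unfolding B.stake_Suc_c using c_ne by simp
        then show ?thesis using z by (simp only: B.gp_simps) (simp add: B.gh_ed)
      qed
      finally have "\<phi> (B.pa c ?y) = \<phi> (B.ed (hd c) x)"
        by (rule eqI[rotated 2]) (use pc z in simp_all)
      moreover have "\<phi> (B.pa c ?y) = (1 + fps_X) \<rhd> \<phi> ?y"
      proof -
        have "B.pa c ?y = B.act (ev [:1, 1:]) ?y" by (simp only: ev_1_X B.pa_def)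
        then show ?thesis using ev[OF y, of "[:1, 1:]"] by (simp add: fps_of_poly_pCons)
      qed
      ultimately show ?thesis using True z by (simp add: \<tau>_stl_z tw_def)
    qed
  next
    case (SCons e' q)
    then have e': "e' \<in> arcs E" "head E e' = tail E (shd q)" by (simp_all add: C_SCons)
    then show ?case using SCons \<tau>_arcs[OF SCons.hyps(1)] vertex[OF SCons.hyps(1) head_in_verts, of e' x]
      by (auto simp: \<tau>_SCons B.gh_ed zero tw_def)
  qed
  have ghost: "\<phi> (B.gp (\<tau> q) (B.gh e x)) =
      (if e ## q \<in> C then inverse (tw (e ## q)) \<rhd> \<phi> (B.gp (\<tau> (e ## q)) x) else 0)"
    if q: "q \<in> C" and e: "e \<in> arcs E" and x: "x \<in> carrier B" for q e x
  proof (cases "e ## q \<in> C")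
    case False
    then have "head E e \<noteq> tail E (shd q)" using q e by (simp add: C_SCons)
    then show ?thesis using vertex[OF q head_in_verts[OF e], of "B.gh e x"] False e x by (simp add: B.vx_gh_same)
  next
    case True
    show ?thesis
    proof (cases "e ## q = z")
      case False
      then show ?thesis using True e x \<tau>_arcs[OF q] by (simp add: \<tau>_SCons[OF q] tw_def)
    next
      case eqz: True
      then have eq: "e = hd c" "q = stl z" by (metis shd_z stream.sel(1), metis stream.sel(2))
      \<comment> \<open>Here x and c applied to \<open>?y\<close> agree after the same ghost prefix,
        so \<open>\<phi> x\<close> is 1 + x acting on \<open>\<phi> ?y\<close>; undoing it gives the
        inverse twist.\<close>
      let ?y = "B.gp c x"
      have y: "?y \<in> carrier B" using x c_arcs by simp
      have pc: "B.pa c ?y \<in> carrier B" using y c_arcs by simp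
      have "B.gp (stake (Suc (length c)) z) (B.pa c ?y) = B.gp [hd c] (B.gp c (B.pa c ?y))"
        unfolding B.stake_Suc_c using pc c_arcs by (intro B.gp_append) simp_all
      also have "\<dots> = B.gp [hd c] ?y"
        using B.gp_pa[OF B.awalk_c c_ne y] B.gp_vx[of "[hd c]" ?y] y by simp
      also have "\<dots> = B.gp (stake (Suc (length c)) z) x"
        unfolding B.stake_Suc_c using x c_arcs by (intro B.gp_append[symmetric]) simp_all
      finally have "\<phi> (B.pa c ?y) = \<phi> x" by (rule eqI[rotated 2]) (use pc x in simp_all)
      moreover have "B.pa c ?y = B.act (ev [:1, 1:]) ?y" by (simp only: ev_1_X B.pa_def)
      ultimately have "\<phi> x = (1 + fps_X) \<rhd> \<phi> ?y" using ev[OF y, of "[:1, 1:]"] by (simp add: fps_of_poly_pCons)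
      then have "inverse (tw z) \<rhd> \<phi> x = \<phi> ?y" using tw_inverse(2)[of z "\<phi> ?y"] by (simp add: tw_def)
      moreover have "?y = B.gp (\<tau> q) (B.gh e x)"
        using x c_ne B.hd_arcs c_arcs unfolding eq \<tau>_stl_z by (metis B.gp_simps(2) list.collapse)
      ultimately show ?thesis using eqz x by simp
    qed
  qed
  define h where "h x q = (if q \<in> C then \<phi> (B.gp (\<tau> q) x) else 0)" for x q
  have hUH: "h x \<in> UH" for x by (rule UHI) (simp add: h_def)
  interpret T: leavitt_module E K "TM UH" by (rule TM_leavitt_module)
  interpret P: leavitt_module_pair E K B "TM UH" by unfold_locales
  have T_act: "T.act a u = lact a u" if "a \<in> FC" "u \<in> UH" for a u using TM_act that by blast
  have "h \<in> module_homs L B (TM UH)"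
  proof (rule P.module_homs_if_gens)
    fix x assume x: "x \<in> carrier B"
    show "h x \<in> carrier (TM UH)" by (simp add: hUH)
    show "h (x \<oplus>\<^bsub>B\<^esub> y) = h x \<oplus>\<^bsub>TM UH\<^esub> h y" if "y \<in> carrier B" for y
      using x that \<tau>_arcs by (intro ext) (simp add: h_def B.gp_add add)
    show "h (B.sc k x) = T.sc k (h x)" for k
      using x \<tau>_arcs by (intro ext) (simp add: T_act hUH free_carrier_scalar lact_scalar h_def B.gp_act_central sc)
    fix a assume a: "a \<in> lpa_gens E"
    then have mono: "monomial [a] \<in> FC" by (intro free_carrier_monomial) simp
    have "h (B.act (monomial [a]) x) q = gact a (h x) q" for q
    proof (cases "q \<in> C")
      case False
      then show ?thesis using UH_outside[OF gact_UH[OF hUH] False, of a x] by (simp add: h_def)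
    next
      case True
      consider (V) v where "a = Vertex v" "v \<in> verts E" | (D) e where "a = Edge e" "e \<in> arcs E"
        | (H) e where "a = Ghost e" "e \<in> arcs E" using a by (auto simp: lpa_gens_def)
      then show ?thesis
      proof cases
        case V
        then show ?thesis using vertex[OF True V(2) x] True by (simp add: h_def)
      next
        case D
        then show ?thesis using edge[OF True D(2) x] True C_stl[OF True] by (simp add: h_def)
      next
        case H
        then show ?thesis using ghost[OF True H(2) x] True by (simp add: h_def)
      qed
    qed
    then show "h (B.act (monomial [a]) x) = T.act (monomial [a]) (h x)"
      using mono by (simp add: T_act hUH fun_eq_iff)
  qed
  moreover have "h (i a) = g a" if a: "a \<in> carrier A" for a
  proof
    fix q show "h (i a) q = g a q"
    proof (cases "q \<in> C")
      case True
      let ?w = "monomial (rev (map Ghost (\<tau> q))) :: ('v, 'e, 'k) lpa_free"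
      have w: "?w \<in> FC" by (rule B.gp_ghost_word_FC[OF \<tau>_arcs[OF True]])
      have "h (i a) q = \<phi> (i (A.act ?w a))" using True w a by (simp add: h_def B.gp_def i_act)
      also have "\<dots> = lact ?w (g a) z" using w a by (simp add: phi_i g_act)
      also have "\<dots> = g a q" by (simp add: wact_ghost_\<tau>[OF True])
      finally show ?thesis .
    qed (use UH_outside[OF g_UH[OF a]] in \<open>simp add: h_def\<close>)
  qed
  ultimately show ?thesis by blast
qed

end

context pruefer
begin

theorem UH_injective: "injective_module TYPE('m) L (TM UH)"
  unfolding injective_module_def
proof (intro conjI allI impI UH_left_module)
  fix A B :: "(('v, 'e, 'k) lpa, 'm) module" and i g
  assume *: "left_module L A \<and> left_module L B \<and> i \<in> module_homs L A B \<and> inj_on i (carrier A) \<and>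
    g \<in> module_homs L A (TM UH)"
  then interpret pruefer_extension E K c B A i g
    by (intro pruefer_extension.intro pruefer_module.intro pruefer_axioms leavitt_module.intro leavitt_axioms
        pruefer_extension_axioms.intro) simp_all
  show "\<exists>h\<in>module_homs L B (TM UH). \<forall>x\<in>carrier A. h (i x) = g x" by (rule extension_exists)
qed

lemma UF_eq_UH: "finite C \<Longrightarrow> UF = UH"
  by (auto simp: UF_def UH_def intro: finite_subset)

end

section \<open>Closed paths that are not maximal cycles\<close>

text \<open>A closed path visits its base point first and last, so dropping either entry of the
  vertex list leaves the same vertices. The list of tails is preferred because it rotates along with
  the path.\<close>

lemma (in wf_digraph) cycle_iff_distinct_tails:
  "cycle p \<longleftrightarrow> closed_w p \<and> distinct (map (tail G) p)"
proof -
  have "distinct (tl (awalk_verts u p)) \<longleftrightarrow> distinct (map (tail G) p)" if "awalk u p u" "p \<noteq> []" for u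
  proof -
    have "tail G (hd p) = u" "head G (last p) = u" using awalk_hd_last[OF that] by simp_all
    then show ?thesis using that(2) by (cases p) (auto simp: awalk_verts_conv)
  qed
  then show ?thesis by (auto simp: cycle_def closed_w_def)
qed

text \<open>A repeated vertex encloses a shorter closed path.\<close>

lemma (in wf_digraph) closed_w_contains_cycle:
  assumes "closed_w p" shows "\<exists>r. cycle r \<and> set r \<subseteq> set p"
  using assms
proof (induction "length p" arbitrary: p rule: less_induct)
  case less
  then obtain u where u: "awalk u p u" "p \<noteq> []" by (auto simp: closed_w_def)
  show ?case
  proof (cases "distinct (tl (awalk_verts u p))")
    case True
    then show ?thesis using u by (auto simp: cycle_def)
  next
    case False
    obtain e es where p: "p = e # es" using u(2) by (cases p) auto
    have es: "awalk (head G e) es u" "\<not> distinct (awalk_verts (head G e) es)"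
      using u(1) False p by (auto simp: awalk_Cons_iff)
    obtain q r s where r: "es = q @ r @ s" "closed_w r"
      using awalk_not_distinct_decomp[OF es] by (auto simp: closed_w_def)
    then have "length r < length p" using p by auto
    from less.hyps[OF this r(2)] show ?thesis using r p by auto
  qed
qed

lemma stream_eq_snth: "(\<And>n. s !! n = t !! n) \<Longrightarrow> s = t"
  using smap_alt[of id s t] by (simp add: stream.map_id)

context pruefer
begin

lemma v0_eq: "path_source E c = tail E (shd z)"
  by (simp add: path_source_def)

lemma C_reach: "q \<in> C \<Longrightarrow> tail E (shd q) \<rightarrow>\<^sup>*\<^bsub>E\<^esub> path_source E c"
proof -
  assume q: "q \<in> C"
  obtain n where n: "sdrop n q = z" using C_ex_sdrop[OF q] by blast
  have "q !! n = shd z" using n by (metis sdrop_simps(1))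
  then show ?thesis
    using infinite_path_awalk[OF C_inf[OF q], of n] unfolding v0_eq by (auto intro: reachable_awalkI)
qed

lemma shift_in_C:
  assumes "awalk u p (path_source E c)" shows "p @- z \<in> C" "tail E (shd (p @- z)) = u"
proof -
  have "infinite_path E (p @- z)" using infinite_path_shift[of u p z] assms inf_z v0_eq by simp
  moreover have "sdrop (length p) (p @- z) = sdrop 0 z" by (simp add: sdrop_shift)
  ultimately show "p @- z \<in> C" unfolding tail_class_def by (metis (mono_tags, lifting) mem_Collect_eq)
  show "tail E (shd (p @- z)) = u"
    using assms v0_eq by (cases p) (auto simp: awalk_Cons_iff awalk_Nil_iff)
qed

text \<open>If c fails to be a cycle, a cycle cut out of c is a witness: its source lies on c, and
  it is no rotation of c because its tails are distinct while those of c are not.\<close>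

lemma not_maximal_witness:
  assumes "\<not> maximal_cycle E c"
  shows "\<exists>d. cycle d \<and> path_source E d \<rightarrow>\<^sup>*\<^bsub>E\<^esub> path_source E c \<and> (\<forall>i. d \<noteq> rotate i c)"
proof (cases "cycle c")
  case True
  then show ?thesis using assms by (auto simp: maximal_cycle_def)
next
  case False
  obtain r where r: "cycle r" "set r \<subseteq> set c" using closed_w_contains_cycle[OF closed_c] by blast
  then have hd: "hd r \<in> set c" by (auto simp: cycle_def)
  obtain u where u: "awalk u c u" using closed_c by (auto simp: closed_w_def)
  then have "path_source E c = u" using awalk_hd_last[OF u c_ne] by (simp add: path_source_def)
  then have "path_source E r \<rightarrow>\<^sup>*\<^bsub>E\<^esub> path_source E c"
    using awalk_verts_reachable_to[OF u] awalk_verts_arc1[OF hd] by (simp add: path_source_def)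
  moreover have "r \<noteq> rotate i c" for i
  proof
    assume "r = rotate i c"
    then have "map (tail E) r = rotate i (map (tail E) c)" by (simp add: rotate_map)
    then have "distinct (map (tail E) c)" using r(1) by (simp add: cycle_iff_distinct_tails)
    then show False using False closed_c by (simp add: cycle_iff_distinct_tails)
  qed
  ultimately show ?thesis using r by blast
qed

lemma sdrop_mult_c: "sdrop (length c * m) z = z"
  using c_ne by simp

text \<open>The tail t of z repeats both d and a turn of c. As the edges of the cycle d are
  distinct, the length of d divides that of c; primitivity gives the reverse inequality, and d is a
  full turn of t.\<close>

lemma cycle_tail_not_rotation:
  assumes d: "cycle d" and t: "t = sdrop j z"
    and per: "\<And>k. stake (length d) (sdrop (k * length d) t) = d"
  shows "\<exists>i. d = rotate i c"
proof -
  have dne: "d \<noteq> []" using d by (auto simp: cycle_def)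
  then have len: "0 < length d" by simp
  have nth: "t !! i = d ! (i mod length d)" for i
  proof -
    have "stake (length d) (sdrop (i div length d * length d) t) ! (i mod length d) =
        sdrop (i div length d * length d) t !! (i mod length d)"
      using len by (intro stake_nth) simp
    then show ?thesis unfolding per by (simp add: sdrop_snth)
  qed
  have td: "sdrop (length d) t = t" by (rule stream_eq_snth) (simp add: sdrop_snth nth)
  have tc: "sdrop (length c) t = t"
  proof -
    have "sdrop (length c) t = sdrop j (sdrop (length c) z)" unfolding t by (simp add: add.commute)
    then show ?thesis unfolding t using c_ne by simp
  qed
  have "t !! length c = t !! 0" using tc by (metis sdrop_simps(1) sdrop.simps(1))
  then have "d ! (length c mod length d) = d ! 0" using nth[of "length c"] nth[of 0] by simp
  moreover have "distinct d" using d by (auto simp: cycle_conv)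
  ultimately have "length c mod length d = 0" using len by (simp add: nth_eq_iff_index_eq)
  then have dvd: "length d dvd length c" by auto
  have "sdrop (length d) z = z"
  proof -
    \<comment> \<open>Dropping \<open>?l\<close> further edges from t completes a whole number of
      turns and leads back to z, so z inherits the period of t.\<close>
    let ?l = "length c * j - j"
    have "j + ?l = length c * j" using c_ne by (cases "length c") auto
    then have "z = sdrop ?l t" unfolding t using sdrop_mult_c[of j] by simp
    then have "sdrop (length d) z = sdrop ?l (sdrop (length d) t)" by (simp add: add.commute)
    then show ?thesis using td \<open>z = sdrop ?l t\<close> by simp
  qed
  then have "length c \<le> length d" by (rule primitive[OF len])
  then have eq: "length d = length c" using dvd c_ne by (simp add: dvd_imp_le le_antisym)
  have "d = stake (length c) t" using per[of 0] eq by simp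
  also have "t = Stream.cycle (rotate (j mod length c) c)" unfolding t by (rule sdrop_cycle[OF c_ne])
  also have "stake (length c) \<dots> = rotate (j mod length c) c"
    using stake_cycle_eq[of "rotate (j mod length c) c"] c_ne by simp
  finally show ?thesis by blast
qed

text \<open>Let d be a cycle that violates maximality, and suppose every path of C starting at its
  source began with d. Then a path leading from there into z would be d repeated forever, so a tail
  of z would be, and d would be a rotation of c.\<close>

lemma not_maximal_exit:
  assumes "\<not> maximal_cycle E c"
  shows "\<exists>d q. closed_w d \<and> q \<in> C \<and> tail E (shd q) = tail E (hd d) \<and> stake (length d) q \<noteq> d"
proof (rule ccontr)
  assume neg: "\<not> ?thesis"
  obtain d where d: "cycle d" "path_source E d \<rightarrow>\<^sup>*\<^bsub>E\<^esub> path_source E c" "\<And>i. d \<noteq> rotate i c"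
    using not_maximal_witness[OF assms] by blast
  have cl: "closed_w d" using d(1) by (simp add: cycle_iff_distinct_tails)
  have dne: "d \<noteq> []" using d(1) by (auto simp: cycle_def)
  have stake: "stake (length d) q = d" if "q \<in> C" "tail E (shd q) = tail E (hd d)" for q
    using neg cl that by blast
  obtain p where p: "awalk (path_source E d) p (path_source E c)" using d(2) by (auto simp: reachable_awalk)
  define q0 where "q0 = p @- z"
  have q0: "q0 \<in> C" "tail E (shd q0) = tail E (hd d)"
    using shift_in_C[OF p] by (simp_all add: q0_def path_source_def)
  have ends: "tail E (hd d) = head E (last d)"
    using cl awalk_hd_last[OF _ dne] by (auto simp: closed_w_def)
  have step: "tail E (shd (sdrop (length d) q)) = tail E (hd d)"
    if "q \<in> C" "tail E (shd q) = tail E (hd d)" for q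
  proof -
    have "awalk (tail E (shd q)) d (tail E (q !! length d))"
      using infinite_path_awalk[OF C_inf[OF that(1)], of "length d"] unfolding stake[OF that] .
    from awalk_hd_last[OF this dne] show ?thesis using ends by (metis sdrop_simps(1))
  qed
  have inv: "tail E (shd (sdrop (k * length d) q0)) = tail E (hd d)" for k
  proof (induction k)
    case (Suc k)
    have "sdrop (Suc k * length d) q0 = sdrop (length d) (sdrop (k * length d) q0)"
      by (simp add: add.commute)
    then show ?case using step[OF C_sdrop[OF q0(1)] Suc] by simp
  qed (use q0 in simp)
  \<comment> \<open>Each d has at least one edge, so after \<open>length p\<close> copies of d the
    initial path p is used up and only a tail of z is left.\<close>
  let ?k = "length p"
  have le: "length p \<le> ?k * length d" using dne by (cases "length d") auto
  then have "sdrop (?k * length d) q0 = sdrop (?k * length d - length p) z"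
    unfolding q0_def by (simp add: sdrop_shift)
  moreover have "stake (length d) (sdrop (k * length d) (sdrop (?k * length d) q0)) = d" for k
  proof -
    have "sdrop (k * length d) (sdrop (?k * length d) q0) = sdrop ((?k + k) * length d) q0"
      by (simp add: algebra_simps)
    then show ?thesis using stake[OF C_sdrop[OF q0(1)] inv] by simp
  qed
  ultimately show False using cycle_tail_not_rotation[OF d(1)] d(3) by blast
qed

text \<open>A path in C that has reached c stays on it and is then one of finitely many tails of z.
  Before that it repeats no vertex. So it is a prefix of bounded length followed by such a
  tail.\<close>

lemma C_finite:
  assumes "maximal_cycle E c" shows "finite C"
proof -
  have cyc: "cycle c" and max: "\<And>d. \<lbrakk>cycle d; path_source E d \<rightarrow>\<^sup>*\<^bsub>E\<^esub> path_source E c\<rbrakk> \<Longrightarrow> \<exists>i. d = rotate i c"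
    using assms by (auto simp: maximal_cycle_def)
  have inj: "inj_on (tail E) (set c)" using cyc by (simp add: cycle_iff_distinct_tails distinct_map)
  obtain u where u: "awalk u c u" using closed_c by (auto simp: closed_w_def)
  have us: "path_source E c = u" using awalk_hd_last[OF u c_ne] by (simp add: path_source_def)
  have no_exit: "e \<in> set c"
    if e: "e \<in> arcs E" "tail E e \<in> tail E ` set c" "head E e \<rightarrow>\<^sup>*\<^bsub>E\<^esub> path_source E c" for e
  proof -
    obtain f where f: "f \<in> set c" "tail E e = tail E f" using e(2) by auto
    have "u \<rightarrow>\<^sup>*\<^bsub>E\<^esub> tail E e"
      using awalk_verts_reachable_from[OF u awalk_verts_arc1[OF f(1)]] f(2) by simp
    then have "head E e \<rightarrow>\<^sup>*\<^bsub>E\<^esub> tail E e" using e(3) us by (auto intro: reachable_trans)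
    \<comment> \<open>A path back without repeated vertices closes with e to a cycle that connects
      to c. By maximality it is a rotation of c, so e lies on c.\<close>
    then obtain p where p: "apath (head E e) p (tail E e)" by (auto simp: reachable_apath)
    then have "cycle (e # p)"
      using e(1) by (auto simp: cycle_def apath_def awalk_Cons_iff intro!: exI[of _ "tail E e"])
    moreover have "path_source E (e # p) \<rightarrow>\<^sup>*\<^bsub>E\<^esub> path_source E c"
      using awalk_verts_reachable_to[OF u awalk_verts_arc1[OF f(1)]] f(2) us by (simp add: path_source_def)
    ultimately obtain i where "e # p = rotate i c" using max by blast
    then show ?thesis by (metis list.set_intros(1) set_rotate)
  qed
  have on_c: "q !! n \<in> set c" if "q \<in> C" "tail E (q !! n) \<in> tail E ` set c" for q n
  proof -
    have s: "sdrop n q \<in> C" using that(1) by (rule C_sdrop)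
    have "head E (shd (sdrop n q)) \<rightarrow>\<^sup>*\<^bsub>E\<^esub> path_source E c"
      using C_reach[OF C_stl[OF s]] by (simp only: C_head[OF s])
    then have "head E (q !! n) \<rightarrow>\<^sup>*\<^bsub>E\<^esub> path_source E c" "q !! n \<in> arcs E"
      using C_shd[OF s] by simp_all
    then show ?thesis using no_exit that(2) by blast
  qed
  have z_set: "z !! n \<in> set c" for n using c_ne snth_sset[of z n] by simp
  have follow: "\<exists>j<length c. q = sdrop j z" if q: "q \<in> C" "tail E (shd q) \<in> tail E ` set c" for q
  proof -
    have "shd q \<in> set c" using on_c[of q 0] q by simp
    then obtain j where j: "j < length c" "c ! j = shd q" by (auto simp: in_set_conv_nth)
    have "c ! j = z !! j" using stake_nth[OF j(1), of z] stake_cycle_eq[OF c_ne] by simp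
    have "q !! n = z !! (j + n)" for n
    proof (induction n)
      case 0
      then show ?case using j \<open>c ! j = z !! j\<close> by simp
    next
      case (Suc n)
      have "tail E (q !! Suc n) = head E (q !! n)" using C_inf[OF q(1)] unfolding infinite_path_def by metis
      also have "\<dots> = tail E (z !! (j + Suc n))" using inf_z Suc unfolding infinite_path_def by (metis add_Suc_right)
      finally have eq: "tail E (q !! Suc n) = tail E (z !! (j + Suc n))" .
      then have "q !! Suc n \<in> set c" using on_c[OF q(1), of "Suc n"] z_set[of "j + Suc n"] by (metis imageI)
      then show ?case using eq inj z_set[of "j + Suc n"] by (auto dest: inj_onD)
    qed
    then have "q = sdrop j z" by (intro stream_eq_snth) (simp add: sdrop_snth)
    then show ?thesis using j by blast
  qed
  let ?W = "{l. set l \<subseteq> arcs E \<and> length l \<le> card (verts E)}"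
  have "C \<subseteq> (\<lambda>(l, j). l @- sdrop j z) ` (?W \<times> {..<length c})"
  proof
    fix q assume q: "q \<in> C"
    obtain n where "sdrop n q = z" using C_ex_sdrop[OF q] by blast
    then have ex: "tail E (q !! n) \<in> tail E ` set c" using z_set[of 0] by (metis imageI sdrop_simps(1) snth.simps(1))
    define m where "m = (LEAST n. tail E (q !! n) \<in> tail E ` set c)"
    have m: "tail E (q !! m) \<in> tail E ` set c" unfolding m_def
      using ex by (rule LeastI[where P = "\<lambda>n. tail E (q !! n) \<in> tail E ` set c"])
    have least: "tail E (q !! i) \<notin> tail E ` set c" if "i < m" for i
      using not_less_Least[of i "\<lambda>n. tail E (q !! n) \<in> tail E ` set c"] that unfolding m_def by blast
    have aw: "awalk (tail E (shd q)) (stake m q) (tail E (q !! m))"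
      by (rule infinite_path_awalk[OF C_inf[OF q]])
    \<comment> \<open>A repetition before the first visit to c would contain a cycle connecting to
      c, hence a rotation of c, whose source would be an earlier visit.\<close>
    have "distinct (awalk_verts (tail E (shd q)) (stake m q))"
    proof (rule ccontr)
      assume "\<not> ?thesis"
      then obtain a r b where r: "stake m q = a @ r @ b" "closed_w r"
        using awalk_not_distinct_decomp[OF aw] by (auto simp: closed_w_def)
      obtain r' where r': "cycle r'" "set r' \<subseteq> set r" using closed_w_contains_cycle[OF r(2)] by blast
      then have "hd r' \<in> set (stake m q)" using r(1) by (auto simp: cycle_def)
      then obtain i where i: "i < m" "hd r' = q !! i" by (auto simp: in_set_conv_nth)
      have "path_source E r' \<rightarrow>\<^sup>*\<^bsub>E\<^esub> path_source E c"
        using C_reach[OF C_sdrop[OF q], of i] i by (simp add: path_source_def)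
      then obtain k where "r' = rotate k c" using max r'(1) by blast
      then have "hd r' \<in> set c" using r'(1) by (metis cycle_def hd_in_set set_rotate)
      then show False using least[OF i(1)] i(2) by auto
    qed
    then have "m \<le> card (verts E)" using length_apath[of _ "stake m q"] aw by (simp add: apath_def)
    moreover have "set (stake m q) \<subseteq> arcs E" using aw by (simp add: awalk_def)
    moreover obtain j where "j < length c" "sdrop m q = sdrop j z"
      using follow[OF C_sdrop[OF q], of m] m by auto
    ultimately show "q \<in> (\<lambda>(l, j). l @- sdrop j z) ` (?W \<times> {..<length c})"
      using stake_sdrop[of m q] by (intro image_eqI[of _ _ "(stake m q, j)"]) auto
  qed
  then show ?thesis by (rule finite_subset) (simp add: finite_lists_length_le)
qed

end

text \<open>The test modules are copies of the ring and of the left ideal in the left half of the sum type.\<close>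

lemma injective_module_extends_from_left_ideal:
  fixes R :: "('r, 's) ring_scheme" and U :: "('r, 'u, 'x) module_scheme"
  assumes R: "ring R" and inj: "injective_module TYPE('r + 'm) R U"
    and J: "J \<subseteq> carrier R" "left_module R ((regular_module R)\<lparr>carrier := J\<rparr>)"
    and k: "k \<in> module_homs R ((regular_module R)\<lparr>carrier := J\<rparr>) U"
  shows "\<exists>u\<in>carrier U. \<forall>a\<in>J. k a = a \<odot>\<^bsub>U\<^esub> u"
proof -
  interpret R: ring R by fact
  define cp :: "'r set \<Rightarrow> ('r, 'r + 'm) module" where
    "cp S = \<lparr>carrier = Inl ` S, monoid.mult = undefined, one = undefined, ring.zero = Inl \<zero>\<^bsub>R\<^esub>,
       add = (\<lambda>x y. Inl (projl x \<oplus>\<^bsub>R\<^esub> projl y)), module.smult = (\<lambda>a x. Inl (a \<otimes>\<^bsub>R\<^esub> projl x))\<rparr>" for S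
  have cp_iso: "Inl \<in> module_isos R ((regular_module R)\<lparr>carrier := S\<rparr>) (cp S)" for S
    by (auto simp: module_isos_def module_homs_def cp_def regular_module_def bij_betw_def)
  have B: "left_module R (cp (carrier R))"
    using left_module_transport[OF _ cp_iso, of "carrier R"] regular_left_module[OF R]
    by (simp add: regular_module_def)
  have A: "left_module R (cp J)" using left_module_transport[OF J(2) cp_iso] .
  have id: "(\<lambda>x. x) \<in> module_homs R (cp J) (cp (carrier R))"
    using J(1) by (auto simp: module_homs_def cp_def)
  have "(\<lambda>x. k (projl x)) \<in> module_homs R (cp J) U"
    using k by (auto simp: module_homs_def cp_def regular_module_def)
  with inj A B id obtain h where h: "h \<in> module_homs R (cp (carrier R)) U" "\<forall>x\<in>carrier (cp J). h x = k (projl x)"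
    unfolding injective_module_def inj_on_def by blast
  have "k a = a \<odot>\<^bsub>U\<^esub> h (Inl \<one>\<^bsub>R\<^esub>)" if a: "a \<in> J" for a
  proof -
    have "k a = h (Inl a)" using h(2) a by (auto simp: cp_def)
    also have "Inl a = a \<odot>\<^bsub>cp (carrier R)\<^esub> Inl \<one>\<^bsub>R\<^esub>" using a J(1) by (auto simp: cp_def)
    also have "h \<dots> = a \<odot>\<^bsub>U\<^esub> h (Inl \<one>\<^bsub>R\<^esub>)"
      using module_homsD(3)[OF h(1), of a "Inl \<one>\<^bsub>R\<^esub>"] a J(1) by (auto simp: cp_def)
    finally show ?thesis .
  qed
  moreover have "h (Inl \<one>\<^bsub>R\<^esub>) \<in> carrier U" using module_homsD(1)[OF h(1)] by (simp add: cp_def)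
  ultimately show ?thesis by blast
qed

context pruefer
begin

text \<open>If \<open>q\<close> does not start with the closed path \<open>d\<close>, then \<open>(d - 1) y = u\<close> has, for \<open>u\<close> supported at \<open>q\<close>,
  the solution \<open>y = - \<Sum>k. d ^ k u\<close>, but none with finite support.\<close>

lemma UF_not_injective:
  assumes d: "closed_w d" and q: "q \<in> C" "tail E (shd q) = tail E (hd d)" "stake (length d) q \<noteq> d"
  shows "\<not> injective_module TYPE(('v, 'e, 'k) lpa + 'm) L (TM UF)"
proof
  assume inj: "injective_module TYPE(('v, 'e, 'k) lpa + 'm) L (TM UF)"
  obtain w where w: "awalk w d w" and dne: "d \<noteq> []" using d by (auto simp: closed_w_def)
  have wq: "w = tail E (shd q)" using awalk_hd_last[OF w dne] q(2) by simp
  have darcs: "set d \<subseteq> arcs E" using w by (simp add: awalk_def)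
  \<comment> \<open>The paths d^k q, which carry the infinite solution. They are pairwise distinct
    because q does not start with d.\<close>
  define p where "p k = (((@-) d) ^^ k) q" for k
  have p0: "p 0 = q" and pS: "p (Suc k) = d @- p k" for k by (simp_all add: p_def)
  have shift_C: "r @- s \<in> C \<and> tail E (shd (r @- s)) = v" if "awalk v r (tail E (shd s))" "s \<in> C" for v r s
    using that
  proof (induction r arbitrary: v)
    case (Cons e r)
    then have "r @- s \<in> C" "tail E (shd (r @- s)) = head E e" "e \<in> arcs E" "tail E e = v"
      by (auto simp: awalk_Cons_iff)
    then show ?case by (simp add: C_SCons)
  qed (auto simp: awalk_Nil_iff)
  have pC: "p k \<in> C \<and> tail E (shd (p k)) = w" for k
    by (induction k) (use q wq w shift_C in \<open>auto simp: p0 pS\<close>)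
  \<comment> \<open>The twists met along r multiply to a unit t that does not depend on u.\<close>
  have path_eval: "\<exists>t. fps_nth t 0 \<noteq> 0 \<and> (\<forall>u\<in>UH. wact (map Edge r) u (r @- s) = t \<rhd> u s)"
    if "awalk v r (tail E (shd s))" "s \<in> C" for v r s
    using that
  proof (induction r arbitrary: v)
    case Nil
    then show ?case by (intro exI[of _ 1]) simp
  next
    case (Cons e r)
    then obtain t where t: "fps_nth t 0 \<noteq> 0" "\<forall>u\<in>UH. wact (map Edge r) u (r @- s) = t \<rhd> u s"
      by (auto simp: awalk_Cons_iff)
    have "e ## (r @- s) \<in> C" using shift_C[OF Cons.prems] by simp
    then show ?case using t tw_unit[of "e ## (r @- s)"]
      by (intro exI[of _ "tw (e ## (r @- s)) * t"]) (simp add: contract_assoc)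
  qed
  have "\<forall>k. \<exists>t. fps_nth t 0 \<noteq> 0 \<and> (\<forall>u\<in>UH. wact (map Edge d) u (p (Suc k)) = t \<rhd> u (p k))"
  proof
    fix k
    show "\<exists>t. fps_nth t 0 \<noteq> 0 \<and> (\<forall>u\<in>UH. wact (map Edge d) u (p (Suc k)) = t \<rhd> u (p k))"
      unfolding pS by (rule path_eval[of w]) (use w pC[of k] in simp_all)
  qed
  from choice[OF this] obtain T where T0: "\<And>k. fps_nth (T k) 0 \<noteq> 0"
    and T: "\<And>k u. u \<in> UH \<Longrightarrow> wact (map Edge d) u (p (Suc k)) = T k \<rhd> u (p k)"
    by auto
  have p_len: "p (k + m) \<noteq> p k" if m: "0 < m" for k m
  proof (induction k)
    case 0
    obtain m' where m': "m = Suc m'" using m by (cases m) auto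
    have "stake (length d) (p m) = d" unfolding m' pS by (simp add: stake_shift)
    then show ?case using q(3) by (auto simp: p0)
  next
    case (Suc k)
    then show ?case by (simp add: pS)
  qed
  have p_inj: "inj p"
  proof (rule injI, rule ccontr)
    fix j k assume eq: "p j = p k" "j \<noteq> k"
    then consider "j < k" | "k < j" by linarith
    then show False
      by cases (use p_len[of "k - j" j] p_len[of "j - k" k] eq in simp_all)
  qed
  define u where "u = delta q (1 :: 'k poly)"
  \<comment> \<open>Up to sign, the values that the equation forces on y: -1 at q, and
    multiplication by the unit \<open>T k\<close> from each d^k q to the next.\<close>
  define V where "V k = rec_nat (1 :: 'k poly) (\<lambda>k v. T k \<rhd> v) k" for k
  define y where "y s = (if s \<in> range p then - V (the_inv p s) else 0)" for s
  have yp: "y (p k) = - V k" for k by (simp add: y_def the_inv_f_f[OF p_inj])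
  have V0: "V 0 = 1" and VS: "V (Suc k) = T k \<rhd> V k" for k by (simp_all add: V_def)
  have yUH: "y \<in> UH" by (rule UHI) (use pC in \<open>auto simp: y_def\<close>)
  define D where "D = monomial (map Edge d) - (1 :: ('v, 'e, 'k) lpa_free)"
  have D_FC: "D \<in> FC" unfolding D_def by (intro free_carrier_diff path_FC(1)[OF darcs] free_carrier_one)
  have uUF: "u \<in> UF" by (simp add: u_def q(1))
  have Dy: "lact D y = u"
  proof
    fix s
    have "wact (map Edge d) y s - y s = u s"
    proof (cases "s \<in> range p")
      case True
      then obtain k where k: "s = p k" by auto
      show ?thesis
      proof (cases k)
        case 0
        have "wact (map Edge d) y q = 0" by (rule wact_path_eq_0[OF q(3)])
        then show ?thesis using k 0 yp[of 0] by (simp add: p0 V0 u_def)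
      next
        case (Suc k')
        have "s \<noteq> q" using p_len[of "Suc k'" 0] k Suc by (simp add: p0)
        then show ?thesis using k Suc T[OF yUH, of k'] yp by (simp add: u_def VS contract_minus_right)
      qed
    next
      case False
      then have "s \<noteq> q" using p0 by (metis rangeI)
      have "wact (map Edge d) y s = 0"
      proof (cases "stake (length d) s = d")
        case True
        define s' where "s' = sdrop (length d) s"
        have s: "s = d @- s'" using stake_sdrop[of "length d" s] True by (simp add: s'_def)
        show ?thesis
        proof (cases "s \<in> C")
          case True
          then have s'C: "s' \<in> C" by (simp add: s'_def C_sdrop)
          have "awalk (tail E (shd s)) d (tail E (s !! length d))"
            using infinite_path_awalk[OF C_inf[OF True], of "length d"] \<open>stake (length d) s = d\<close> by simp
          then have "awalk (tail E (shd s)) d (tail E (shd s'))" by (simp add: s'_def)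
          from path_eval[OF this s'C] obtain t where "\<forall>u\<in>UH. wact (map Edge d) u (d @- s') = t \<rhd> u s'"
            by blast
          then have "wact (map Edge d) y s = t \<rhd> y s'" using yUH unfolding s[symmetric] by blast
          moreover have "y s' = 0"
          proof -
            have "s' \<notin> range p" using False s pS by (metis rangeE rangeI)
            then show ?thesis by (simp add: y_def)
          qed
          ultimately show ?thesis by simp
        qed (rule UH_outside[OF wact_UH[OF yUH]])
      qed (rule wact_path_eq_0)
      then show ?thesis using False \<open>s \<noteq> q\<close> by (simp add: y_def u_def)
    qed
    then show "lact D y s = u s" by (simp add: D_def lact_diff)
  qed
  interpret L: ring L by (rule L_ring)
  \<comment> \<open>J is the left ideal generated by d - 1. Acting on y gives a homomorphism from J
    into \<open>UF\<close>, as (d - 1) y = u has finite support although y has not; an extension to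
    the whole algebra would yield a finitely supported solution.\<close>
  define J where "J = (\<lambda>a. cls (a * D)) ` FC"
  have lact_mem: "b \<in> FC \<Longrightarrow> cls b \<in> J \<Longrightarrow> lact b y \<in> UF" for b
  proof -
    assume b: "b \<in> FC" "cls b \<in> J"
    then obtain a where a: "a \<in> FC" "cls b = cls (a * D)" by (auto simp: J_def)
    then have "lact b y = lact (a * D) y" using b D_FC yUH by (intro lact_cong) (simp_all add: free_carrier_mult)
    also have "\<dots> = lact a u" by (simp add: lact_mult Dy)
    finally show "lact b y \<in> UF" using lact_UF[OF uUF] by simp
  qed
  have JL: "J \<subseteq> carrier L" using D_FC by (auto simp: J_def free_carrier_mult)
  have Jmod: "left_module L ((regular_module L)\<lparr>carrier := J\<rparr>)"
  proof (rule left_module_image[OF RM_left_module])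
    show "(\<lambda>x. x \<otimes>\<^bsub>L\<^esub> cls D) \<in> module_homs L RM (RM\<lparr>carrier := J\<rparr>)"
      using D_FC by (auto simp: module_homs_def carrier_L J_def cls_mult regular_module_def L.l_distr L.m_assoc
          simp flip: carrier_L)
        (auto simp: carrier_L cls_mult)
    show "carrier (RM\<lparr>carrier := J\<rparr>) = (\<lambda>x. x \<otimes>\<^bsub>L\<^esub> cls D) ` carrier RM"
      using D_FC by (simp add: carrier_L image_image J_def cls_mult)
    show "\<zero>\<^bsub>RM\<lparr>carrier := J\<rparr>\<^esub> = \<zero>\<^bsub>RM\<^esub> \<otimes>\<^bsub>L\<^esub> cls D"
      using D_FC by (simp add: regular_module_def)
  qed
  let ?k = "\<lambda>A. A \<odot>\<^bsub>TM UH\<^esub> y"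
  interpret TH: left_module L "TM UH" by (rule UH_left_module)
  have khom: "?k \<in> module_homs L (RM\<lparr>carrier := J\<rparr>) (TM UF)"
  proof (rule module_homsI)
    fix x assume "x \<in> carrier (RM\<lparr>carrier := J\<rparr>)"
    then show "?k x \<in> carrier (TM UF)"
      using lact_mem JL yUH by (auto simp: TM_smult carrier_L)
  next
    fix x x' assume x: "x \<in> carrier (RM\<lparr>carrier := J\<rparr>)" "x' \<in> carrier (RM\<lparr>carrier := J\<rparr>)"
    then have "x \<in> carrier L" "x' \<in> carrier L" using JL by auto
    then show "?k (x \<oplus>\<^bsub>RM\<lparr>carrier := J\<rparr>\<^esub> x') = ?k x \<oplus>\<^bsub>TM UF\<^esub> ?k x'"
      using TH.smult_l_distr[of x x' y] yUH by (simp add: regular_module_def)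
  next
    fix a x assume ax: "a \<in> carrier L" "x \<in> carrier (RM\<lparr>carrier := J\<rparr>)"
    then obtain a' x' where a': "a' \<in> FC" "a = cls a'" and x': "x' \<in> FC" "x = cls x'" "cls x' \<in> J"
      using JL by (auto simp: carrier_L)
    have "?k (a \<odot>\<^bsub>RM\<lparr>carrier := J\<rparr>\<^esub> x) = ?k (cls (a' * x'))"
      using a' x' by (simp add: regular_module_def cls_mult)
    also have "\<dots> = lact a' (lact x' y)" using a' x' yUH by (simp add: TM_smult free_carrier_mult lact_mult)
    also have "\<dots> = a \<odot>\<^bsub>TM UF\<^esub> ?k x" using a' x' yUH by (simp add: TM_smult lact_UH)
    finally show "?k (a \<odot>\<^bsub>RM\<lparr>carrier := J\<rparr>\<^esub> x) = a \<odot>\<^bsub>TM UF\<^esub> ?k x" .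
  qed
  obtain y' where y': "y' \<in> UF" "\<And>A. A \<in> J \<Longrightarrow> ?k A = A \<odot>\<^bsub>TM UF\<^esub> y'"
    using injective_module_extends_from_left_ideal[OF L_ring inj JL Jmod khom] by auto
  have y'UH: "y' \<in> UH" by (rule UF_UH[OF y'(1)])
  have "cls D \<in> J" unfolding J_def by (rule image_eqI[of _ _ 1]) (simp_all add: free_carrier_one)
  from y'(2)[OF this] have Dy': "lact D y' = u" using D_FC yUH y'UH by (simp add: TM_smult Dy)
  have eq: "wact (map Edge d) y' s - y' s = u s" for s
    using fun_cong[OF Dy', of s] by (simp add: D_def lact_diff)
  \<comment> \<open>The same recursion governs every solution: starting from -1 at q it multiplies
    by units and never reaches 0.\<close>
  have "y' (p k) \<noteq> 0" for k
  proof (induction k)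
    case 0
    have "wact (map Edge d) y' q = 0" by (rule wact_path_eq_0[OF q(3)])
    then have "- y' q = 1" using eq[of q] by (simp add: u_def)
    then show ?case unfolding p0 by (metis neg_0_equal_iff_equal zero_neq_one)
  next
    case (Suc k)
    have "p (Suc k) \<noteq> q" using p_len[of "Suc k" 0] by (simp add: p0)
    then have "y' (p (Suc k)) = T k \<rhd> y' (p k)" using eq[of "p (Suc k)"] T[OF y'UH, of k] by (simp add: u_def)
    moreover have "T k \<rhd> m = 0 \<longleftrightarrow> m = 0" for m
      using inverse_mult_eq_1[OF T0, of k] contract_assoc[of "inverse (T k)" "T k" m]
      by (metis contract_one contract_zero_right)
    ultimately show ?case using Suc by simp
  qed
  then have "range p \<subseteq> {s. y' s \<noteq> 0}" by auto
  moreover have "finite {s. y' s \<noteq> 0}" using y'(1) by (simp add: UF_def)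
  ultimately have "finite (range p)" by (rule finite_subset)
  then show False using p_inj by (simp add: finite_image_iff)
qed

end

section \<open>The Chen module as an essential submodule\<close>

text \<open>Meant for the Chen module, which inherits the axioms from the functions once it is
  embedded there.\<close>

lemma left_module_pullback:
  assumes "left_module R N" and hom: "f \<in> module_homs R M N" and inj: "inj_on f (carrier M)"
    and zero: "\<zero>\<^bsub>M\<^esub> \<in> carrier M" "f \<zero>\<^bsub>M\<^esub> = \<zero>\<^bsub>N\<^esub>"
    and add: "\<And>x y. \<lbrakk>x \<in> carrier M; y \<in> carrier M\<rbrakk> \<Longrightarrow> x \<oplus>\<^bsub>M\<^esub> y \<in> carrier M"
    and smult: "\<And>a x. \<lbrakk>a \<in> carrier R; x \<in> carrier M\<rbrakk> \<Longrightarrow> a \<odot>\<^bsub>M\<^esub> x \<in> carrier M"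
  shows "left_module R M"
proof -
  interpret N: left_module R N by fact
  note [simp] = module_homsD[OF hom] zero add smult
  show ?thesis
    by (rule left_moduleI; (simp; fail)?; (rule inj_onD[OF inj])?)
      (simp_all add: N.smult_l_distr N.smult_r_distr N.smult_assoc N.smult_one N.smult_l_null N.M.a_ac N.R.ring_axioms)
qed

lemma lookup_linear_extension:
  "Poly_Mapping.lookup (linear_extension f x) b =
    (\<Sum>a\<in>Poly_Mapping.keys x. Poly_Mapping.lookup x a * Poly_Mapping.lookup (f a) b)"
  by (simp add: linear_extension_def lookup_sum Poly_Mapping.map.rep_eq when_def if_distrib cong: if_cong)
    (auto intro: sum.cong)

context pruefer
begin

abbreviation Ch where "Ch \<equiv> chen_module K E z"

text \<open>The twist fixes constant polynomials.\<close>

definition chen_emb :: "('e stream \<Rightarrow>\<^sub>0 'k) \<Rightarrow> ('e, 'k) pfun" where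
  "chen_emb x = (\<lambda>q. [:Poly_Mapping.lookup x q:])"

lemma tw_const [simp]: "tw q \<rhd> [:k:] = [:k:]" "inverse (tw q) \<rhd> [:k:] = [:k:]"
proof -
  have "fps_X \<rhd> [:k:] = 0" using contract_X_power_eq_0[of "[:k:]" 1] by simp
  then show eq: "tw q \<rhd> [:k:] = [:k:]" by (simp add: tw_def contract_add_left)
  show "inverse (tw q) \<rhd> [:k:] = [:k:]" using tw_inverse(2)[of q "[:k:]"] by (simp only: eq)
qed

lemma chen_emb_UF_iff: "chen_emb x \<in> UF \<longleftrightarrow> Poly_Mapping.keys x \<subseteq> C"
  by (auto simp: chen_emb_def UF_def UH_def in_keys_iff)

lemma chen_emb_inj: "chen_emb x = chen_emb y \<longleftrightarrow> x = y"
  by (auto simp: chen_emb_def fun_eq_iff intro: poly_mapping_eqI)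

lemma chen_emb_add: "chen_emb (x + y) = (\<lambda>q. chen_emb x q + chen_emb y q)"
  by (simp add: chen_emb_def lookup_add)

text \<open>At a given q at most one basis path contributes to the sum: q itself,
  \<open>stl q\<close> or \<open>e ## q\<close>.\<close>

lemma chen_emb_gen_action:
  assumes x: "Poly_Mapping.keys x \<subseteq> C" and g: "g \<in> lpa_gens E"
  shows "chen_emb (linear_extension (gen_action E g) x) = gact g (chen_emb x)"
proof
  fix q
  let ?x = "Poly_Mapping.lookup x"
  have out: "?x q = 0" if "q \<notin> C" for q using x that by (auto simp: in_keys_iff)
  have delta: "(\<Sum>a\<in>Poly_Mapping.keys x. if a = r then if P then ?x a else 0 else 0) = (if P then ?x r else 0)"
    for r P by (simp add: sum.delta in_keys_iff)
  show "chen_emb (linear_extension (gen_action E g) x) q = gact g (chen_emb x) q"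
  proof (cases g)
    case (Vertex v)
    have "(\<Sum>a\<in>Poly_Mapping.keys x. ?x a * Poly_Mapping.lookup (gen_action E g a) q) =
        (\<Sum>a\<in>Poly_Mapping.keys x. if a = q then if v = tail E (shd q) then ?x a else 0 else 0)"
      unfolding Vertex by (intro sum.cong refl) (auto simp: lookup_single when_def)
    then show ?thesis unfolding delta by (simp add: Vertex chen_emb_def lookup_linear_extension)
  next
    case (Edge e)
    then have e: "e \<in> arcs E" using g by (auto simp: lpa_gens_def)
    have SCons: "e ## a = q \<longleftrightarrow> shd q = e \<and> a = stl q" for a by (metis stream.collapse stream.sel)
    have "(\<Sum>a\<in>Poly_Mapping.keys x. ?x a * Poly_Mapping.lookup (gen_action E g a) q) =
        (\<Sum>a\<in>Poly_Mapping.keys x. if a = stl q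
          then if shd q = e \<and> head E e = tail E (shd (stl q)) then ?x a else 0 else 0)"
      proof (rule sum.cong[OF refl])
      fix a
      show "?x a * Poly_Mapping.lookup (gen_action E g a) q =
          (if a = stl q then if shd q = e \<and> head E e = tail E (shd (stl q)) then ?x a else 0 else 0)"
      proof (cases "e ## a = q")
        case True
        then have "shd q = e" "stl q = a" using SCons by auto
        then show ?thesis using True by (simp add: Edge lookup_single)
      next
        case False
        then have "Poly_Mapping.lookup (gen_action E g a) q = 0" by (simp add: Edge lookup_single)
        then show ?thesis using False SCons by auto
      qed
    qed
    moreover have "q \<in> C \<longleftrightarrow> shd q = e \<and> head E e = tail E (shd (stl q)) \<and> stl q \<in> C" if "shd q = e"
      using C_SCons[of e "stl q"] e that by auto
    ultimately show ?thesis
      unfolding delta using out[of "stl q"] by (auto simp: Edge chen_emb_def lookup_linear_extension)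
  next
    case (Ghost e)
    have "(\<Sum>a\<in>Poly_Mapping.keys x. ?x a * Poly_Mapping.lookup (gen_action E g a) q) =
        (\<Sum>a\<in>Poly_Mapping.keys x. if a = e ## q then if True then ?x a else 0 else 0)"
      unfolding Ghost by (intro sum.cong refl) (auto simp: lookup_single when_def)
    then show ?thesis unfolding delta by (simp add: Ghost chen_emb_def lookup_linear_extension)
  qed
qed

lemma chen_emb_word_action:
  assumes x: "Poly_Mapping.keys x \<subseteq> C" and w: "set (letters w) \<subseteq> lpa_gens E"
  shows "chen_emb (word_action E x w) = wact (letters w) (chen_emb x)"
proof -
  have "chen_emb (foldr (\<lambda>g. linear_extension (gen_action E g)) gs x) = wact gs (chen_emb x)"
    if "set gs \<subseteq> lpa_gens E" for gs
    using that
  proof (induction gs)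
    case (Cons g gs)
    let ?y = "foldr (\<lambda>g. linear_extension (gen_action E g)) gs x"
    have IH: "chen_emb ?y = wact gs (chen_emb x)" using Cons by simp
    moreover have "wact gs (chen_emb x) \<in> UF" using x by (intro wact_UF) (simp add: chen_emb_UF_iff)
    ultimately have "Poly_Mapping.keys ?y \<subseteq> C" by (simp flip: chen_emb_UF_iff)
    then show ?case using chen_emb_gen_action[of ?y g] Cons.prems IH by simp
  qed simp
  then show ?thesis using w by (simp add: word_action_def)
qed

lemma chen_emb_action:
  assumes x: "Poly_Mapping.keys x \<subseteq> C" and a: "a \<in> FC"
  shows "chen_emb (linear_extension (word_action E x) a) = lact a (chen_emb x)"
proof
  fix q
  have "(\<Sum>w\<in>A. [:f w:]) = [:\<Sum>w\<in>A. f w:]" for f :: "('v, 'e) lpa_gen fword \<Rightarrow> 'k" and A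
    by (induction A rule: infinite_finite_induct) simp_all
  then have "chen_emb (linear_extension (word_action E x) a) q =
      (\<Sum>w\<in>Poly_Mapping.keys a. smult (Poly_Mapping.lookup a w) (chen_emb (word_action E x w) q))"
    by (simp add: chen_emb_def lookup_linear_extension)
  also have "\<dots> = lact a (chen_emb x) q"
    unfolding lact_def
    by (intro sum.cong refl) (use a in \<open>simp add: chen_emb_word_action[OF x] free_carrier_def\<close>)
  finally show "chen_emb (linear_extension (word_action E x) a) q = lact a (chen_emb x) q" .
qed

lemma carrier_chen: "carrier Ch = {x. Poly_Mapping.keys x \<subseteq> C}"
  by (simp add: chen_module_def)

text \<open>All members of a class act alike, since they do so after the injective embedding into
  the functions, where the ideal acts as zero. Hence the definite description in the action
  denotes.\<close>

lemma chen_smult: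
  assumes x: "x \<in> carrier Ch" and a: "a \<in> FC"
  shows "cls a \<odot>\<^bsub>Ch\<^esub> x = linear_extension (word_action E x) a"
proof -
  have keys: "Poly_Mapping.keys x \<subseteq> C" using x by (simp add: carrier_chen)
  then have UH: "chen_emb x \<in> UH" by (intro UF_UH) (simp add: chen_emb_UF_iff)
  have "linear_extension (word_action E x) b = linear_extension (word_action E x) a" if b: "b \<in> cls a" for b
  proof -
    obtain r where r: "r \<in> lpa_ideal E" "b = r + a" using b unfolding cls_subset by auto
    then have "b \<in> FC" using a lpa_ideal_FC free_carrier_add by blast
    moreover have "lact b (chen_emb x) = lact a (chen_emb x)"
      by (rule ext) (simp add: r(2) lact_add lact_ideal[OF r(1) UH])
    ultimately show ?thesis using a keys by (simp add: chen_emb_action flip: chen_emb_inj)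
  qed
  then have "(THE y. \<forall>b\<in>cls a. linear_extension (word_action E x) b = y) = linear_extension (word_action E x) a"
    using mem_cls[OF a] by (intro the_equality ballI; metis)
  moreover have "cls a \<odot>\<^bsub>Ch\<^esub> x = (THE y. \<forall>b\<in>cls a. linear_extension (word_action E x) b = y)"
    by (simp add: chen_module_def)
  ultimately show ?thesis by (simp only:)
qed

lemma chen_emb_smult:
  assumes "x \<in> carrier Ch" "A \<in> carrier L"
  shows "chen_emb (A \<odot>\<^bsub>Ch\<^esub> x) = A \<odot>\<^bsub>TM UF\<^esub> chen_emb x"
proof -
  obtain a where a: "a \<in> FC" "A = cls a" using assms(2) by (auto simp: carrier_L)
  have keys: "Poly_Mapping.keys x \<subseteq> C" using assms(1) by (simp add: carrier_chen)
  then have "chen_emb x \<in> UH" by (intro UF_UH) (simp add: chen_emb_UF_iff)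
  then show ?thesis using a keys assms(1) by (simp add: chen_smult chen_emb_action TM_smult)
qed

lemma chen_emb_UF: "x \<in> carrier Ch \<longleftrightarrow> chen_emb x \<in> UF"
  by (simp add: carrier_chen chen_emb_UF_iff)

lemma chen_add_zero [simp]: "x \<oplus>\<^bsub>Ch\<^esub> y = x + y" "\<zero>\<^bsub>Ch\<^esub> = 0"
  by (simp_all add: chen_module_def)

lemma chen_smult_closed:
  assumes "x \<in> carrier Ch" "A \<in> carrier L" shows "A \<odot>\<^bsub>Ch\<^esub> x \<in> carrier Ch"
proof -
  interpret T: left_module L "TM UF" by (rule UF_left_module)
  show ?thesis
    using assms T.smult_closed[of A "chen_emb x"] by (simp add: chen_emb_UF chen_emb_smult)
qed

lemma chen_emb_hom: "chen_emb \<in> module_homs L Ch (TM UF)"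
  by (rule module_homsI) (simp_all add: chen_emb_add chen_emb_smult, simp add: chen_emb_UF)

lemma chen_left_module: "left_module L Ch"
proof (rule left_module_pullback[OF UF_left_module chen_emb_hom])
  show "inj_on chen_emb (carrier Ch)" by (simp add: inj_on_def chen_emb_inj)
  show "\<zero>\<^bsub>Ch\<^esub> \<in> carrier Ch" by (simp add: carrier_chen)
  show "chen_emb \<zero>\<^bsub>Ch\<^esub> = \<zero>\<^bsub>TM UF\<^esub>" by (simp add: chen_emb_def)
  show "x \<oplus>\<^bsub>Ch\<^esub> y \<in> carrier Ch" if "x \<in> carrier Ch" "y \<in> carrier Ch" for x y
    using that UF_add by (simp add: chen_emb_UF chen_emb_add)
qed (rule chen_smult_closed)

text \<open>Applying ghost paths, the support of a nonzero element can be shrunk to a point, which can be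
  moved to \<open>z\<close>; then a power of \<open>c - 1\<close> produces a nonzero constant.\<close>

lemma chen_essential:
  assumes N: "submodule N L (TM UF)" "N \<noteq> {\<zero>\<^bsub>TM UF\<^esub>}"
  shows "N \<inter> chen_emb ` carrier Ch \<noteq> {\<zero>\<^bsub>TM UF\<^esub>}"
proof -
  interpret N: submodule N L "TM UF" by fact
  have NUF: "N \<subseteq> UF" using N.subset by simp
  have act: "lact a u \<in> N" if "a \<in> FC" "u \<in> N" for a u
  proof -
    have "u \<in> UH" using that NUF UF_UH by blast
    then show ?thesis using N.smult_closed[of "cls a" u] that by (simp add: TM_smult)
  qed
  have ghost: "wact (rev (map Ghost p)) u \<in> N" if "set p \<subseteq> arcs E" "u \<in> N" for p u
  proof -
    have "monomial (rev (map Ghost p)) \<in> FC"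
      by (rule free_carrier_monomial) (use that in \<open>auto simp: lpa_gens_def\<close>)
    from act[OF this \<open>u \<in> N\<close>] show ?thesis by simp
  qed
  have "(\<lambda>_. 0) \<in> N" using N.one_closed by simp
  then obtain u0 where u0: "u0 \<in> N" "u0 \<noteq> (\<lambda>_. 0)" using N(2) by auto
  let ?s = "\<lambda>u :: ('e, 'k) pfun. {q. u q \<noteq> 0}"
  define u where "u = arg_min (\<lambda>u. card (?s u)) (\<lambda>u. u \<in> N \<and> u \<noteq> (\<lambda>_. 0))"
  have u: "u \<in> N" "u \<noteq> (\<lambda>_. 0)"
    and u_min: "\<And>v. v \<in> N \<Longrightarrow> v \<noteq> (\<lambda>_. 0) \<Longrightarrow> card (?s u) \<le> card (?s v)"
    using arg_min_nat_lemma[of "\<lambda>u. u \<in> N \<and> u \<noteq> (\<lambda>_. 0)" u0 "\<lambda>u. card (?s u)"] u0 by (simp_all add: u_def)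
  have fin: "finite (?s u)" using u(1) NUF by (auto simp: UF_def)
  obtain q where q: "u q \<noteq> 0" using u(2) by auto
  have qC: "q \<in> C" using q UH_outside[OF UF_UH, of u q] u(1) NUF by auto
  have single: "s = q" if s: "u s \<noteq> 0" for s
  proof (rule ccontr)
    assume "s \<noteq> q"
    then obtain n where n: "s !! n \<noteq> q !! n" using stream_eq_snth by blast
    \<comment> \<open>A prefix that separates q from s: stripping it keeps the value at q up to a
      unit, loses the one at s and creates no new support, against minimality.\<close>
    define p where "p = stake (Suc n) q"
    define v where "v = wact (rev (map Ghost p)) u"
    have "set p \<subseteq> arcs E"
      using infinite_path_awalk[OF C_inf[OF qC], of "Suc n"] unfolding p_def by (auto simp: awalk_def)
    then have vN: "v \<in> N" unfolding v_def using u(1) by (rule ghost)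
    have v_iff: "v t = 0 \<longleftrightarrow> u (p @- t) = 0" for t unfolding v_def by (rule wact_ghost_eq_0_iff)
    have "v (sdrop (Suc n) q) \<noteq> 0" using q unfolding v_iff p_def by (simp only: stake_sdrop not_False_eq_True)
    then have v0: "v \<noteq> (\<lambda>_. 0)" by auto
    have sub: "(@-) p ` ?s v \<subseteq> ?s u - {s}"
    proof -
      have "p @- t \<noteq> s" for t
      proof
        assume "p @- t = s"
        then have "s !! n = p ! n" by (auto simp: p_def shift_snth simp del: stake.simps)
        also have "\<dots> = q !! n" unfolding p_def by (rule stake_nth) simp
        finally show False using n by simp
      qed
      then show ?thesis by (auto simp: v_iff)
    qed
    have "card (?s v) = card ((@-) p ` ?s v)" by (subst card_image) (auto simp: inj_on_def)
    also have "\<dots> \<le> card (?s u - {s})" using fin sub by (intro card_mono) simp_all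
    also have "\<dots> < card (?s u)" using fin s by (intro psubset_card_mono) auto
    finally show False using u_min[OF vN v0] by simp
  qed
  define m where "m = u q"
  have "wact (rev (map Ghost (\<tau> q))) u = delta z m"
  proof
    fix t
    show "wact (rev (map Ghost (\<tau> q))) u t = delta z m t"
    proof (cases "t = z")
      case False
      have "\<tau> q @- t \<noteq> q"
      proof
        assume "\<tau> q @- t = q"
        then have "\<tau> q @- t = \<tau> q @- z" using \<tau>_shift[OF qC] by simp
        then show False using False by simp
      qed
      then have "wact (rev (map Ghost (\<tau> q))) u t = 0"
        unfolding wact_ghost_eq_0_iff using single by blast
      then show ?thesis using False by simp
    qed (simp add: m_def wact_ghost_\<tau>[OF qC])
  qed
  then have "delta z m \<in> N" using ghost[OF \<tau>_arcs[OF qC] u(1)] by simp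
  then have "lact (xc ^ degree m) (delta z m) \<in> N" by (intro act) simp_all
  moreover have "fps_X ^ degree m \<rhd> m = [:lead_coeff m:]"
    by (rule poly_eqI) (auto simp: coeff_X_power_contract coeff_pCons coeff_eq_0 split: nat.splits)
  moreover have "delta z [:k:] = chen_emb (Poly_Mapping.single z k)" for k
    by (auto simp: delta_def chen_emb_def lookup_single when_def)
  ultimately have "chen_emb (Poly_Mapping.single z (lead_coeff m)) \<in> N"
    by (simp add: lact_xc_power_delta)
  moreover have "Poly_Mapping.single z (lead_coeff m) \<in> carrier Ch"
    by (simp add: carrier_chen)
  moreover have "chen_emb (Poly_Mapping.single z (lead_coeff m)) z \<noteq> 0"
    using q by (simp add: chen_emb_def m_def)
  then have "chen_emb (Poly_Mapping.single z (lead_coeff m)) \<noteq> \<zero>\<^bsub>TM UF\<^esub>" by auto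
  ultimately show ?thesis by blast
qed

lemma chen_envelope:
  assumes "injective_module TYPE('m) L (TM UF)"
  shows "injective_envelope TYPE('m) L Ch (TM UF)"
  unfolding injective_envelope_def
  using assms chen_left_module chen_emb_hom chen_essential
  by (blast intro: inj_onI chen_emb_inj[THEN iffD1])

end

section \<open>Endomorphisms\<close>

context pruefer
begin

text \<open>Twists are units and can be divided out, so a function supported at q lies in the image
  of every prefix of q. Homomorphisms preserve such images, which confines where a function
  supported at z can go.\<close>

lemma delta_eq_path:
  "q \<in> C \<Longrightarrow> \<exists>m'. delta q m = wact (map Edge (stake n q)) (delta (sdrop n q) m')"
proof (induction n arbitrary: q m)
  case (Suc n)
  from Suc.IH[OF C_stl[OF Suc.prems], of "inverse (tw q) \<rhd> m"] obtain m'
    where m': "delta (stl q) (inverse (tw q) \<rhd> m) = wact (map Edge (stake n (stl q))) (delta (sdrop n (stl q)) m')"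
    by blast
  have "gact (Edge (shd q)) (delta (stl q) (inverse (tw q) \<rhd> m)) = delta q m"
    using gact_Edge_delta[of "shd q" "stl q" "inverse (tw q) \<rhd> m"] Suc.prems by simp
  then show ?case unfolding m' by (intro exI[of _ m']) simp
qed auto

lemma contract_UF: assumes "u \<in> UF" shows "(\<lambda>q. f \<rhd> u q) \<in> UF"
proof -
  have "{q. f \<rhd> u q \<noteq> 0} \<subseteq> {q. u q \<noteq> 0}" by auto
  then have "finite {q. f \<rhd> u q \<noteq> 0}" by (rule finite_subset) (use assms in \<open>simp add: UF_def\<close>)
  moreover have "(\<lambda>q. f \<rhd> u q) \<in> UH" using UH_outside[OF UF_UH[OF assms]] by (intro UHI) simp
  ultimately show ?thesis by (simp add: UF_def)
qed

lemma contract_hom: "(\<lambda>u q. f \<rhd> u q) \<in> module_homs L (TM UF) (TM UF)"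
proof (rule module_homsI)
  fix A u assume A: "A \<in> carrier L" "u \<in> carrier (TM UF)"
  then obtain a where a: "a \<in> FC" "A = cls a" by (auto simp: carrier_L)
  have u: "u \<in> UF" using A by simp
  then show "(\<lambda>q. f \<rhd> (A \<odot>\<^bsub>TM UF\<^esub> u) q) = A \<odot>\<^bsub>TM UF\<^esub> (\<lambda>q. f \<rhd> u q)"
    by (simp add: a TM_smult UF_UH contract_UF) (simp add: fun_eq_iff lact_contract)
qed (simp_all add: contract_UF contract_add_right)

text \<open>An element in the image of every prefix of z is supported at z, so h acts there on K[x]
  alone and commutes with the shift. This makes the images of the x^n compatible contractions of one
  series, and the functions x^n at z generate \<open>UF\<close>.\<close>

lemma endomorphism_contract:
  assumes h: "h \<in> module_homs L (TM UF) (TM UF)"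
  shows "\<exists>f. \<forall>u\<in>UF. h u = (\<lambda>q. f \<rhd> u q)"
proof -
  have hUF: "h u \<in> UF" if "u \<in> UF" for u using module_homsD(1)[OF h] that by simp
  have h_lact: "h (lact a u) = lact a (h u)" if "a \<in> FC" "u \<in> UF" for a u
    using module_homsD(3)[OF h, of "cls a" u] that hUF[of u] by (simp add: TM_smult UF_UH)
  have h_outside: "h (delta z m) q = 0" if "q \<noteq> z" for m q
  proof -
    from \<open>q \<noteq> z\<close> obtain n where n: "q !! n \<noteq> z !! n" using stream_eq_snth by blast
    \<comment> \<open>A prefix of z that q does not share, so everything in the image of this path
      vanishes at q.\<close>
    let ?r = "stake (Suc n) z"
    obtain m' where m': "delta z m = wact (map Edge ?r) (delta (sdrop (Suc n) z) m')"
      using delta_eq_path[OF z_in_C] by blast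
    have "set ?r \<subseteq> arcs E"
      using infinite_path_awalk[OF inf_z, of "Suc n"] by (auto simp only: awalk_def)
    then have "h (delta z m) = wact (map Edge ?r) (h (delta (sdrop (Suc n) z) m'))"
      unfolding m' using h_lact[OF path_FC(1), of ?r "delta (sdrop (Suc n) z) m'"] C_sdrop[OF z_in_C, of "Suc n"]
      by (simp del: stake.simps sdrop.simps)
    moreover have "stake (length ?r) q \<noteq> ?r"
      using n stake_nth[of n "Suc n" q] stake_nth[of n "Suc n" z] by (metis length_stake lessI)
    ultimately show ?thesis using wact_path_eq_0 by simp
  qed
  define w where "w n = h (delta z (monom 1 n)) z" for n
  have h_delta: "h (delta z (monom 1 n)) = delta z (w n)" for n
    by (auto simp: w_def delta_def fun_eq_iff h_outside[unfolded delta_def])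
  have w_shift: "delta z (fps_X ^ i \<rhd> w n) = h (delta z (fps_X ^ i \<rhd> monom 1 n))" for i n
    using h_lact[of "xc ^ i" "delta z (monom 1 n)"] by (simp add: lact_xc_power_delta h_delta)
  have h_zero: "h (\<lambda>_. 0) = (\<lambda>_. 0)"
    using module_homs_zero[OF UF_left_module UF_left_module h] by simp
  then have w_above: "fps_X ^ i \<rhd> w n = 0" if "n < i" for i n
    using fun_cong[OF w_shift[of i n], of z] that by (simp add: contract_X_power_eq_0 degree_monom_eq h_zero)
  have w_below: "fps_X ^ i \<rhd> w n = w (n - i)" if "i \<le> n" for i n
    using fun_cong[OF w_shift[of i n], of z] that by (simp add: contract_X_power_monom h_delta)
  \<comment> \<open>Contracting x^n by f leaves the n-th coefficient of f as constant term, so no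
    other series is possible.\<close>
  define f where "f = Abs_fps (\<lambda>n. coeff (w n) 0)"
  have w_eq: "w n = f \<rhd> monom 1 n" for n
  proof (rule poly_eqI)
    fix i
    have "coeff (w n) i = coeff (fps_X ^ i \<rhd> w n) 0" by (simp add: coeff_X_power_contract)
    then show "coeff (w n) i = coeff (f \<rhd> monom 1 n) i"
      by (simp add: coeff_contract_monom f_def w_above w_below)
  qed
  have "h u = (\<lambda>q. f \<rhd> u q)" if u: "u \<in> UF" for u
  proof -
    obtain n a where a: "a \<in> FC" "u = lact a (\<xi> n)" using UF_generated[OF u] by blast
    have \<xi>: "h (\<xi> n) = (\<lambda>q. f \<rhd> \<xi> n q)" unfolding h_delta w_eq by (auto simp: delta_def)
    have "h u = lact a (h (\<xi> n))" unfolding a(2) by (rule h_lact) (use a in simp_all)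
    also have "\<dots> = (\<lambda>q. f \<rhd> u q)" unfolding \<xi> a(2) by (rule ext) (rule lact_contract)
    finally show ?thesis .
  qed
  then show ?thesis by blast
qed

text \<open>Contraction with a series is conjugated by \<Phi> into an endomorphism of P and
  restricted to the carrier, as members of \<open>End_ring\<close> are extensional.\<close>

lemma End_ring_iso:
  assumes \<Phi>: "\<Phi> \<in> module_isos L (TM UF) P"
  shows "End_ring L P \<simeq> (ring_of_type_algebra :: 'k fps ring)"
proof -
  define \<Phi>' where "\<Phi>' = inv_into UF \<Phi>"
  have hom: "\<Phi> \<in> module_homs L (TM UF) P" and bij: "bij_betw \<Phi> UF (carrier P)"
    using \<Phi> by (simp_all add: module_isos_def)
  have hom': "\<Phi>' \<in> module_homs L P (TM UF)"
    using module_isos_inverse[OF \<Phi> UF_left_module] by (simp add: module_isos_def \<Phi>'_def)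
  have inv1: "\<Phi>' (\<Phi> u) = u" if "u \<in> UF" for u
    unfolding \<Phi>'_def using bij that by (intro inv_into_f_f) (simp_all add: bij_betw_def)
  have inv2: "\<Phi> (\<Phi>' S) = S" if "S \<in> carrier P" for S
    unfolding \<Phi>'_def using bij that by (rule bij_betw_inv_into_right)
  have \<Phi>'_UF: "\<Phi>' S \<in> UF" if "S \<in> carrier P" for S using module_homsD(1)[OF hom' that] by simp
  have \<Phi>_P: "\<Phi> u \<in> carrier P" if "u \<in> UF" for u using module_homsD(1)[OF hom] that by simp
  define \<Psi> where "\<Psi> f = (\<lambda>S\<in>carrier P. \<Phi> (\<lambda>q. f \<rhd> \<Phi>' S q))" for f
  have \<Psi>_P: "\<Psi> f S \<in> carrier P" if "S \<in> carrier P" for f S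
    using that by (simp add: \<Psi>_def \<Phi>_P contract_UF \<Phi>'_UF)
  interpret P: left_module L P using UF_left_module \<Phi> by (rule left_module_transport)
  have \<Psi>_hom: "\<Psi> f \<in> module_homs L P P" for f
  proof -
    have "(\<lambda>S. \<Phi> (\<lambda>q. f \<rhd> \<Phi>' S q)) \<in> module_homs L P P"
      by (rule module_homs_comp[OF module_homs_comp[OF hom' contract_hom] hom])
    then show ?thesis by (auto simp: module_homs_def \<Psi>_def P.smult_closed)
  qed
  have inj: "inj \<Psi>"
  proof (rule injI)
    fix f g assume eq: "\<Psi> f = \<Psi> g"
    have "f $ n = g $ n" for n
    proof -
      \<comment> \<open>This function detects the n-th coefficient of a series, as the constant term
        of the contraction at z.\<close>
      let ?u = "delta z (monom 1 n)"
      have u: "?u \<in> UF" by simp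
      have "(\<lambda>q. f \<rhd> ?u q) = \<Phi>' (\<Phi> (\<lambda>q. f \<rhd> ?u q))"
        by (rule inv1[OF contract_UF[OF u], symmetric])
      also have "\<Phi> (\<lambda>q. f \<rhd> ?u q) = \<Phi> (\<lambda>q. g \<rhd> ?u q)"
        using fun_cong[OF eq, of "\<Phi> ?u"] by (simp add: \<Psi>_def \<Phi>_P[OF u] inv1[OF u])
      also have "\<Phi>' \<dots> = (\<lambda>q. g \<rhd> ?u q)"
        by (rule inv1[OF contract_UF[OF u]])
      finally have "(\<lambda>q. f \<rhd> ?u q) z = (\<lambda>q. g \<rhd> ?u q) z" by (rule fun_cong)
      then have "f \<rhd> monom 1 n = g \<rhd> monom 1 n" by simp
      then have "coeff (f \<rhd> monom 1 n) 0 = coeff (g \<rhd> monom 1 n) 0" by simp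
      then show ?thesis by (simp add: coeff_contract_monom)
    qed
    then show "f = g" by (simp add: fps_eq_iff)
  qed
  have surj: "\<exists>f. H = \<Psi> f" if H: "H \<in> module_homs L P P" "H \<in> extensional (carrier P)" for H
  proof -
    have "(\<lambda>u. \<Phi>' (H (\<Phi> u))) \<in> module_homs L (TM UF) (TM UF)"
      by (rule module_homs_comp[OF module_homs_comp[OF hom H(1)] hom'])
    from endomorphism_contract[OF this] obtain f where f: "\<And>u. u \<in> UF \<Longrightarrow> \<Phi>' (H (\<Phi> u)) = (\<lambda>q. f \<rhd> u q)"
      by blast
    have "H S = \<Psi> f S" if "S \<in> carrier P" for S
    proof -
      have "\<Psi> f S = \<Phi> (\<Phi>' (H (\<Phi> (\<Phi>' S))))" using that by (simp add: \<Psi>_def f[OF \<Phi>'_UF[OF that]])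
      also have "\<dots> = H S" using that inv2 module_homsD(1)[OF H(1)] by simp
      finally show ?thesis ..
    qed
    then have "H = \<Psi> f" using H(2) by (intro extensionalityI[of _ "carrier P"]) (simp_all add: \<Psi>_def)
    then show ?thesis ..
  qed
  have "\<Psi> \<in> ring_iso ring_of_type_algebra (End_ring L P)"
  proof (rule ring_iso_memI)
    fix f g :: "'k fps"
    show "\<Psi> f \<in> carrier (End_ring L P)" using \<Psi>_hom by (simp add: End_ring_def \<Psi>_def)
    show "\<Psi> (f \<otimes>\<^bsub>ring_of_type_algebra\<^esub> g) = \<Psi> f \<otimes>\<^bsub>End_ring L P\<^esub> \<Psi> g"
      by (simp add: ring_of_type_algebra_def End_ring_def compose_def)
        (auto simp: \<Psi>_def contract_assoc inv1 contract_UF \<Phi>'_UF \<Phi>_P intro: restrict_ext)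
    show "\<Psi> (f \<oplus>\<^bsub>ring_of_type_algebra\<^esub> g) = \<Psi> f \<oplus>\<^bsub>End_ring L P\<^esub> \<Psi> g"
      using module_homsD(2)[OF hom]
      by (simp add: ring_of_type_algebra_def End_ring_def)
        (auto simp: \<Psi>_def contract_add_left contract_UF \<Phi>'_UF intro!: restrict_ext)
    show "\<Psi> \<one>\<^bsub>ring_of_type_algebra\<^esub> = \<one>\<^bsub>End_ring L P\<^esub>"
      by (auto simp: ring_of_type_algebra_def End_ring_def \<Psi>_def inv2 intro!: restrict_ext)
    show "bij_betw \<Psi> (carrier ring_of_type_algebra) (carrier (End_ring L P))"
      using inj surj \<Psi>_hom
      by (auto simp: bij_betw_def ring_of_type_algebra_def End_ring_def) (auto simp: \<Psi>_def)
  qed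
  then show ?thesis
    using ring_iso_sym[OF ring_from_type_algebra] by (auto simp: is_ring_iso_def)
qed

end

theorem theorem6p4:
  fixes E :: "('v, 'e) pre_digraph" and c :: "'e list"
  assumes "fin_digraph E"
    and "basic_closed_path E c"
  shows "(injective_module TYPE(('v, 'e, 'k::field) lpa + 'm)
            (leavitt_path_algebra TYPE('k) E) (prufer_module TYPE('k) E c)
          \<longleftrightarrow> maximal_cycle E c) \<and>
         (injective_module TYPE(('v, 'e, 'k) lpa + 'm)
            (leavitt_path_algebra TYPE('k) E) (prufer_module TYPE('k) E c)
          \<longrightarrow> injective_envelope TYPE(('v, 'e, 'k) lpa + 'm) (leavitt_path_algebra TYPE('k) E)
                (chen_module TYPE('k) E (Stream.cycle c)) (prufer_module TYPE('k) E c) \<and>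
              End_ring (leavitt_path_algebra TYPE('k) E) (prufer_module TYPE('k) E c)
                \<simeq> (ring_of_type_algebra :: 'k fps ring))"
proof -
  interpret pruefer E "TYPE('k)" c
    using assms by (intro pruefer.intro leavitt.intro pruefer_axioms.intro)
  let ?P = "prufer_module TYPE('k) E c"
  obtain \<Phi> where \<Phi>: "\<Phi> \<in> module_isos L (TM UF) ?P"
    using prufer_iso by blast
  note \<Phi>' = module_isos_inverse[OF \<Phi> UF_left_module]
  note P = left_module_transport[OF UF_left_module \<Phi>]
  have inj_iff: "injective_module TYPE(('v, 'e, 'k) lpa + 'm) L ?P \<longleftrightarrow>
      injective_module TYPE(('v, 'e, 'k) lpa + 'm) L (TM UF)"
    using injective_module_transport[OF UF_left_module \<Phi>] injective_module_transport[OF P \<Phi>'] by blast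
  have "injective_module TYPE(('v, 'e, 'k) lpa + 'm) L (TM UF)" if "maximal_cycle E c"
    using UH_injective UF_eq_UH[OF C_finite[OF that]] by simp
  moreover have "\<not> injective_module TYPE(('v, 'e, 'k) lpa + 'm) L (TM UF)" if "\<not> maximal_cycle E c"
    using not_maximal_exit[OF that] UF_not_injective by blast
  ultimately have "injective_module TYPE(('v, 'e, 'k) lpa + 'm) L ?P \<longleftrightarrow> maximal_cycle E c"
    unfolding inj_iff by blast
  moreover have "injective_envelope TYPE(('v, 'e, 'k) lpa + 'm) L Ch ?P"
    if "injective_module TYPE(('v, 'e, 'k) lpa + 'm) L ?P"
    using that unfolding inj_iff by (intro injective_envelope_transport[OF UF_left_module \<Phi>] chen_envelope)
  ultimately show ?thesis using End_ring_iso[OF \<Phi>] by blast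
qed


end
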